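(* Let $K$ be an algebraically closed field of characteristic zero, and for positive integers $d,r$ let $S_{d,r}\subset\mathbb{P}(K[u,v]_d)$ be the set of (classes of) binary forms of degree $d$ and Waring rank exactly $r$. Let $d$ be a positive integer, let $k$ be an integer, and suppose that $d\ge d-k>\left\lceil \frac{d+1}{2}\right\rceil$. Then $$\overline{S_{d,d-k}}=\Delta_{3,2^k,1^{d-2k-3}}^\vee ,$$ where the bar denotes Zariski closure in $\mathbb{P}(K[u,v]_d)$ and $\Delta_{3,2^k,1^{d-2k-3}}^\vee\subset\mathbb{P}(K[u,v]_d)$ is the dual variety of the multiple root locus of the partition of $d$ with one part equal to $3$, $k$ parts equal to $2$ and $d-2k-3$ parts equal to $1$.
   Context: The Waring rank of a nonzero form $f\in K[u,v]_d$ is the smallest integer $r$ such that $f=l_1^d+\dots+l_r^d$ for some linear forms $l_1,\dots,l_r\in K[u,v]_1$. It depends only on the class of $f$ up to nonzero scalars. Multiple root locus: for a partition $\lambda=(\lambda_1\ge\dots\ge\lambda_m>0)$ of $d$, the multiple root locus $\Delta_\lambda\subset\mathbb{P}(K[x,y]_d)\cong\mathbb{P}^d$ is the image of the map $(\mathbb{P}^1)^m\to\mathbb{P}^d$, $(l_1,\dots,l_m)\mapsto l_1^{\lambda_1}\cdots l_m^{\lambda_m}$, where points of $\mathbb{P}^1=\mathbb{P}(K[x,y]_1)$ are linear forms up to scalar. It is an irreducible closed subvariety of dimension $m$. Dual variety: the dual projective space of $\mathbb{P}(K[x,y]_d)$ is identified with $\mathbb{P}(K[u,v]_d)$ via the perfect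 pairing $K[x,y]_d\times K[u,v]_d\to K$, $(f,g)\mapsto f\left(\frac{\partial}{\partial u},\frac{\partial}{\partial v}\right)g(u,v)$. The conormal variety of $\Delta_\lambda$ is the Zariski closure of the set of pairs $(f,g)\in\mathbb{P}(K[x,y]_d)\times\mathbb{P}(K[u,v]_d)$ such that $f$ is a smooth point of $\Delta_\lambda$ and $g$ is orthogonal, under this pairing, to the (embedded projective) tangent space $T_f\Delta_\lambda$. The dual variety $\Delta_\lambda^\vee\subset\mathbb{P}(K[u,v]_d)$ is the image of the conormal variety under projection to the second factor. *)

theory Defs
  imports
    "HOL-Analysis.Analysis"
    "HOL-Computational_Algebra.Computational_Algebra"
    "HOL-Library.Poly_Mapping"
    "HOL-Library.Extended_Nat"
begin

section \<open>Binary forms\<close>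

text \<open>
  The ring \<open>K[u,v]\<close> (and likewise \<open>K[x,y]\<close>) is \<open>K[u][v]\<close>, that is, \<^typ>\<open>'a poly poly\<close> with the
  first variable inside: \<open>coeff (coeff f j) i\<close> is the coefficient of \<open>u ^ i * v ^ j\<close>.
\<close>

definition binary_forms :: "nat \<Rightarrow> 'a::field poly poly set" where
  "binary_forms d = {f. \<forall>i j. coeff (coeff f j) i \<noteq> 0 \<longrightarrow> i + j = d}"

abbreviation form_scale :: "'a::field \<Rightarrow> 'a poly poly \<Rightarrow> 'a poly poly" where
  "form_scale c f \<equiv> smult [:c:] f"

global_interpretation forms: vector_space "form_scale :: 'a::field \<Rightarrow> _"
  by unfold_locales (simp_all add: smult_add_right smult_add_left[symmetric] mult.commute flip: one_pCons)

definition partial_u :: "'a::field poly poly \<Rightarrow> 'a poly poly" where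
  "partial_u = map_poly pderiv"

definition partial_v :: "'a::field poly poly \<Rightarrow> 'a poly poly" where
  "partial_v = pderiv"

text \<open>
  \<open>f(\<partial>/\<partial>u, \<partial>/\<partial>v) g(u,v)\<close>. If \<open>f\<close> and \<open>g\<close> are forms of the same degree, the result is a constant,
  and \<open>f\<close> and \<open>g\<close> are orthogonal under the pairing iff it vanishes.
\<close>

definition diff_action :: "'a::field poly poly \<Rightarrow> 'a poly poly \<Rightarrow> 'a poly poly" where
  "diff_action f g =
     (\<Sum>j\<le>degree f. \<Sum>i\<le>degree (coeff f j).
        form_scale (coeff (coeff f j) i) ((partial_u ^^ i) ((partial_v ^^ j) g)))"

definition sum_of_powers :: "nat \<Rightarrow> nat \<Rightarrow> 'a::field poly poly \<Rightarrow> bool" where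
  "sum_of_powers d r f \<longleftrightarrow>
     (\<exists>l :: nat \<Rightarrow> 'a poly poly. (\<forall>i<r. l i \<in> binary_forms 1) \<and> f = (\<Sum>i<r. l i ^ d))"

definition has_waring_rank :: "nat \<Rightarrow> 'a::field poly poly \<Rightarrow> nat \<Rightarrow> bool" where
  "has_waring_rank d f r \<longleftrightarrow> sum_of_powers d r f \<and> (\<forall>s<r. \<not> sum_of_powers d s f)"


section \<open>Multivariate polynomials\<close>

type_synonym ('v, 'a) mpolynomial = "('v \<Rightarrow>\<^sub>0 nat) \<Rightarrow>\<^sub>0 'a"

definition mp_eval :: "('v \<Rightarrow> 'a) \<Rightarrow> ('v, 'a::field) mpolynomial \<Rightarrow> 'a" where
  "mp_eval x F =
     (\<Sum>m\<in>Poly_Mapping.keys F.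
        Poly_Mapping.lookup F m * (\<Prod>i\<in>Poly_Mapping.keys m. x i ^ Poly_Mapping.lookup m i))"

definition mp_partial :: "'v \<Rightarrow> ('v, 'a::field) mpolynomial \<Rightarrow> ('v, 'a) mpolynomial" where
  "mp_partial i F =
     (\<Sum>m\<in>Poly_Mapping.keys F.
        Poly_Mapping.single (m - Poly_Mapping.single i 1)
          (of_nat (Poly_Mapping.lookup m i) * Poly_Mapping.lookup F m))"

definition homogeneous_polys :: "nat \<Rightarrow> (nat, 'a::field) mpolynomial set" where
  "homogeneous_polys d =
     {F. (\<forall>m\<in>Poly_Mapping.keys F. Poly_Mapping.keys m \<subseteq> {..d}) \<and>
         (\<exists>e. \<forall>m\<in>Poly_Mapping.keys F. (\<Sum>i\<le>d. Poly_Mapping.lookup m i) = e)}"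

definition bihomogeneous_polys :: "nat \<Rightarrow> (nat + nat, 'a::field) mpolynomial set" where
  "bihomogeneous_polys d =
     {F. (\<forall>m\<in>Poly_Mapping.keys F. Poly_Mapping.keys m \<subseteq> Inl ` {..d} \<union> Inr ` {..d}) \<and>
         (\<exists>a b. \<forall>m\<in>Poly_Mapping.keys F.
            (\<Sum>i\<le>d. Poly_Mapping.lookup m (Inl i)) = a \<and>
            (\<Sum>i\<le>d. Poly_Mapping.lookup m (Inr i)) = b)}"


section \<open>The projective space of binary forms and its Zariski topology\<close>

definition proj_class :: "'a::field poly poly \<Rightarrow> 'a poly poly set" where
  "proj_class f = {form_scale c f | c. c \<noteq> 0}"

definition form_coord :: "nat \<Rightarrow> 'a::field poly poly \<Rightarrow> nat \<Rightarrow> 'a" where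
  "form_coord d f j = coeff (coeff f j) (d - j)"

text \<open>
  The topologies below have the non-vanishing loci of (bi)homogeneous polynomials in the
  coefficients as a basis, so their closed sets are the common zero loci of such polynomials.
  Taking for \<open>F\<close> the constant 1 shows that the underlying spaces are \<open>P(K[u,v]_d)\<close> and
  \<open>P(K[x,y]_d) \<times> P(K[u,v]_d)\<close>.
\<close>

definition zariski :: "nat \<Rightarrow> 'a::field poly poly set topology" where
  "zariski d = topology_generated_by
     {{proj_class f | f. f \<in> binary_forms d - {0} \<and> mp_eval (form_coord d f) F \<noteq> 0}
      | F. F \<in> homogeneous_polys d}"

definition zariski_prod :: "nat \<Rightarrow> ('a::field poly poly set \<times> 'a poly poly set) topology" where
  "zariski_prod d = topology_generated_by
     {{(proj_class f, proj_class g) | f g.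
         f \<in> binary_forms d - {0} \<and> g \<in> binary_forms d - {0} \<and>
         mp_eval (case_sum (form_coord d f) (form_coord d g)) F \<noteq> 0}
      | F. F \<in> bihomogeneous_polys d}"

definition irreducible_closed :: "'b topology \<Rightarrow> 'b set \<Rightarrow> bool" where
  "irreducible_closed T Z \<longleftrightarrow>
     closedin T Z \<and> Z \<noteq> {} \<and>
     (\<forall>A B. closedin T A \<longrightarrow> closedin T B \<longrightarrow> Z \<subseteq> A \<union> B \<longrightarrow> Z \<subseteq> A \<or> Z \<subseteq> B)"

text \<open>The Krull dimension of a closed subset \<open>X\<close> (0 if \<open>X\<close> is empty).\<close>

definition krull_dim :: "'b topology \<Rightarrow> 'b set \<Rightarrow> enat" where
  "krull_dim T X =
     Sup {enat n | n. \<exists>Z :: nat \<Rightarrow> 'b set.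
       (\<forall>i\<le>n. irreducible_closed T (Z i) \<and> Z i \<subseteq> X) \<and> (\<forall>i<n. Z i \<subset> Z (Suc i))}"


section \<open>Tangent spaces and dual varieties\<close>

definition vanishing_polys ::
    "nat \<Rightarrow> 'a::field poly poly set set \<Rightarrow> (nat, 'a) mpolynomial set" where
  "vanishing_polys d X =
     {F \<in> homogeneous_polys d.
        \<forall>f \<in> binary_forms d - {0}. proj_class f \<in> X \<longrightarrow> mp_eval (form_coord d f) F = 0}"

text \<open>
  The linear subspace of \<open>K[x,y]_d\<close> whose projectivization is the embedded projective tangent
  space of \<open>X\<close> at the class of \<open>f\<close>.
\<close>

definition tangent_space ::
    "nat \<Rightarrow> 'a::field poly poly set set \<Rightarrow> 'a poly poly \<Rightarrow> 'a poly poly set" where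
  "tangent_space d X f =
     {h \<in> binary_forms d. \<forall>F \<in> vanishing_polys d X.
        (\<Sum>i\<le>d. mp_eval (form_coord d f) (mp_partial i F) * form_coord d h i) = 0}"

text \<open>
  Smoothness of an irreducible closed \<open>X\<close> at the class of \<open>f\<close>; the summand 1 passes from
  projective to linear dimension.
\<close>

definition smooth_point :: "nat \<Rightarrow> 'a::field poly poly set set \<Rightarrow> 'a poly poly \<Rightarrow> bool" where
  "smooth_point d X f \<longleftrightarrow>
     f \<in> binary_forms d - {0} \<and> proj_class f \<in> X \<and>
     enat (forms.dim (tangent_space d X f)) = krull_dim (zariski d) X + 1"

definition conormal_variety ::
    "nat \<Rightarrow> 'a::field poly poly set set \<Rightarrow> ('a poly poly set \<times> 'a poly poly set) set" where
  "conormal_variety d X =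
     zariski_prod d closure_of
       {(proj_class f, proj_class g) | f g.
          smooth_point d X f \<and> g \<in> binary_forms d - {0} \<and>
          (\<forall>h \<in> tangent_space d X f. diff_action h g = 0)}"

definition dual_variety ::
    "nat \<Rightarrow> 'a::field poly poly set set \<Rightarrow> 'a poly poly set set" where
  "dual_variety d X = snd ` conormal_variety d X"


section \<open>Waring rank strata and multiple root loci\<close>

definition waring_stratum :: "nat \<Rightarrow> nat \<Rightarrow> 'a::field poly poly set set" where
  "waring_stratum d r = {proj_class f | f. f \<in> binary_forms d - {0} \<and> has_waring_rank d f r}"

text \<open>The partition is given as the list \<open>p\<close> of its parts; the locus consists of forms of degree \<open>sum_list p\<close>.\<close>

definition multiple_root_locus :: "nat list \<Rightarrow> 'a::field poly poly set set" where
  "multiple_root_locus p =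
     {proj_class (\<Prod>i<length p. l i ^ (p ! i)) | l. \<forall>i<length p. l i \<in> binary_forms 1 - {0}}"

end

theory Submission
  imports Defs "Jordan_Normal_Form.Determinant"
begin

text \<open>
  Both sides equal the set of forms \<open>g\<close> annihilated by some \<open>l\<^sup>2 m\<^sub>1 \<cdots> m\<^sub>k\<close> with nonzero linear
  forms \<open>l, m\<^sub>i\<close>.

  Dual variety: for every partition \<open>e\<close> of \<open>d\<close> with \<open>M\<close> parts, the tangent space of the multiple root
  locus at a general \<open>\<Prod>l\<^sub>i\<^bsup>e\<^sub>i\<^esup>\<close> is \<open>\<Prod>l\<^sub>i\<^bsup>e\<^sub>i - 1\<^esup> \<cdot> K[x,y]\<^sub>M\<close>. The inclusion \<open>\<supseteq>\<close> persists at every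
  point, because it is a polynomial identity in the \<open>l\<^sub>i\<close>; the dimension bound is generic smoothness,
  read off from minimal algebraic relations over a transcendence basis of the coordinates. Hence
  every point of the conormal variety projects to a form annihilated by some \<open>\<Prod>l\<^sub>i\<^bsup>e\<^sub>i - 1\<^esup>\<close>, a
  condition that is closed by elimination along \<open>M\<close> projective lines. Conversely, an annihilated
  form deforms along with the \<open>l\<^sub>i\<close> by Cramer's rule, so it is a limit of general conormal points.

  Waring rank: if \<open>h\<close> of degree \<open>n\<close> annihilates \<open>g\<close> and no form of smaller degree does, then a second
  generator of degree \<open>d + 2 - n\<close> exists that is coprime to \<open>h\<close>, and a general member of the pencil
  they span is squarefree, so the rank is at most \<open>d + 2 - n\<close>. A squarefree annihilator of smaller
  degree would have to be a multiple of \<open>h\<close>; hence the rank is exactly \<open>d + 2 - n\<close> if \<open>h\<close> has a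
  multiple root, and it is at most \<open>n\<close> otherwise.
\<close>

text \<open>Lowering each part of the partition by one gives the exponents
  \<open>2, 1, ..., 1, 0, ..., 0\<close>, so orthogonality to a general tangent space means
  annihilation by a form of degree \<open>k + 2\<close> with a square factor. The rank
  \<open>d - k\<close> is the complementary degree \<open>d + 2 - (k + 2)\<close>, and the bound on
  \<open>d - k\<close> puts \<open>k + 2\<close> strictly below it; this is what makes the square
  visible in the rank. Two obstacles shape the rest. Smoothness is measured against a Krull
  dimension, so chains inside the locus must be bounded: each strict step yields one more
  algebraically independent function on the cone. And closures are reached only along polynomial
  curves: a line of parameters joins the given point to one in general position, each genericity
  condition is a nonzero polynomial on that line, and finitely many such conditions hold together at
  some parameter of an infinite field. Roots at infinity occur everywhere: a polynomial
  \<open>h\<close> carries a nominal degree \<open>n\<close>, and \<open>n - degree h\<close> is its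
  multiplicity at infinity.\<close>

hide_const (open) module.smult

section \<open>Polynomial functions\<close>

text \<open>The functions generated by \<open>C\<close>: with \<open>C = {id}\<close> the polynomials in one variable, and with
  coordinate functions for \<open>C\<close> those in several variables.\<close>

inductive polyfun :: "('x \<Rightarrow> 'a::comm_ring_1) set \<Rightarrow> ('x \<Rightarrow> 'a) \<Rightarrow> bool" for C where
  const: "polyfun C (\<lambda>x. c)"
| gen: "g \<in> C \<Longrightarrow> polyfun C g"
| add: "polyfun C f \<Longrightarrow> polyfun C g \<Longrightarrow> polyfun C (\<lambda>x. f x + g x)"
| mult: "polyfun C f \<Longrightarrow> polyfun C g \<Longrightarrow> polyfun C (\<lambda>x. f x * g x)"

abbreviation curvefun :: "('a::comm_ring_1 \<Rightarrow> 'a) \<Rightarrow> bool" where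
  "curvefun \<equiv> polyfun {\<lambda>t. t}"

definition coords :: "'i set \<Rightarrow> (('i \<Rightarrow> 'a) \<Rightarrow> 'a) set" where
  "coords I = (\<lambda>i x. x i) ` I"

lemma polyfun_compose:
  assumes "polyfun C f" "\<And>g. g \<in> C \<Longrightarrow> polyfun C' (\<lambda>x. g (\<phi> x))"
  shows "polyfun C' (\<lambda>x. f (\<phi> x))"
  using assms by (induction rule: polyfun.induct) (auto intro: polyfun.intros)

lemma polyfun_compose_coords:
  assumes "polyfun (coords I) f" "\<And>i. i \<in> I \<Longrightarrow> polyfun C (\<lambda>x. \<phi> x i)"
  shows "polyfun C (\<lambda>x. f (\<phi> x))"
  by (rule polyfun_compose[OF assms(1)]) (auto simp: coords_def assms(2))

lemma polyfun_mono: "polyfun C f \<Longrightarrow> C \<subseteq> C' \<Longrightarrow> polyfun C' f"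
  by (induction rule: polyfun.induct) (auto intro: polyfun.intros)

lemma polyfun_coord: "i \<in> I \<Longrightarrow> polyfun (coords I) (\<lambda>x. x i)"
  by (rule polyfun.gen) (auto simp: coords_def)

lemma polyfun_id: "curvefun (\<lambda>t. t)"
  by (rule polyfun.gen) auto

lemma polyfun_uminus: "polyfun C f \<Longrightarrow> polyfun C (\<lambda>x. - f x)"
  using polyfun.mult[OF polyfun.const[of C "-1"], of f] by simp

lemma polyfun_diff: "polyfun C f \<Longrightarrow> polyfun C g \<Longrightarrow> polyfun C (\<lambda>x. f x - g x)"
  using polyfun.add[OF _ polyfun_uminus, of C f g] by simp

lemma polyfun_sum: "(\<And>i. i \<in> A \<Longrightarrow> polyfun C (f i)) \<Longrightarrow> polyfun C (\<lambda>x. \<Sum>i\<in>A. f i x)"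
  by (induction A rule: infinite_finite_induct) (auto intro: polyfun.intros)

lemma polyfun_prod: "(\<And>i. i \<in> A \<Longrightarrow> polyfun C (f i)) \<Longrightarrow> polyfun C (\<lambda>x. \<Prod>i\<in>A. f i x)"
  by (induction A rule: infinite_finite_induct) (auto intro: polyfun.intros)

lemma polyfun_power: "polyfun C f \<Longrightarrow> polyfun C (\<lambda>x. f x ^ n)"
  by (induction n) (auto intro: polyfun.intros)

lemma polyfun_if: "polyfun C f \<Longrightarrow> polyfun C g \<Longrightarrow> polyfun C (\<lambda>x. if b then f x else g x)"
  by (cases b) auto

lemmas polyfun_intros = polyfun.const polyfun.add polyfun.mult polyfun_id polyfun_uminus
  polyfun_diff polyfun_sum polyfun_prod polyfun_power polyfun_if

lemma polyfun_coeff_mult: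
  assumes "\<And>i. polyfun C (\<lambda>x. coeff (P x) i)" "\<And>i. polyfun C (\<lambda>x. coeff (Q x) i)"
  shows "polyfun C (\<lambda>x. coeff (P x * Q x) i)"
  unfolding coeff_mult by (intro polyfun_intros assms)

lemma polyfun_coeff_power:
  assumes "\<And>i. polyfun C (\<lambda>x. coeff (P x) i)"
  shows "polyfun C (\<lambda>x. coeff (P x ^ n) i)"
proof (induction n arbitrary: i)
  case 0
  then show ?case by (auto intro: polyfun_intros)
next
  case (Suc n)
  then show ?case by (auto intro!: polyfun_coeff_mult assms)
qed

lemma polyfun_coeff_prod:
  assumes "\<And>k i. k \<in> A \<Longrightarrow> polyfun C (\<lambda>x. coeff (P k x) i)"
  shows "polyfun C (\<lambda>x. coeff (\<Prod>k\<in>A. P k x) i)"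
  using assms
proof (induction A arbitrary: i rule: infinite_finite_induct)
  case (insert a A)
  then show ?case by (auto intro!: polyfun_coeff_mult)
qed (auto intro: polyfun_intros)

lemma polyfun_coeff_linear:
  assumes "polyfun C f" "polyfun C g"
  shows "polyfun C (\<lambda>x. coeff [:f x, g x:] i)"
proof -
  have "(\<lambda>x. coeff [:f x, g x:] i) = (\<lambda>x. if i = 0 then f x else if i = 1 then g x else 0)"
    by (auto simp: coeff_pCons split: nat.splits)
  then show ?thesis by (simp only:) (intro polyfun_intros assms)
qed

section \<open>Polynomial curves and general parameters\<close>

lemma curvefun_poly: 
  assumes "curvefun f" 
  shows "\<exists>p. f = poly p"
  using assms
proof (induction rule: polyfun.induct)
  case (const c)
  show ?case by (rule exI[of _ "[:c:]"]) auto
next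
  case (gen g)
  then show ?case by (intro exI[of _ "[:0,1:]"]) auto
next
  case (add f g)
  then obtain p q where "f = poly p" "g = poly q" by auto
  then show ?case by (intro exI[of _ "p+q"]) auto
next
  case (mult f g)
  then obtain p q where "f = poly p" "g = poly q" by auto
  then show ?case by (intro exI[of _ "p*q"]) auto
qed

text \<open>A nonzero polynomial in one variable has finitely many roots. "For cofinitely many
  \<open>t\<close>" is the working notion of general position, since such conditions can be
  intersected.\<close>

lemma curvefun_generic:
  fixes f :: "'a::idom \<Rightarrow> 'a"
  assumes "curvefun f" "f t0 \<noteq> 0"
  shows "\<forall>\<^sub>F t in cofinite. f t \<noteq> 0"
proof -
  obtain p where p: "f = poly p" using curvefun_poly[OF assms(1)] by blast
  then have "p \<noteq> 0" using assms(2) by auto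
  then show ?thesis using poly_roots_finite[of p] p by (simp add: eventually_cofinite)
qed

lemma cofinite_ex:
  assumes "\<forall>\<^sub>F t in cofinite. P (t::'a::field_char_0)"
  shows "\<exists>t. P t"
proof (rule ccontr)
  assume "\<not> ?thesis"
  then have "{t. \<not> P t} = UNIV" by auto
  then show False using assms infinite_UNIV_char_0[where 'a='a] by (simp add: eventually_cofinite)
qed

text \<open>The principle that carries identities from general parameters to degenerate ones: an
  exceptional value would again be exceptional for almost all \<open>t\<close>.\<close>

lemma curvefun_eq_0:
  fixes f :: "'a::field_char_0 \<Rightarrow> 'a"
  assumes "curvefun f" "\<forall>\<^sub>F t in cofinite. f t = 0"
  shows "f t0 = 0"
proof (rule ccontr)
  assume "f t0 \<noteq> 0"
  from eventually_conj[OF curvefun_generic[OF assms(1) this] assms(2)]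
  have "\<forall>\<^sub>F t::'a in cofinite. False" by eventually_elim auto
  then show False using cofinite_ex by blast
qed

definition lineseg :: "(nat \<Rightarrow> 'a) \<Rightarrow> (nat \<Rightarrow> 'a) \<Rightarrow> 'a \<Rightarrow> nat \<Rightarrow> 'a::comm_ring_1" where
  "lineseg x y t i = (1 - t) * x i + t * y i"

lemma lineseg_simps [simp]: "lineseg x y 0 = x" "lineseg x y 1 = y"
  by (auto simp: lineseg_def)

lemma curvefun_lineseg: "polyfun (coords UNIV) f \<Longrightarrow> curvefun (\<lambda>t. f (lineseg x y t))"
  by (erule polyfun_compose_coords) (auto simp: lineseg_def intro!: polyfun_intros)

text \<open>Irreducibility of affine space: on the line joining the two witnesses each function has
  finitely many zeros.\<close>

lemma polyfun_common_nonzero: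
  fixes f g :: "(nat \<Rightarrow> 'a::field_char_0) \<Rightarrow> 'a"
  assumes "polyfun (coords UNIV) f" "polyfun (coords UNIV) g" "f x \<noteq> 0" "g y \<noteq> 0"
  shows "\<exists>z. f z \<noteq> 0 \<and> g z \<noteq> 0"
proof -
  have "\<forall>\<^sub>F t in cofinite. f (lineseg x y t) \<noteq> 0"
    using assms(3) by (intro curvefun_generic[where ?t0.0=0] curvefun_lineseg assms) auto
  moreover have "\<forall>\<^sub>F t in cofinite. g (lineseg x y t) \<noteq> 0"
    using assms(4) by (intro curvefun_generic[where ?t0.0=1] curvefun_lineseg assms) auto
  ultimately have "\<forall>\<^sub>F t in cofinite. f (lineseg x y t) \<noteq> 0 \<and> g (lineseg x y t) \<noteq> 0"
    by (rule eventually_conj)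
  then show ?thesis using cofinite_ex by blast
qed

lemma polyfun_prod_nonzero:
  fixes f :: "'i \<Rightarrow> (nat \<Rightarrow> 'a::field_char_0) \<Rightarrow> 'a"
  assumes "finite A" "\<And>i. i \<in> A \<Longrightarrow> polyfun (coords UNIV) (f i)" "\<And>i. i \<in> A \<Longrightarrow> \<exists>x. f i x \<noteq> 0"
  shows "\<exists>x. (\<Prod>i\<in>A. f i x) \<noteq> 0"
  using assms
proof (induction A rule: finite_induct)
  case (insert a A)
  obtain x where x: "f a x \<noteq> 0" using insert.prems(2)[of a] by auto
  obtain y where y: "(\<Prod>i\<in>A. f i y) \<noteq> 0" using insert.IH insert.prems by auto
  have "\<exists>z. f a z \<noteq> 0 \<and> (\<Prod>i\<in>A. f i z) \<noteq> 0"
    by (rule polyfun_common_nonzero[where x=x and y=y]) (use x y insert.prems in \<open>auto intro!: polyfun_prod\<close>)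
  then show ?case using insert by auto
qed auto

section \<open>Determinants\<close>

text \<open>The matrix is a plain function of two indices, so that determinants with entries
  depending on a parameter are visibly polynomial functions of it.\<close>

definition dt :: "nat \<Rightarrow> (nat \<Rightarrow> nat \<Rightarrow> 'a::comm_ring_1) \<Rightarrow> 'a" where
  "dt n M = Determinant.det (Matrix.mat n n (\<lambda>(i,j). M i j))"

lemma dt_leibniz: "dt n M = (\<Sum>p | p permutes {0..<n}. signof p * (\<Prod>i=0..<n. M i (p i)))"
proof -
  have "dt n M = (\<Sum>p | p permutes {0..<n}. signof p * (\<Prod>i=0..<n. Matrix.mat n n (\<lambda>(i,j). M i j) $$ (i, p i)))"
    unfolding dt_def by (rule det_def') auto
  also have "\<dots> = (\<Sum>p | p permutes {0..<n}. signof p * (\<Prod>i=0..<n. M i (p i)))"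
    by (intro sum.cong refl arg_cong[where f="\<lambda>x. _ * x"] prod.cong)
       (auto dest: permutes_in_image)
  finally show ?thesis .
qed

lemma polyfun_dt:
  assumes "\<And>i j. i < n \<Longrightarrow> j < n \<Longrightarrow> polyfun C (\<lambda>x. M x i j)"
  shows "polyfun C (\<lambda>x. dt n (M x))"
  unfolding dt_leibniz
  by (intro polyfun_sum polyfun.mult polyfun.const polyfun_prod assms)
     (auto dest: permutes_in_image)

lemma dt_eq_0_iff:
  fixes M :: "nat \<Rightarrow> nat \<Rightarrow> 'a::field"
  shows "dt n M = 0 \<longleftrightarrow> (\<exists>v. (\<exists>j<n. v j \<noteq> 0) \<and> (\<forall>i<n. (\<Sum>j<n. M i j * v j) = 0))"
proof -
  let ?A = "Matrix.mat n n (\<lambda>(i,j). M i j)"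
  have eq: "(?A *\<^sub>v w = 0\<^sub>v n) \<longleftrightarrow> (\<forall>i<n. (\<Sum>j<n. M i j * vec_index w j) = 0)" if "w \<in> carrier_vec n" for w
    using that by (auto simp: vec_eq_iff scalar_prod_def lessThan_atLeast0 intro!: sum.cong)
  have "dt n M = 0 \<longleftrightarrow> (\<exists>w. w \<in> carrier_vec n \<and> w \<noteq> 0\<^sub>v n \<and> ?A *\<^sub>v w = 0\<^sub>v n)"
    unfolding dt_def by (rule det_0_iff_vec_prod_zero) auto
  also have "\<dots> \<longleftrightarrow> (\<exists>v. (\<exists>j<n. v j \<noteq> 0) \<and> (\<forall>i<n. (\<Sum>j<n. M i j * v j) = 0))" (is "?L \<longleftrightarrow> ?R")
  proof
    assume ?L
    then obtain w where w: "w \<in> carrier_vec n" "w \<noteq> 0\<^sub>v n" "?A *\<^sub>v w = 0\<^sub>v n" by blast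
    have "\<exists>j<n. vec_index w j \<noteq> 0"
      using w(1,2) by (auto simp: vec_eq_iff)
    moreover have "\<forall>i<n. (\<Sum>j<n. M i j * vec_index w j) = 0" using eq[OF w(1)] w(3) by blast
    ultimately show ?R by (intro exI[of _ "vec_index w"]) auto
  next
    assume ?R
    then obtain v where v: "\<exists>j<n. v j \<noteq> 0" "\<forall>i<n. (\<Sum>j<n. M i j * v j) = 0" by blast
    have "Matrix.vec n v \<noteq> 0\<^sub>v n" using v(1) by (auto simp: vec_eq_iff)
    moreover have "?A *\<^sub>v Matrix.vec n v = 0\<^sub>v n" using v(2) by (subst eq) auto
    ultimately show ?L by (intro exI[of _ "Matrix.vec n v"]) auto
  qed
  finally show ?thesis .
qed

lemma dt_transpose: "dt n (\<lambda>i j. M j i) = dt n M"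
proof -
  have "Matrix.mat n n (\<lambda>(i,j). M j i) = transpose_mat (Matrix.mat n n (\<lambda>(i,j). M i j))"
    by (auto simp: mat_eq_iff)
  then show ?thesis unfolding dt_def by (metis det_transpose mat_carrier)
qed

text \<open>The entry \<open>(i, j)\<close> of the adjugate: the index shifts skip row
  \<open>j\<close> and column \<open>i\<close>. Written out by minors, its entries are polynomial
  functions whenever those of \<open>M\<close> are.\<close>

definition adj :: "nat \<Rightarrow> (nat \<Rightarrow> nat \<Rightarrow> 'a::comm_ring_1) \<Rightarrow> nat \<Rightarrow> nat \<Rightarrow> 'a" where
  "adj n M i j = (-1)^(j+i) * dt (n-1) (\<lambda>i' j'. M (if i' < j then i' else Suc i') (if j' < i then j' else Suc j'))"

lemma polyfun_adj:
  assumes "\<And>i j. i < n \<Longrightarrow> j < n \<Longrightarrow> polyfun C (\<lambda>x. M x i j)"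
  shows "polyfun C (\<lambda>x. adj n (M x) i j)"
  unfolding adj_def by (intro polyfun.mult polyfun.const polyfun_dt assms) auto

lemma adj_right:
  fixes M :: "nat \<Rightarrow> nat \<Rightarrow> 'a::comm_ring_1"
  assumes "i < n" "k < n"
  shows "(\<Sum>j<n. M i j * adj n M j k) = (if i = k then dt n M else 0)"
proof -
  let ?A = "Matrix.mat n n (\<lambda>(i,j). M i j)"
  have A: "?A \<in> carrier_mat n n" by auto
  have adj: "adj_mat ?A $$ (j,k) = adj n M j k" if "j < n" for j
  proof -
    have "mat_delete ?A k j = Matrix.mat (n-1) (n-1) 
      (\<lambda>(i', j'). M (if i' < k then i' else Suc i') (if j' < j then j' else Suc j'))"
      using that assms by (auto simp: mat_delete_def mat_eq_iff)
    then show ?thesis using that assms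
      by (simp add: adj_mat_def cofactor_def adj_def dt_def)
  qed
  have dims: "dim_row (adj_mat ?A) = n" "dim_col (adj_mat ?A) = n" by (auto simp: adj_mat_def)
  have "(\<Sum>j<n. M i j * adj n M j k) = (?A * adj_mat ?A) $$ (i,k)"
    using assms dims by (simp add: scalar_prod_def lessThan_atLeast0 adj)
  also have "?A * adj_mat ?A = Determinant.det ?A \<cdot>\<^sub>m 1\<^sub>m n" using adj_mat[OF A] by simp
  also have "\<dots> $$ (i,k) = (if i = k then dt n M else 0)" using assms by (simp add: dt_def)
  finally show ?thesis .
qed

text \<open>Gaussian elimination by induction on the equations: an unknown \<open>p\<close> with
  nonzero coefficient in \<open>e\<close> is solved for, which costs one equation and one
  unknown.\<close>

lemma homogeneous_system_nontrivial:
  fixes c :: "'e \<Rightarrow> 'j \<Rightarrow> 'a::field"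
  assumes "finite E" "finite J" "card E < card J"
  shows "\<exists>x. (\<exists>j\<in>J. x j \<noteq> 0) \<and> (\<forall>e\<in>E. (\<Sum>j\<in>J. c e j * x j) = 0)"
  using assms
proof (induction E arbitrary: J c rule: finite_induct)
  case empty
  then have "J \<noteq> {}" by auto
  then show ?case by (intro exI[of _ "\<lambda>_. 1"]) auto
next
  case (insert e E)
  show ?case
  proof (cases "\<forall>j\<in>J. c e j = 0")
    case True
    have "card E < card J" using insert by auto
    from insert.IH[OF insert.prems(1) this] obtain x where
      x: "\<exists>j\<in>J. x j \<noteq> 0" "\<forall>e\<in>E. (\<Sum>j\<in>J. c e j * x j) = 0" by blast
    with True show ?thesis by (intro exI[of _ x]) auto
  next
    case False
    then obtain p where p: "p \<in> J" "c e p \<noteq> 0" by auto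
    let ?J = "J - {p}"
    have "card E < card ?J" using insert p by auto
    from insert.IH[OF _ this, of "\<lambda>e' j. c e' j - c e' p * c e j / c e p"] insert.prems(1) obtain x where
      x: "\<exists>j\<in>?J. x j \<noteq> 0" "\<forall>e'\<in>E. (\<Sum>j\<in>?J. (c e' j - c e' p * c e j / c e p) * x j) = 0" by blast
    define y where "y = x(p := - (\<Sum>j\<in>?J. c e j * x j) / c e p)"
    have sy: "(\<Sum>j\<in>J. c e' j * y j) = c e' p * y p + (\<Sum>j\<in>?J. c e' j * x j)" for e'
    proof -
      have "(\<Sum>j\<in>J. c e' j * y j) = c e' p * y p + (\<Sum>j\<in>?J. c e' j * y j)"
        by (rule sum.remove) (use insert p in auto)
      also have "(\<Sum>j\<in>?J. c e' j * y j) = (\<Sum>j\<in>?J. c e' j * x j)" by (auto simp: y_def)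
      finally show ?thesis .
    qed
    have yp: "y p = - (\<Sum>j\<in>?J. c e j * x j) / c e p" by (simp add: y_def)
    have "(\<Sum>j\<in>J. c e j * y j) = 0" unfolding sy yp using p by simp
    moreover have "(\<Sum>j\<in>J. c e' j * y j) = 0" if "e' \<in> E" for e'
    proof -
      have "(\<Sum>j\<in>?J. (c e' j - c e' p * c e j / c e p) * x j)
        = (\<Sum>j\<in>?J. c e' j * x j) - (\<Sum>j\<in>?J. c e' p / c e p * (c e j * x j))"
        unfolding sum_subtractf[symmetric] by (intro sum.cong) (auto simp: field_simps)
      also have "(\<Sum>j\<in>?J. c e' p / c e p * (c e j * x j)) = c e' p / c e p * (\<Sum>j\<in>?J. c e j * x j)"
        by (rule sum_distrib_left[symmetric])
      finally show ?thesis unfolding sy yp using x(2) that by (auto simp: field_simps)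
    qed
    moreover have "\<exists>j\<in>J. y j \<noteq> 0" using x(1) by (auto simp: y_def)
    ultimately show ?thesis by (intro exI[of _ y]) auto
  qed
qed

section \<open>Elimination of a projective point\<close>

text \<open>Zariski closedness in the space of all sequences. Infinitely many coordinates leave room
  for the linear forms next to the form they constrain; each separating function uses only finitely
  many of them.\<close>

definition aclosed :: "(nat \<Rightarrow> 'a::field) set \<Rightarrow> bool" where
  "aclosed Y \<longleftrightarrow> (\<forall>x. x \<notin> Y \<longrightarrow> (\<exists>f. polyfun (coords UNIV) f \<and> f x \<noteq> 0 \<and> (\<forall>y\<in>Y. f y = 0)))"

lemma poly_eq_sum_le:
  fixes p :: "'a::comm_ring_1 poly"
  shows "degree p \<le> N \<Longrightarrow> poly p x = (\<Sum>i\<le>N. coeff p i * x ^ i)"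
  by (simp add: poly_altdef sum.mono_neutral_left[of "{..N}" "{..degree p}"] coeff_eq_0)

lemma infinite_poly_zero:
  fixes p :: "'a::field_char_0 poly"
  assumes "\<And>r. r \<noteq> 0 \<Longrightarrow> poly p r = 0"
  shows "p = 0"
proof (rule ccontr)
  assume "p \<noteq> 0"
  then have "finite {r. poly p r = 0}" by (rule poly_roots_finite)
  moreover have "UNIV - {0} \<subseteq> {r. poly p r = 0}" using assms by auto
  ultimately have "finite (UNIV - {0::'a})" by (rule finite_subset[rotated])
  then show False using infinite_UNIV_char_0[where 'a='a] by simp
qed

text \<open>Separates the homogeneous components of a function that vanishes on a cone. The value
  \<open>r = 0\<close> is left out because projective classes allow only nonzero scalars.\<close>

lemma power_sum_coeffs_zero:
  fixes c :: "nat \<Rightarrow> 'a::field_char_0"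
  assumes "\<And>r. r \<noteq> 0 \<Longrightarrow> (\<Sum>e\<le>N. c e * r ^ e) = 0" "e \<le> N"
  shows "c e = 0"
proof -
  define p where "p = (\<Sum>e\<le>N. monom (c e) e)"
  have "poly p r = (\<Sum>e\<le>N. c e * r ^ e)" for r by (simp add: p_def poly_sum poly_monom)
  then have "p = 0" using assms by (intro infinite_poly_zero) auto
  moreover have "coeff p e = c e" using assms(2)
    by (simp add: p_def coeff_sum if_distrib cong: if_cong)
  ultimately show ?thesis by simp
qed

text \<open>Reads \<open>f\<close> as a polynomial in the coordinates \<open>a\<close> (inner
  variable) and \<open>b\<close> (outer variable) with coefficients depending on the point. The
  bound \<open>N\<close> is uniform in \<open>x\<close>, so the splitting into bihomogeneous pieces
  is the same at all points.\<close>

lemma polyfun_bipoly: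
  fixes f :: "(nat \<Rightarrow> 'a::field) \<Rightarrow> 'a"
  assumes "polyfun (coords UNIV) f" "a \<noteq> b"
  shows "\<exists>P N. (\<forall>i j. polyfun (coords UNIV) (\<lambda>x. coeff (coeff (P x) j) i)) \<and>
     (\<forall>x. degree (P x) \<le> N \<and> (\<forall>j. degree (coeff (P x) j) \<le> N)) \<and>
     (\<forall>x s t. f (x(a := s, b := t)) = poly (poly (P x) [:t:]) s)"
  using assms(1)
proof (induction rule: polyfun.induct)
  case (const c)
  have "polyfun (coords UNIV) (\<lambda>x::nat \<Rightarrow> 'a. coeff (coeff [:[:c:]:] j) i)" for i j
    by (rule polyfun.const)
  then show ?case
    by (intro exI[of _ "\<lambda>_. [:[:c:]:]"] exI[of _ 0]) (auto simp: coeff_pCons split: nat.splits)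
next
  case (gen g)
  then obtain k where k: "g = (\<lambda>x. x k)" by (auto simp: coords_def)
  consider "k = a" | "k = b" | "k \<noteq> a" "k \<noteq> b" by auto
  then show ?case
  proof cases
    case 1
    have "polyfun (coords UNIV) (\<lambda>x::nat \<Rightarrow> 'a. coeff (coeff [:[:0,1::'a:]:] j) i)" for i j
      by (rule polyfun.const)
    then show ?thesis using 1 assms(2)
      by (intro exI[of _ "\<lambda>_. [:[:0,1:]:]"] exI[of _ 1]) (auto simp: k coeff_pCons split: nat.splits)
  next
    case 2
    have "polyfun (coords UNIV) (\<lambda>x::nat \<Rightarrow> 'a. coeff (coeff [:0, [:1::'a:]:] j) i)" for i j
      by (rule polyfun.const)
    then show ?thesis using 2 assms(2)
      by (intro exI[of _ "\<lambda>_. [:0, [:1:]:]"] exI[of _ 1]) (auto simp: k coeff_pCons split: nat.splits)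
  next
    case 3
    have "polyfun (coords UNIV) (\<lambda>x::nat \<Rightarrow> 'a. coeff (coeff [:[:x k:]:] j) i)" for i j
    proof -
      have "(\<lambda>x::nat \<Rightarrow> 'a. coeff (coeff [:[:x k:]:] j) i) = (\<lambda>x. if i = 0 \<and> j = 0 then x k else 0)"
        by (auto simp: coeff_pCons split: nat.splits)
      then show ?thesis by (simp only:) (intro polyfun_intros polyfun_coord UNIV_I)
    qed
    then show ?thesis using 3
      by (intro exI[of _ "\<lambda>x. [:[:x k:]:]"] exI[of _ 0]) (auto simp: k coeff_pCons split: nat.splits)
  qed
next
  case (add f g)
  then obtain P N Q N' where 
    P: "\<forall>i j. polyfun (coords UNIV) (\<lambda>x. coeff (coeff (P x) j) i)"
      "\<forall>x. degree (P x) \<le> N \<and> (\<forall>j. degree (coeff (P x) j) \<le> N)"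
      "\<forall>x s t. f (x(a := s, b := t)) = poly (poly (P x) [:t:]) s" and
    Q: "\<forall>i j. polyfun (coords UNIV) (\<lambda>x. coeff (coeff (Q x) j) i)"
      "\<forall>x. degree (Q x) \<le> N' \<and> (\<forall>j. degree (coeff (Q x) j) \<le> N')"
      "\<forall>x s t. g (x(a := s, b := t)) = poly (poly (Q x) [:t:]) s" by blast
  show ?case
  proof (intro exI[of _ "\<lambda>x. P x + Q x"] exI[of _ "N + N'"] conjI allI)
    show "polyfun (coords UNIV) (\<lambda>x. coeff (coeff (P x + Q x) j) i)" for i j
      using P Q by (auto intro: polyfun_intros)
    show "degree (P x + Q x) \<le> N + N'" for x
      using P(2) Q(2) by (meson degree_add_le le_add1 le_add2 le_trans)
    show "degree (coeff (P x + Q x) j) \<le> N + N'" for x j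
      unfolding coeff_add using P(2) Q(2) by (meson degree_add_le le_add1 le_add2 le_trans)
  qed (simp add: P(3) Q(3) del: fun_upd_apply)
next
  case (mult f g)
  then obtain P N Q N' where 
    P: "\<forall>i j. polyfun (coords UNIV) (\<lambda>x. coeff (coeff (P x) j) i)"
      "\<forall>x. degree (P x) \<le> N \<and> (\<forall>j. degree (coeff (P x) j) \<le> N)"
      "\<forall>x s t. f (x(a := s, b := t)) = poly (poly (P x) [:t:]) s" and
    Q: "\<forall>i j. polyfun (coords UNIV) (\<lambda>x. coeff (coeff (Q x) j) i)"
      "\<forall>x. degree (Q x) \<le> N' \<and> (\<forall>j. degree (coeff (Q x) j) \<le> N')"
      "\<forall>x s t. g (x(a := s, b := t)) = poly (poly (Q x) [:t:]) s" by blast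
  show ?case
  proof (intro exI[of _ "\<lambda>x. P x * Q x"] exI[of _ "N + N'"] conjI allI)
    show "polyfun (coords UNIV) (\<lambda>x. coeff (coeff (P x * Q x) j) i)" for i j
      unfolding coeff_mult[of "P _"] coeff_sum
      using P(1) Q(1) by (auto intro!: polyfun_sum polyfun_coeff_mult)
    show "degree (P x * Q x) \<le> N + N'" for x
      using P(2) Q(2) by (meson degree_mult_le add_mono le_trans)
    show "degree (coeff (P x * Q x) j) \<le> N + N'" for x j
      unfolding coeff_mult[of "P _"] using P(2) Q(2)
      by (intro degree_sum_le) (auto intro!: order.trans[OF degree_mult_le] add_mono)
  qed (simp add: P(3) Q(3) del: fun_upd_apply)
qed

lemma triangle_sum:
  fixes h :: "nat \<Rightarrow> nat \<Rightarrow> 'a::comm_monoid_add"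
  assumes "\<And>i j. i > N \<or> j > N \<Longrightarrow> h i j = 0"
  shows "(\<Sum>j\<le>N. \<Sum>i\<le>N. h i j) = (\<Sum>e\<le>2*N. \<Sum>i\<le>e. h i (e - i))"
proof -
  have "(\<Sum>e\<le>2*N. \<Sum>i\<le>e. h i (e - i)) = (\<Sum>(i,j)\<in>{(i,j). i + j \<le> 2*N}. h i j)"
    by (rule sum.triangle_reindex_eq[symmetric])
  also have "\<dots> = (\<Sum>(i,j)\<in>{..N}\<times>{..N}. h i j)"
  proof (rule sum.mono_neutral_right)
    have "{(i,j). i + j \<le> 2*N} \<subseteq> {..2*N} \<times> {..2*N}" by auto
    then show "finite {(i,j). i + j \<le> 2*N}" by (rule finite_subset) auto
  next
    show "{..N} \<times> {..N} \<subseteq> {(i,j). i + j \<le> 2*N}" by auto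
    show "\<forall>p\<in>{(i,j). i + j \<le> 2*N} - {..N} \<times> {..N}. (case p of (i,j) \<Rightarrow> h i j) = 0"
    proof
      fix p assume "p \<in> {(i,j). i + j \<le> 2*N} - {..N} \<times> {..N}"
      then show "(case p of (i,j) \<Rightarrow> h i j) = 0" using assms[of "fst p" "snd p"] by (cases p) auto
    qed
  qed
  also have "\<dots> = (\<Sum>i\<le>N. \<Sum>j\<le>N. h i j)" by (simp add: sum.cartesian_product)
  also have "\<dots> = (\<Sum>j\<le>N. \<Sum>i\<le>N. h i j)" by (rule sum.swap)
  finally show ?thesis by simp
qed

definition binform :: "nat \<Rightarrow> (nat \<Rightarrow> 'a) \<Rightarrow> 'a \<Rightarrow> 'a \<Rightarrow> 'a::comm_ring_1" where
  "binform D c s t = (\<Sum>i\<le>D. c i * s ^ i * t ^ (D - i))"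

text \<open>Binary forms in the coordinates \<open>a\<close> and \<open>b\<close>, with polynomial functions as coefficients, that vanish
  on \<open>Y\<close>. Two of them without a common root at a given point have a resultant that does not vanish
  there but vanishes on the projection of \<open>Y\<close>.\<close>

definition elim_ideal :: "(nat \<Rightarrow> 'a::field) set \<Rightarrow> nat \<Rightarrow> nat \<Rightarrow> nat \<Rightarrow> (nat \<Rightarrow> (nat \<Rightarrow> 'a) \<Rightarrow> 'a) \<Rightarrow> bool" where
  "elim_ideal Y a b D c \<longleftrightarrow> (\<forall>i. polyfun (coords UNIV) (c i)) \<and>
     (\<forall>x s t. x(a := s, b := t) \<in> Y \<longrightarrow> binform D (\<lambda>i. c i x) s t = 0)"

text \<open>Because \<open>Y\<close> is a cone in the coordinates \<open>a\<close> and
  \<open>b\<close>, every homogeneous component in these two of a function vanishing on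
  \<open>Y\<close> vanishes there too. One component of the separating function survives at the
  given point.\<close>

lemma elim_ideal_separates:
  fixes Y :: "(nat \<Rightarrow> 'a::field_char_0) set"
  assumes "aclosed Y" "a \<noteq> b" 
    and conic: "\<And>x c. x \<in> Y \<Longrightarrow> c \<noteq> 0 \<Longrightarrow> x(a := c * x a, b := c * x b) \<in> Y"
    and "x(a := s, b := t) \<notin> Y"
  shows "\<exists>D c. elim_ideal Y a b D c \<and> binform D (\<lambda>i. c i x) s t \<noteq> 0"
proof -
  obtain f where f: "polyfun (coords UNIV) f" "f (x(a := s, b := t)) \<noteq> 0" "\<forall>y\<in>Y. f y = 0"
    using assms unfolding aclosed_def by meson
  obtain P N where 
    P: "\<And>i j. polyfun (coords UNIV) (\<lambda>x. coeff (coeff (P x) j) i)"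
      "\<And>x. degree (P x) \<le> N" "\<And>x j. degree (coeff (P x) j) \<le> N"
      "\<And>x s t. f (x(a := s, b := t)) = poly (poly (P x) [:t:]) s"
    using polyfun_bipoly[OF f(1) assms(2)] by blast
  define c where "c e i x = coeff (coeff (P x) (e - i)) i" for e i x
  have expand: "f (x(a := r * s, b := r * t)) = (\<Sum>e\<le>2*N. binform e (\<lambda>i. c e i x) s t * r ^ e)" for x r s t
  proof -
    have z: "coeff (coeff (P x) j) i = 0" if "i > N \<or> j > N" for i j
      using that P(2)[of x] P(3)[of x j] 
      by (metis coeff_0 coeff_eq_0 le_less_trans)
    have "f (x(a := r * s, b := r * t)) = poly (poly (P x) [:(r * t):]) (r * s)" using P(4) by simp
    also have "\<dots> = (\<Sum>j\<le>N. poly (coeff (P x) j) (r * s) * (r*t)^j)"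
      by (subst poly_eq_sum_le[OF P(2)]) (simp add: poly_sum)
    also have "\<dots> = (\<Sum>j\<le>N. \<Sum>i\<le>N. coeff (coeff (P x) j) i * (r * s)^i * (r*t)^j)"
      by (subst poly_eq_sum_le[OF P(3)]) (simp add: sum_distrib_right)
    also have "\<dots> = (\<Sum>e\<le>2*N. \<Sum>i\<le>e. coeff (coeff (P x) (e-i)) i * (r * s)^i * (r*t)^(e-i))"
      by (rule triangle_sum) (use z in auto)
    also have "\<dots> = (\<Sum>e\<le>2*N. binform e (\<lambda>i. c e i x) s t * r ^ e)"
    proof (intro sum.cong refl)
      fix e assume "e \<in> {..2*N}"
      show "(\<Sum>i\<le>e. coeff (coeff (P x) (e-i)) i * (r * s)^i * (r*t)^(e-i)) = binform e (\<lambda>i. c e i x) s t * r ^ e"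
        unfolding binform_def sum_distrib_right c_def
      proof (intro sum.cong refl)
        fix i assume "i \<in> {..e}"
        then have "r ^ e = r ^ i * r ^ (e - i)" by (simp flip: power_add)
        then show "coeff (coeff (P x) (e-i)) i * (r * s)^i * (r*t)^(e-i) = 
          coeff (coeff (P x) (e-i)) i * s^i * t^(e-i) * r ^ e"
            by (simp only: power_mult_distrib mult_ac)
      qed
    qed
    finally show ?thesis .
  qed
  have "f (x(a := s, b := t)) = (\<Sum>e\<le>2*N. binform e (\<lambda>i. c e i x) s t)"
    using expand[of x 1 s t] by simp
  then have "(\<Sum>e\<le>2*N. binform e (\<lambda>i. c e i x) s t) \<noteq> 0" using f(2) by simp
  then obtain e where e: "e \<le> 2*N" "binform e (\<lambda>i. c e i x) s t \<noteq> 0"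
    by (rule sum.not_neutral_contains_not_neutral) auto
  have "elim_ideal Y a b e (c e)"
    unfolding elim_ideal_def
  proof (intro conjI allI impI)
    show "polyfun (coords UNIV) (c e i)" for i unfolding c_def[abs_def] by (rule P(1))
    fix x s t assume Y: "x(a := s, b := t) \<in> Y"
    show "binform e (\<lambda>i. c e i x) s t = 0"
    proof (rule power_sum_coeffs_zero[OF _ e(1), where c="\<lambda>e. binform e (\<lambda>i. c e i x) s t"])
      fix r :: 'a assume "r \<noteq> 0"
      from conic[OF Y this] have "x(a := r * s, b := r * t) \<in> Y" using assms(2) by (simp add: fun_upd_twist)
      then show "(\<Sum>e\<le>2*N. binform e (\<lambda>i. c e i x) s t * r ^ e) = 0"
        unfolding expand[symmetric] using f(3) by blast
    qed
  qed
  then show ?thesis using e by blast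
qed

text \<open>Multiplication by a power of \<open>t\<close> brings forms to a common degree; values at
  \<open>t = 1\<close> do not change.\<close>

lemma elim_ideal_pad:
  assumes "elim_ideal Y a b D c" "D \<le> E"
  shows "elim_ideal Y a b E (\<lambda>i x. if i \<le> D then c i x else 0)"
    and "binform E (\<lambda>i. if i \<le> D then c i x else 0) s t = t ^ (E - D) * binform D (\<lambda>i. c i x) s t"
proof -
  have eq: "binform E (\<lambda>i. if i \<le> D then c i x else 0) s t = t ^ (E - D) * binform D (\<lambda>i. c i x) s t" for x s t
  proof -
    have "binform E (\<lambda>i. if i \<le> D then c i x else 0) s t = (\<Sum>i\<le>D. c i x * s ^ i * t ^ (E - i))"
      unfolding binform_def using assms(2) by (intro sum.mono_neutral_cong_right) auto
    also have "\<dots> = t ^ (E - D) * binform D (\<lambda>i. c i x) s t"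
      unfolding binform_def sum_distrib_left
    proof (intro sum.cong refl)
      fix i assume "i \<in> {..D}"
      then have "t ^ (E - i) = t ^ (E - D) * t ^ (D - i)" using assms(2) by (simp flip: power_add)
      then show "c i x * s ^ i * t ^ (E - i) = t ^ (E - D) * (c i x * s ^ i * t ^ (D - i))" by simp
    qed
    finally show ?thesis .
  qed
  then show "binform E (\<lambda>i. if i \<le> D then c i x else 0) s t = t ^ (E - D) * binform D (\<lambda>i. c i x) s t" .
  show "elim_ideal Y a b E (\<lambda>i x. if i \<le> D then c i x else 0)"
    unfolding elim_ideal_def eq using assms(1)
    by (auto simp: elim_ideal_def intro: polyfun_intros)
qed

lemma elim_ideal_comb:
  assumes "elim_ideal Y a b D c" "elim_ideal Y a b D c'"
  shows "elim_ideal Y a b D (\<lambda>i x. c i x + r * c' i x)"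
    and "binform D (\<lambda>i. c i x + r * c' i x) s t = binform D (\<lambda>i. c i x) s t + r * binform D (\<lambda>i. c' i x) s t"
proof -
  have eq: "binform D (\<lambda>i. c i x + r * c' i x) s t = binform D (\<lambda>i. c i x) s t + r * binform D (\<lambda>i. c' i x) s t" for x s t
    by (simp add: binform_def algebra_simps sum.distrib sum_distrib_left)
  then show "binform D (\<lambda>i. c i x + r * c' i x) s t = binform D (\<lambda>i. c i x) s t + r * binform D (\<lambda>i. c' i x) s t" .
  show "elim_ideal Y a b D (\<lambda>i x. c i x + r * c' i x)"
    unfolding elim_ideal_def eq using assms
    by (auto simp: elim_ideal_def intro!: polyfun.add polyfun.mult polyfun.const)
qed

text \<open>A general linear combination avoids finitely many points when each of them can be
  avoided separately. \<open>D \<ge> 1\<close> is arranged because the Sylvester matrix with a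
  kernel vector must have positive size.\<close>

lemma elim_ideal_avoids_finite:
  fixes Y :: "(nat \<Rightarrow> 'a::field_char_0) set"
  assumes sep: "\<And>s. s \<in> R \<Longrightarrow> \<exists>D c. elim_ideal Y a b D c \<and> binform D (\<lambda>i. c i x) s 1 \<noteq> 0"
    and "finite R"
  shows "\<exists>D c. D \<ge> 1 \<and> elim_ideal Y a b D c \<and> (\<forall>s\<in>R. binform D (\<lambda>i. c i x) s 1 \<noteq> 0)"
  using assms(2,1)
proof (induction R rule: finite_induct)
  case empty
  have "elim_ideal Y a b 1 (\<lambda>_ _. 0)" by (auto simp: elim_ideal_def binform_def intro: polyfun_intros)
  then show ?case by auto
next
  case (insert s0 R)
  then obtain D c where D: "D \<ge> 1" "elim_ideal Y a b D c" "\<forall>s\<in>R. binform D (\<lambda>i. c i x) s 1 \<noteq> 0" by blast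
  obtain D' c' where D': "elim_ideal Y a b D' c'" "binform D' (\<lambda>i. c' i x) s0 1 \<noteq> 0"
    using insert.prems by blast
  let ?E = "D + D'"
  define B where "B s = binform D (\<lambda>i. c i x) s 1" for s
  define B' where "B' s = binform D' (\<lambda>i. c' i x) s 1" for s
  \<comment> \<open>The multipliers \<open>r\<close> that create a root at some \<open>s\<close>.
    Where \<open>B' s = 0\<close> the quotient is the harmless value 0, and no \<open>r\<close> is
    bad because \<open>B s\<close> is nonzero there.\<close>
  let ?bad = "(\<lambda>s. - B s / B' s) ` insert s0 R"
  have "finite ?bad" using insert by auto
  then obtain r where r: "r \<notin> ?bad" using ex_new_if_finite[OF infinite_UNIV_char_0] by blast
  let ?C = "\<lambda>i x. (if i \<le> D then c i x else 0) + r * (if i \<le> D' then c' i x else 0)"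
  have "elim_ideal Y a b ?E ?C"
    by (intro elim_ideal_comb elim_ideal_pad D D') auto
  moreover have "binform ?E (\<lambda>i. ?C i x) s 1 \<noteq> 0" if s: "s \<in> insert s0 R" for s
  proof -
    have "binform ?E (\<lambda>i. ?C i x) s 1 = B s + r * B' s"
      unfolding B_def B'_def
      using elim_ideal_comb(2)[OF elim_ideal_pad(1)[OF D(2)] elim_ideal_pad(1)[OF D'(1)], where D="?E" and r=r and x=x and s=s and t=1]
        elim_ideal_pad(2)[OF D(2), of ?E x s 1] elim_ideal_pad(2)[OF D'(1), of ?E x s 1] by simp
    also have "\<dots> \<noteq> 0"
    proof
      assume eq: "B s + r * B' s = 0"
      show False
      proof (cases "B' s = 0")
        case True
        then have "s \<in> R" "B s = 0" using s D'(2) eq by (auto simp: B'_def)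
        then show False using D(3) by (auto simp: B_def)
      next
        case False
        then have "r = - B s / B' s" using eq by (simp add: field_simps eq_neg_iff_add_eq_0)
        then show False using r s by auto
      qed
    qed
    finally show ?thesis .
  qed
  ultimately show ?case using D(1) by (intro exI[of _ ?E] exI[of _ ?C]) auto
qed

section \<open>Resultants through the Sylvester matrix\<close>

definition sylv :: "nat \<Rightarrow> nat \<Rightarrow> (nat \<Rightarrow> 'a) \<Rightarrow> (nat \<Rightarrow> 'a) \<Rightarrow> nat \<Rightarrow> nat \<Rightarrow> 'a::comm_ring_1" where
  "sylv D E A B r c = (if r < E then (if r \<le> c \<and> c \<le> r + D then A (c - r) else 0)
     else (if r - E \<le> c \<and> c \<le> r - E + E then B (c - (r - E)) else 0))"

lemma shifted_sum:
  fixes f :: "nat \<Rightarrow> 'a::comm_monoid_add"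
  assumes "r + D < n"
  shows "(\<Sum>c<n. if r \<le> c \<and> c \<le> r + D then f c else 0) = (\<Sum>i\<le>D. f (i + r))"
proof -
  have "(\<Sum>c<n. if r \<le> c \<and> c \<le> r + D then f c else 0) = (\<Sum>c\<in>{r..r+D}. f c)"
    using assms by (intro sum.mono_neutral_cong_right) auto
  also have "\<dots> = (\<Sum>i\<le>D. f (i + r))"
    by (rule sum.reindex_bij_witness[of _ "\<lambda>i. i + r" "\<lambda>c. c - r"]) auto
  finally show ?thesis .
qed

text \<open>The monomials of degree \<open>D + E - 1\<close> evaluated at the common root form a
  kernel vector: each row contributes a monomial times the value of one of the two forms.\<close>

lemma sylv_common_root:
  fixes A B :: "nat \<Rightarrow> 'a::field"
  assumes "binform D A s t = 0" "binform E B s t = 0" "(s, t) \<noteq> (0, 0)" "E \<ge> 1"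
  shows "dt (D + E) (sylv D E A B) = 0"
proof -
  let ?n = "D + E"
  define v where "v c = s ^ c * t ^ (?n - 1 - c)" for c
  have row: "(\<Sum>c<?n. (if r \<le> c \<and> c \<le> r + D' then A' (c - r) else 0) * v c) = 0"
    if "r + D' < ?n" "binform D' A' s t = 0" for r D' and A' :: "nat \<Rightarrow> 'a"
  proof -
    have "(\<Sum>c<?n. (if r \<le> c \<and> c \<le> r + D' then A' (c - r) else 0) * v c) = 
      (\<Sum>c<?n. if r \<le> c \<and> c \<le> r + D' then A' (c - r) * v c else 0)"
      by (intro sum.cong) auto
    also have "\<dots> = (\<Sum>i\<le>D'. A' i * v (i + r))" by (subst shifted_sum[OF that(1)]) simp
    also have "\<dots> = (\<Sum>i\<le>D'. s ^ r * t ^ (?n - 1 - D' - r) * (A' i * s ^ i * t ^ (D' - i)))"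
    proof (intro sum.cong refl)
      fix i assume "i \<in> {..D'}"
      then have "?n - 1 - (i + r) = (?n - 1 - D' - r) + (D' - i)" using that(1) by simp
      then have "t ^ (?n - 1 - (i + r)) = t ^ (?n - 1 - D' - r) * t ^ (D' - i)" by (simp only: power_add)
      then show "A' i * v (i + r) = s ^ r * t ^ (?n - 1 - D' - r) * (A' i * s ^ i * t ^ (D' - i))"
        by (simp add: v_def power_add)
    qed
    also have "\<dots> = s ^ r * t ^ (?n - 1 - D' - r) * binform D' A' s t"
      by (simp add: binform_def sum_distrib_left)
    finally show ?thesis using that(2) by simp
  qed
  show ?thesis
    unfolding dt_eq_0_iff
  proof (intro exI[of _ v] conjI allI impI)
    show "\<exists>j<?n. v j \<noteq> 0"
    proof (cases "t = 0")
      case True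
      then have "v (?n - 1) \<noteq> 0" using assms(3) by (simp add: v_def)
      then show ?thesis using assms(4) by (intro exI[of _ "?n - 1"]) auto
    next
      case False
      then have "v 0 \<noteq> 0" by (simp add: v_def)
      then show ?thesis using assms(4) by (intro exI[of _ 0]) auto
    qed
    fix r assume "r < ?n"
    show "(\<Sum>j<?n. sylv D E A B r j * v j) = 0"
    proof (cases "r < E")
      case True
      then show ?thesis using row[of r D A] assms(1) by (simp add: sylv_def)
    next
      case False
      then show ?thesis using row[of "r - E" E B] assms(2) \<open>r < ?n\<close> by (simp add: sylv_def)
    qed
  qed
qed

lemma poly_bezout:
  fixes p q :: "'a::field poly"
  shows "\<exists>g a b. g dvd p \<and> g dvd q \<and> g = a * p + b * q"
proof (induction "euclidean_size q" arbitrary: p q rule: less_induct)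
  case less
  show ?case
  proof (cases "q = 0")
    case True
    then show ?thesis by (intro exI[of _ p] exI[of _ 1] exI[of _ 0]) auto
  next
    case False
    from less[OF mod_size_less[OF this], of q p] obtain g a b where
      g: "g dvd q" "g dvd p mod q" "g = a * q + b * (p mod q)" by blast
    have "g dvd p" using g(1,2) by (metis dvd_mod_imp_dvd)
    moreover have "g = b * p + (a - b * (p div q)) * q"
      using g(3) by (simp add: algebra_simps minus_div_mult_eq_mod[symmetric])
    ultimately show ?thesis using g(1) by blast
  qed
qed

lemma poly_bezout_no_common_root:
  fixes p q :: "'a::alg_closed_field poly"
  assumes "\<And>x. poly p x = 0 \<Longrightarrow> poly q x \<noteq> 0" "p \<noteq> 0"
  shows "\<exists>a b. a * p + b * q = 1"
proof -
  obtain g a b where g: "g dvd p" "g dvd q" "g = a * p + b * q" using poly_bezout by blast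
  have "g \<noteq> 0" using g(1) assms(2) by auto
  have "degree g = 0"
  proof (rule ccontr)
    assume "degree g \<noteq> 0"
    then obtain x where "poly g x = 0" using alg_closed_imp_poly_has_root by blast
    then have "poly p x = 0" "poly q x = 0" using g(1,2) by (auto elim!: dvdE)
    then show False using assms by blast
  qed
  then obtain c where c: "g = [:c:]" by (metis degree_eq_zeroE)
  with \<open>g \<noteq> 0\<close> have "c \<noteq> 0" by auto
  then have "[:inverse c:] * g = 1" using c by (simp add: one_pCons)
  then have "([:inverse c:] * a) * p + ([:inverse c:] * b) * q = 1"
    unfolding g(3) by (simp only: algebra_simps)
  then show ?thesis by blast
qed

lemma poly_bezout_dvd:
  fixes p q :: "'a::field poly"
  assumes "a * p + b * q = 1" "p dvd V * q"
  shows "p dvd V"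
proof -
  have "V = V * a * p + b * (V * q)"
    using arg_cong[OF assms(1), of "\<lambda>x. V * x"] by (simp add: algebra_simps)
  then show ?thesis using assms(2) by (metis dvd_add dvd_mult dvd_triv_right)
qed

text \<open>A kernel vector of the transpose is a relation \<open>U * p + V * q = 0\<close> with
  \<open>degree V < D\<close>. Since \<open>A D\<close> is nonzero, \<open>p\<close> has degree
  exactly \<open>D\<close> and there is no root at infinity; coprimality then forces
  \<open>p dvd V\<close>, hence \<open>V = 0\<close> and \<open>U = 0\<close>.\<close>

lemma sylv_no_common_root:
  fixes A B :: "nat \<Rightarrow> 'a::alg_closed_field"
  assumes "A D \<noteq> 0" "\<And>s. binform D A s 1 = 0 \<Longrightarrow> binform E B s 1 \<noteq> 0"
  shows "dt (D + E) (sylv D E A B) \<noteq> 0"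
proof
  let ?n = "D + E"
  assume "dt ?n (sylv D E A B) = 0"
  then have "dt ?n (\<lambda>i j. sylv D E A B j i) = 0" using dt_transpose[of ?n "sylv D E A B"] by simp
  then obtain w where w: "\<exists>j<?n. w j \<noteq> 0" "\<forall>c<?n. (\<Sum>r<?n. sylv D E A B r c * w r) = 0"
    unfolding dt_eq_0_iff by blast
  define p where "p = (\<Sum>i\<le>D. monom (A i) i)"
  define q where "q = (\<Sum>i\<le>E. monom (B i) i)"
  define U where "U = (\<Sum>r<E. monom (w r) r)"
  define V where "V = (\<Sum>r<D. monom (w (E + r)) r)"
  have cp: "coeff p i = (if i \<le> D then A i else 0)" for i
    by (simp add: p_def coeff_sum if_distrib cong: if_cong)
  have cq: "coeff q i = (if i \<le> E then B i else 0)" for i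
    by (simp add: q_def coeff_sum if_distrib cong: if_cong)
  have cU: "coeff U i = (if i < E then w i else 0)" for i
    by (simp add: U_def coeff_sum if_distrib cong: if_cong)
  have cV: "coeff V i = (if i < D then w (E + i) else 0)" for i
    by (simp add: V_def coeff_sum if_distrib cong: if_cong)
  have degp: "degree p = D" using assms(1) by (intro antisym degree_le le_degree) (auto simp: cp)
  have degV: "V = 0 \<or> degree V < D"
  proof (cases "V = 0")
    case False
    then have "coeff V (degree V) \<noteq> 0" by simp
    then show ?thesis unfolding cV by (auto split: if_splits)
  qed auto
  have p0: "p \<noteq> 0" using assms(1) cp[of D] by auto
  have ev: "poly p s = binform D A s 1" "poly q s = binform E B s 1" for s
    by (simp_all add: p_def q_def binform_def poly_sum poly_monom)
  have "U * p + V * q = 0"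
  proof (rule poly_eqI)
    fix c
    have "coeff (U * p + V * q) c = (\<Sum>r<E. w r * (if r \<le> c then coeff p (c - r) else 0))
      + (\<Sum>r<D. w (E + r) * (if r \<le> c then coeff q (c - r) else 0))"
      unfolding U_def V_def sum_distrib_right coeff_sum coeff_add coeff_monom_mult
      by (intro arg_cong2[where f="(+)"] sum.cong) auto
    also have "\<dots> = 0"
    proof (cases "c < ?n")
      case True
      have "(\<Sum>r<?n. sylv D E A B r c * w r) = 
        (\<Sum>r<E. sylv D E A B r c * w r) + (\<Sum>r<D. sylv D E A B (E + r) c * w (E + r))"
      proof -
        have "(\<Sum>r\<in>{..<E} \<union> {E..<?n}. sylv D E A B r c * w r) = 
          (\<Sum>r<E. sylv D E A B r c * w r) + (\<Sum>r\<in>{E..<?n}. sylv D E A B r c * w r)"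
          by (rule sum.union_disjoint) auto
        also have "{..<E} \<union> {E..<?n} = {..<?n}" by auto
        also have "(\<Sum>r\<in>{E..<?n}. sylv D E A B r c * w r) = (\<Sum>r<D. sylv D E A B (E + r) c * w (E + r))"
          by (rule sum.reindex_bij_witness[of _ "\<lambda>r. E + r" "\<lambda>r. r - E"]) auto
        finally show ?thesis .
      qed
      moreover have "(\<Sum>r<E. w r * (if r \<le> c then coeff p (c - r) else 0)) = (\<Sum>r<E. sylv D E A B r c * w r)"
        by (intro sum.cong) (auto simp: sylv_def cp)
      moreover have "(\<Sum>r<D. w (E + r) * (if r \<le> c then coeff q (c - r) else 0)) = (\<Sum>r<D. sylv D E A B (E + r) c * w (E + r))"
        by (intro sum.cong) (auto simp: sylv_def cq)
      ultimately show ?thesis using w(2) True by simp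
    next
      case False
      then have "(\<Sum>r<E. w r * (if r \<le> c then coeff p (c - r) else 0)) = 0"
        "(\<Sum>r<D. w (E + r) * (if r \<le> c then coeff q (c - r) else 0)) = 0"
        by (auto intro!: sum.neutral simp: cp cq)
      then show ?thesis by simp
    qed
    finally show "coeff (U * p + V * q) c = coeff 0 c" by simp
  qed
  moreover obtain a b where "a * p + b * q = 1"
    using poly_bezout_no_common_root[of p q] assms(2) p0 ev by metis
  moreover have "V * q = - U * p" using \<open>U * p + V * q = 0\<close> by (simp add: eq_neg_iff_add_eq_0 add.commute)
  ultimately have "p dvd V" by (metis poly_bezout_dvd dvd_triv_right)
  then have "V = 0" using degV degp by (metis dvd_imp_degree_le not_le)
  then have "U = 0" using \<open>U * p + V * q = 0\<close> p0 by auto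
  from w(1) obtain j where j: "j < ?n" "w j \<noteq> 0" by blast
  show False
  proof (cases "j < E")
    case True
    then show False using cU[of j] j \<open>U = 0\<close> by simp
  next
    case False
    then show False using cV[of "j - E"] j \<open>V = 0\<close> by (simp split: if_splits)
  qed
qed

text \<open>Completeness of the projective line. At a point outside the projection, \<open>A\<close>
  is chosen nonzero at \<open>(1, 0)\<close>, so that its roots are finite in number and none is at
  infinity; \<open>B\<close> is chosen to avoid these roots. Their resultant is the separating
  function.\<close>

lemma aclosed_project:
  fixes Y :: "(nat \<Rightarrow> 'a::{alg_closed_field, field_char_0}) set"
  assumes "aclosed Y" "a \<noteq> b" 
    and conic: "\<And>x c. x \<in> Y \<Longrightarrow> c \<noteq> 0 \<Longrightarrow> x(a := c * x a, b := c * x b) \<in> Y"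
  shows "aclosed {x. \<exists>s t. (s, t) \<noteq> (0, 0) \<and> x(a := s, b := t) \<in> Y}"
  unfolding aclosed_def
proof (intro allI impI)
  fix x assume x: "x \<notin> {x. \<exists>s t. (s, t) \<noteq> (0, 0) \<and> x(a := s, b := t) \<in> Y}"
  have sep: "\<exists>D c. elim_ideal Y a b D c \<and> binform D (\<lambda>i. c i x) s t \<noteq> 0" if "(s, t) \<noteq> (0, 0)" for s t
    by (rule elim_ideal_separates[OF assms]) (use x that in auto)
  obtain D A where A: "elim_ideal Y a b D A" "binform D (\<lambda>i. A i x) 1 0 \<noteq> 0"
    using sep[of 1 0] by auto
  have "binform D (\<lambda>i. A i x) 1 0 = A D x"
    unfolding binform_def by (subst sum.mono_neutral_right[of "{..D}" "{D}"]) auto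
  with A have AD: "A D x \<noteq> 0" by simp
  define R where "R = {s. binform D (\<lambda>i. A i x) s 1 = 0}"
  have "finite R"
  proof -
    let ?p = "\<Sum>i\<le>D. monom (A i x) i"
    have "coeff ?p D = A D x" by (simp add: coeff_sum if_distrib cong: if_cong)
    then have "?p \<noteq> 0" using AD by auto
    moreover have "R = {s. poly ?p s = 0}" by (simp add: R_def binform_def poly_sum poly_monom)
    ultimately show ?thesis using poly_roots_finite by metis
  qed
  have "\<exists>E B. E \<ge> 1 \<and> elim_ideal Y a b E B \<and> (\<forall>s\<in>R. binform E (\<lambda>i. B i x) s 1 \<noteq> 0)"
    by (rule elim_ideal_avoids_finite[OF sep \<open>finite R\<close>]) auto
  then obtain E B where
    B: "E \<ge> 1" "elim_ideal Y a b E B" "\<forall>s\<in>R. binform E (\<lambda>i. B i x) s 1 \<noteq> 0" by blast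
  let ?f = "\<lambda>y. dt (D + E) (sylv D E (\<lambda>i. A i y) (\<lambda>i. B i y))"
  have "polyfun (coords UNIV) ?f"
    unfolding sylv_def using A(1) B(2) 
    by (intro polyfun_dt polyfun_intros) (auto simp: elim_ideal_def)
  moreover have "?f x \<noteq> 0"
    by (rule sylv_no_common_root) (use AD B in \<open>auto simp: R_def\<close>)
  moreover have "?f y = 0" if y: "(s, t) \<noteq> (0, 0)" "y(a := s, b := t) \<in> Y" for y s t
    using sylv_common_root[of D _ s t E] A(1) B(1,2) y by (auto simp: elim_ideal_def)
  ultimately show "\<exists>f. polyfun (coords UNIV) f \<and> f x \<noteq> 0 \<and> 
    (\<forall>y\<in>{x. \<exists>s t. (s, t) \<noteq> (0, 0) \<and> x(a := s, b := t) \<in> Y}. f y = 0)" by blast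
qed

text \<open>Coordinates \<open>2 * i\<close> and \<open>2 * i + 1\<close> hold the coefficients of the \<open>i\<close>-th linear form; the coordinates
  from \<open>2 * M\<close> on hold the form that is constrained by them.\<close>

definition mergep :: "nat \<Rightarrow> (nat \<Rightarrow> 'a) \<Rightarrow> (nat \<Rightarrow> 'a) \<Rightarrow> nat \<Rightarrow> 'a" where
  "mergep M x z j = (if j < 2 * M then x j else z j)"

definition nonzero_pairs :: "nat \<Rightarrow> (nat \<Rightarrow> 'a::zero) \<Rightarrow> bool" where
  "nonzero_pairs M x \<longleftrightarrow> (\<forall>i<M. (x (2*i), x (2*i+1)) \<noteq> (0, 0))"

text \<open>One projective line is eliminated at a time, the last pair first. The scaling hypothesis
  passes to the projected set because scaling an earlier pair leaves the eliminated one
  untouched.\<close>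

lemma aclosed_project_pairs:
  fixes Y :: "(nat \<Rightarrow> 'a::{alg_closed_field, field_char_0}) set"
  assumes "aclosed Y"
    and "\<And>i x c. i < M \<Longrightarrow> x \<in> Y \<Longrightarrow> c \<noteq> 0 \<Longrightarrow> x(2*i := c * x (2*i), 2*i+1 := c * x (2*i+1)) \<in> Y"
  shows "aclosed {z. \<exists>x. nonzero_pairs M x \<and> mergep M x z \<in> Y}"
  using assms
proof (induction M arbitrary: Y)
  case 0
  have "mergep 0 x z = z" for x z :: "nat \<Rightarrow> 'a" by (auto simp: mergep_def)
  then show ?case using 0 by (simp add: nonzero_pairs_def)
next
  case (Suc M)
  let ?Y = "{x. \<exists>s t. (s, t) \<noteq> (0, 0) \<and> x(2*M := s, 2*M+1 := t) \<in> Y}"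
  have cl: "aclosed ?Y"
    by (rule aclosed_project[OF Suc.prems(1) _ Suc.prems(2)]) auto
  have "aclosed {z. \<exists>x. nonzero_pairs M x \<and> mergep M x z \<in> ?Y}"
  proof (rule Suc.IH[OF cl])
    fix i x c assume i: "i < M" and x: "x \<in> ?Y" and c: "(c::'a) \<noteq> 0"
    then obtain s t where st: "(s, t) \<noteq> (0, 0)" "x(2*M := s, 2*M+1 := t) \<in> Y" by blast
    have ne: "2*i \<noteq> 2*M" "2*i+1 \<noteq> 2*M" "2*i \<noteq> 2*M+1" "2*i+1 \<noteq> 2*M+1" using i by presburger+
    have eq: "(x(2*M := s, 2*M+1 := t))(2*i := c * (x(2*M := s, 2*M+1 := t)) (2*i), 2*i+1 := c * (x(2*M := s, 2*M+1 := t)) (2*i+1))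
      = (x(2*i := c * x (2*i), 2*i+1 := c * x (2*i+1)))(2*M := s, 2*M+1 := t)"
      using ne by (auto simp: fun_eq_iff)
    have "(x(2*i := c * x (2*i), 2*i+1 := c * x (2*i+1)))(2*M := s, 2*M+1 := t) \<in> Y"
      using Suc.prems(2)[OF _ st(2) c, of i] i unfolding eq by (simp del: fun_upd_apply)
    then show "x(2*i := c * x (2*i), 2*i+1 := c * x (2*i+1)) \<in> ?Y" using st(1) by blast
  qed
  also have "{z. \<exists>x. nonzero_pairs M x \<and> mergep M x z \<in> ?Y} = {z. \<exists>x. nonzero_pairs (Suc M) x \<and> mergep (Suc M) x z \<in> Y}"
  proof (intro Collect_cong iffI)
    fix z assume "\<exists>x. nonzero_pairs M x \<and> mergep M x z \<in> ?Y"
    then obtain x s t where x: "nonzero_pairs M x" "(s, t) \<noteq> (0, 0)" "(mergep M x z)(2*M := s, 2*M+1 := t) \<in> Y" by blast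
    let ?x = "x(2*M := s, 2*M+1 := t)"
    have "mergep (Suc M) ?x z = (mergep M x z)(2*M := s, 2*M+1 := t)"
      by (auto simp: mergep_def fun_eq_iff less_Suc_eq)
    moreover have "nonzero_pairs (Suc M) ?x" 
      using x(1,2) by (auto simp: nonzero_pairs_def less_Suc_eq)
    ultimately show "\<exists>x. nonzero_pairs (Suc M) x \<and> mergep (Suc M) x z \<in> Y" using x(3) by metis
  next
    fix z assume "\<exists>x. nonzero_pairs (Suc M) x \<and> mergep (Suc M) x z \<in> Y"
    then obtain x where x: "nonzero_pairs (Suc M) x" "mergep (Suc M) x z \<in> Y" by blast
    have "(mergep M x z)(2*M := x (2*M), 2*M+1 := x (2*M+1)) = mergep (Suc M) x z"
      by (auto simp: mergep_def fun_eq_iff less_Suc_eq)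
    then have "(mergep M x z)(2*M := x (2*M), 2*M+1 := x (2*M+1)) \<in> Y" using x(2) by simp
    moreover have "(x (2*M), x (2*M+1)) \<noteq> (0, 0)" using x(1) by (auto simp: nonzero_pairs_def)
    ultimately have 1: "mergep M x z \<in> ?Y" by blast
    have "nonzero_pairs M x" using x(1) by (auto simp: nonzero_pairs_def)
    with 1 show "\<exists>x. nonzero_pairs M x \<and> mergep M x z \<in> ?Y" by blast
  qed
  finally show ?case .
qed

section \<open>Evaluation of multivariate polynomials\<close>

abbreviation lkp where "lkp \<equiv> Poly_Mapping.lookup"
abbreviation pmkeys where "pmkeys \<equiv> Poly_Mapping.keys"
abbreviation sgl where "sgl \<equiv> Poly_Mapping.single"

text \<open>Values lie in a commutative ring rather than a field, so that a monomial can also be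
  evaluated at a curve, that is, at a family of polynomials.\<close>

definition monval :: "('v \<Rightarrow> 'a::comm_ring_1) \<Rightarrow> ('v \<Rightarrow>\<^sub>0 nat) \<Rightarrow> 'a" where
  "monval x m = (\<Prod>i\<in>pmkeys m. x i ^ lkp m i)"

lemma mon_superset: "finite A \<Longrightarrow> pmkeys m \<subseteq> A \<Longrightarrow> monval x m = (\<Prod>i\<in>A. x i ^ lkp m i)"
  unfolding monval_def by (rule prod.mono_neutral_left) (auto simp: in_keys_iff)

lemma mon_add: "monval x (m + m') = monval x m * monval x m'"
proof -
  let ?A = "pmkeys m \<union> pmkeys m'"
  have "monval x (m + m') = (\<Prod>i\<in>?A. x i ^ lkp (m + m') i)"
    by (rule mon_superset) (use keys_add[of m m'] in auto)
  also have "\<dots> = (\<Prod>i\<in>?A. x i ^ lkp m i) * (\<Prod>i\<in>?A. x i ^ lkp m' i)"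
    by (simp add: lookup_add power_add prod.distrib)
  also have "(\<Prod>i\<in>?A. x i ^ lkp m i) = monval x m" by (rule mon_superset[symmetric]) auto
  also have "(\<Prod>i\<in>?A. x i ^ lkp m' i) = monval x m'" by (rule mon_superset[symmetric]) auto
  finally show ?thesis .
qed

lemma mp_eval_superset: "finite A \<Longrightarrow> pmkeys F \<subseteq> A \<Longrightarrow> mp_eval x F = (\<Sum>m\<in>A. lkp F m * monval x m)"
  unfolding mp_eval_def monval_def[symmetric] by (rule sum.mono_neutral_left) (auto simp: in_keys_iff)

lemma mp_eval_mon: "mp_eval x F = (\<Sum>m\<in>pmkeys F. lkp F m * monval x m)"
  by (rule mp_eval_superset) auto

lemma mp_eval_zero [simp]: "mp_eval x 0 = 0"
  by (simp add: mp_eval_def)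

lemma mp_eval_add: "mp_eval x (F + G) = mp_eval x F + mp_eval x G"
proof -
  let ?A = "pmkeys F \<union> pmkeys G"
  have "mp_eval x (F + G) = (\<Sum>m\<in>?A. lkp (F + G) m * monval x m)"
    by (rule mp_eval_superset) (use keys_add[of F G] in auto)
  also have "\<dots> = (\<Sum>m\<in>?A. lkp F m * monval x m) + (\<Sum>m\<in>?A. lkp G m * monval x m)"
    by (simp add: lookup_add distrib_right sum.distrib)
  also have "(\<Sum>m\<in>?A. lkp F m * monval x m) = mp_eval x F" by (rule mp_eval_superset[symmetric]) auto
  also have "(\<Sum>m\<in>?A. lkp G m * monval x m) = mp_eval x G" by (rule mp_eval_superset[symmetric]) auto
  finally show ?thesis .
qed

lemma mp_eval_single: "mp_eval x (sgl m c) = c * monval x m"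
  by (subst mp_eval_superset[of "{m}"]) (auto simp: lookup_single)

lemma mp_eval_sum: "mp_eval x (\<Sum>i\<in>A. F i) = (\<Sum>i\<in>A. mp_eval x (F i))"
  by (induction A rule: infinite_finite_induct) (auto simp: mp_eval_add)

lemma lookup_sum_single: 
  "finite A \<Longrightarrow> lkp (\<Sum>m\<in>A. sgl m (c m)) k = (if k \<in> A then c k else 0)"
  by (simp add: lookup_sum lookup_single when_def)

lemma mp_expand: "F = (\<Sum>m\<in>pmkeys F. sgl m (lkp F m))"
  by (rule poly_mapping_eqI) (auto simp: lookup_sum_single in_keys_iff)

lemma mp_eval_mult: "mp_eval x (F * G) = mp_eval x F * mp_eval x G"
proof -
  have "F * G = (\<Sum>m\<in>pmkeys F. sgl m (lkp F m)) * (\<Sum>m\<in>pmkeys G. sgl m (lkp G m))"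
    by (rule arg_cong2[where f="(*)", OF mp_expand mp_expand])
  also have "\<dots> = (\<Sum>m\<in>pmkeys F. \<Sum>n\<in>pmkeys G. sgl (m + n) (lkp F m * lkp G n))"
    by (simp add: sum_product mult_single)
  finally show ?thesis
    by (simp add: mp_eval_sum mp_eval_single mon_add mp_eval_mon[of x F] mp_eval_mon[of x G] sum_product mult_ac)
qed

definition mp_over :: "'v set \<Rightarrow> ('v, 'a::zero) mpolynomial \<Rightarrow> bool" where
  "mp_over I F \<longleftrightarrow> (\<forall>m\<in>pmkeys F. pmkeys m \<subseteq> I)"

lemma mp_over_add: "mp_over I F \<Longrightarrow> mp_over I G \<Longrightarrow> mp_over I (F + G)"
  unfolding mp_over_def using keys_add[of F G] by blast

lemma mp_over_mult: "mp_over I F \<Longrightarrow> mp_over I G \<Longrightarrow> mp_over I (F * G)"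
  unfolding mp_over_def
proof
  fix m assume F: "\<forall>m\<in>pmkeys F. pmkeys m \<subseteq> I" and G: "\<forall>m\<in>pmkeys G. pmkeys m \<subseteq> I" and "m \<in> pmkeys (F * G)"
  then obtain a b where "m = a + b" "a \<in> pmkeys F" "b \<in> pmkeys G" using keys_mult[of F G] by blast
  then show "pmkeys m \<subseteq> I" using F G keys_add[of a b] by blast
qed

lemma polyfun_imp_mp:
  fixes f :: "('v \<Rightarrow> 'a::field) \<Rightarrow> 'a"
  assumes "polyfun (coords I) f"
  shows "\<exists>F. mp_over I F \<and> (\<forall>x. mp_eval x F = f x)"
  using assms
proof (induction rule: polyfun.induct)
  case (const c)
  show ?case by (intro exI[of _ "sgl 0 c"]) (auto simp: mp_over_def mp_eval_single monval_def)
next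
  case (gen g)
  then obtain i where "i \<in> I" "g = (\<lambda>x. x i)" by (auto simp: coords_def)
  then show ?case by (intro exI[of _ "sgl (sgl i 1) 1"]) (auto simp: mp_over_def mp_eval_single monval_def)
next
  case (add f g)
  then show ?case using mp_over_add mp_eval_add by metis
next
  case (mult f g)
  then show ?case using mp_over_mult mp_eval_mult by metis
qed

lemma polyfun_mp_eval: "mp_over I F \<Longrightarrow> polyfun (coords I) (\<lambda>x. mp_eval x F)"
  unfolding mp_eval_def mp_over_def by (intro polyfun_intros polyfun_coord) auto

definition tdeg :: "('v \<Rightarrow>\<^sub>0 nat) \<Rightarrow> nat" where
  "tdeg m = (\<Sum>i\<in>pmkeys m. lkp m i)"

lemma tdeg_superset: "finite A \<Longrightarrow> pmkeys m \<subseteq> A \<Longrightarrow> tdeg m = (\<Sum>i\<in>A. lkp m i)"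
  unfolding tdeg_def by (rule sum.mono_neutral_left) (auto simp: in_keys_iff)

lemma tdeg_add: "tdeg (m + m') = tdeg m + tdeg m'"
proof -
  let ?A = "pmkeys m \<union> pmkeys m'"
  have "tdeg (m + m') = (\<Sum>i\<in>?A. lkp (m + m') i)"
    by (rule tdeg_superset) (use keys_add[of m m'] in auto)
  also have "\<dots> = (\<Sum>i\<in>?A. lkp m i) + (\<Sum>i\<in>?A. lkp m' i)"
    by (simp add: lookup_add sum.distrib)
  also have "(\<Sum>i\<in>?A. lkp m i) = tdeg m" by (rule tdeg_superset[symmetric]) auto
  also have "(\<Sum>i\<in>?A. lkp m' i) = tdeg m'" by (rule tdeg_superset[symmetric]) auto
  finally show ?thesis .
qed

lemma tdeg_single [simp]: "tdeg (sgl i n) = n"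
  by (cases "n = 0") (auto simp: tdeg_def)

lemma mon_scale: "monval (\<lambda>i. c * x i) m = c ^ tdeg m * monval x m"
  by (simp add: monval_def tdeg_def power_mult_distrib prod.distrib power_sum)

definition mp_hom :: "nat \<Rightarrow> ('v, 'a::zero) mpolynomial \<Rightarrow> bool" where
  "mp_hom e F \<longleftrightarrow> (\<forall>m\<in>pmkeys F. tdeg m = e)"

lemma homogeneous_polys_iff: "F \<in> homogeneous_polys d \<longleftrightarrow> mp_over {..d} F \<and> (\<exists>e. mp_hom e F)"
proof -
  have "(\<Sum>i\<le>d. lkp m i) = tdeg m" if "pmkeys m \<subseteq> {..d}" for m
    by (rule tdeg_superset[symmetric]) (use that in auto)
  then show ?thesis unfolding homogeneous_polys_def mp_over_def mp_hom_def by fastforce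
qed

lemma mp_hom_mult: "mp_hom e F \<Longrightarrow> mp_hom e' G \<Longrightarrow> mp_hom (e + e') (F * G)"
  unfolding mp_hom_def using keys_mult[of F G] by (fastforce simp: tdeg_add)

lemma homogeneous_polys_mult: "F \<in> homogeneous_polys d \<Longrightarrow> G \<in> homogeneous_polys d \<Longrightarrow> F * G \<in> homogeneous_polys d"
  unfolding homogeneous_polys_iff using mp_hom_mult mp_over_mult by blast

lemma one_homogeneous: "1 \<in> homogeneous_polys d" "mp_eval x 1 = 1"
proof -
  show "1 \<in> homogeneous_polys d" by (auto simp: homogeneous_polys_iff mp_over_def mp_hom_def)
  show "mp_eval x 1 = 1" using mp_eval_single[of x 0 1] by (simp add: monval_def)
qed

lemma mp_hom_scale: "mp_hom e F \<Longrightarrow> mp_eval (\<lambda>i. c * x i) F = c ^ e * mp_eval x F"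
  unfolding mp_eval_mon sum_distrib_left by (intro sum.cong) (auto simp: mp_hom_def mon_scale)

definition hcomp :: "nat \<Rightarrow> ('v, 'a::comm_monoid_add) mpolynomial \<Rightarrow> ('v, 'a) mpolynomial" where
  "hcomp e F = (\<Sum>m\<in>{m \<in> pmkeys F. tdeg m = e}. sgl m (lkp F m))"

lemma lookup_hcomp: "lkp (hcomp e F) m = (if tdeg m = e then lkp F m else 0)"
  unfolding hcomp_def by (subst lookup_sum_single) (auto simp: in_keys_iff)

lemma hcomp_hom: "mp_hom e (hcomp e F)" "mp_over I F \<Longrightarrow> mp_over I (hcomp e F)"
  by (auto simp: mp_hom_def mp_over_def in_keys_iff lookup_hcomp split: if_splits)

lemma hcomp_sum: "\<exists>N. F = (\<Sum>e\<le>N. hcomp e F) \<and> (\<forall>e>N. hcomp e F = 0)"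
proof -
  define N where "N = (\<Sum>m\<in>pmkeys F. tdeg m)"
  have N: "lkp F m = 0" if "tdeg m > N" for m
    using that member_le_sum[of m "pmkeys F" tdeg] by (force simp: N_def in_keys_iff)
  have "F = (\<Sum>e\<le>N. hcomp e F)"
    by (rule poly_mapping_eqI) (auto simp: lookup_sum lookup_hcomp N not_le)
  moreover have "hcomp e F = 0" if "e > N" for e
    by (rule poly_mapping_eqI) (use that N in \<open>auto simp: lookup_hcomp\<close>)
  ultimately show ?thesis by blast
qed

text \<open>On the punctured line through \<open>x\<close> the polynomial becomes a polynomial in
  \<open>c\<close> whose coefficients are the values of the components at \<open>x\<close>.\<close>

lemma hcomp_vanishes:
  fixes F :: "('v, 'a::field_char_0) mpolynomial"
  assumes "\<And>c. c \<noteq> 0 \<Longrightarrow> mp_eval (\<lambda>i. c * x i) F = 0"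
  shows "mp_eval x (hcomp e F) = 0"
proof -
  obtain N where N: "F = (\<Sum>e\<le>N. hcomp e F)" "\<forall>e>N. hcomp e F = 0" using hcomp_sum by blast
  have ex: "mp_eval y F = (\<Sum>e\<le>N. mp_eval y (hcomp e F))" for y
    by (subst N(1)) (rule mp_eval_sum)
  show ?thesis
  proof (cases "e \<le> N")
    case True
    show ?thesis
    proof (rule power_sum_coeffs_zero[OF _ True, where c="\<lambda>e. mp_eval x (hcomp e F)"])
      fix r :: 'a assume "r \<noteq> 0"
      from assms[OF this] have "(\<Sum>e\<le>N. mp_eval (\<lambda>i. r * x i) (hcomp e F)) = 0" by (simp only: ex)
      then show "(\<Sum>e\<le>N. mp_eval x (hcomp e F) * r ^ e) = 0"
        by (simp add: mp_hom_scale[OF hcomp_hom(1)] mult.commute)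
    qed
  next
    case False
    then show ?thesis using N(2) by simp
  qed
qed

lemma hcomp_nonzero: "F \<noteq> 0 \<Longrightarrow> \<exists>e. hcomp e F \<noteq> 0"
  using hcomp_sum[of F] by (metis sum.neutral)

lemma hcomp_eval_nonzero: "mp_eval x F \<noteq> 0 \<Longrightarrow> \<exists>e. mp_eval x (hcomp e F) \<noteq> 0"
  using hcomp_sum[of F] by (metis (no_types, lifting) mp_eval_sum sum.neutral)

section \<open>Partial derivatives\<close>

lemma diff_single_eq_iff:
  "lkp m' j > 0 \<Longrightarrow> m' - sgl j 1 = m \<longleftrightarrow> m' = m + sgl j (1::nat)"
  by (auto simp: poly_mapping_eq_iff fun_eq_iff lookup_add lookup_minus lookup_single when_def)

lemma lookup_mp_partial:
  fixes F :: "('v, 'a::field) mpolynomial"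
  shows "lkp (mp_partial j F) m = of_nat (lkp m j + 1) * lkp F (m + sgl j 1)"
proof -
  let ?m = "m + sgl j (1::nat)"
  have "lkp (mp_partial j F) m = (\<Sum>m'\<in>pmkeys F. if m' = ?m then of_nat (lkp m j + 1) * lkp F ?m else 0)"
    unfolding mp_partial_def lookup_sum
  proof (intro sum.cong refl)
    fix m'
    show "lkp (sgl (m' - sgl j 1) (of_nat (lkp m' j) * lkp F m')) m = 
      (if m' = ?m then of_nat (lkp m j + 1) * lkp F ?m else 0)"
    proof (cases "lkp m' j = 0")
      case True
      then have "m' \<noteq> ?m" by (auto simp: lookup_add)
      then show ?thesis using True by simp
    next
      case False
      then show ?thesis using diff_single_eq_iff[of m' j m] 
        by (auto simp: lookup_single lookup_add when_def)
    qed
  qed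
  also have "\<dots> = of_nat (lkp m j + 1) * lkp F ?m" by (auto simp: in_keys_iff)
  finally show ?thesis .
qed

lemma mp_partial_over: "mp_over I F \<Longrightarrow> mp_over I (mp_partial j F)"
  unfolding mp_over_def
proof (intro ballI subsetI)
  fix m i assume F: "\<forall>m\<in>pmkeys F. pmkeys m \<subseteq> I" and m: "m \<in> pmkeys (mp_partial j F)" and i: "i \<in> pmkeys m"
  from m have "m + sgl j 1 \<in> pmkeys F" by (auto simp: in_keys_iff lookup_mp_partial)
  moreover have "i \<in> pmkeys (m + sgl j 1)" using i by (auto simp: in_keys_iff lookup_add)
  ultimately show "i \<in> I" using F by blast
qed

lemma mp_partial_hom: "mp_hom e F \<Longrightarrow> mp_hom (e - 1) (mp_partial j F)"
  unfolding mp_hom_def by (auto simp: in_keys_iff lookup_mp_partial tdeg_add dest!: bspec)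

text \<open>Some monomial of \<open>F\<close> involves \<open>j\<close>; differentiation multiplies
  its coefficient by a positive integer, nonzero in characteristic zero, and sends no other monomial
  to the same place.\<close>

lemma mp_partial_nonzero:
  fixes F :: "('v, 'a::field_char_0) mpolynomial"
  assumes "\<not> mp_over I F" "mp_over (insert j I) F"
  shows "mp_partial j F \<noteq> 0"
proof -
  obtain m where m: "m \<in> pmkeys F" "\<not> pmkeys m \<subseteq> I" using assms(1) by (auto simp: mp_over_def)
  with assms(2) have "j \<in> pmkeys m" by (auto simp: mp_over_def)
  then have j: "lkp m j > 0" by (simp add: in_keys_iff)
  then have "m = (m - sgl j 1) + sgl j 1" using diff_single_eq_iff by metis
  then have "lkp (mp_partial j F) (m - sgl j 1) = of_nat (lkp (m - sgl j 1) j + 1) * lkp F m"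
    using lookup_mp_partial by metis
  also have "\<dots> \<noteq> 0" using m(1) by (simp add: in_keys_iff del: of_nat_add of_nat_Suc)
  finally show ?thesis by auto
qed

lemma mp_partial_zero: 
  fixes F :: "('v, 'a::field) mpolynomial"
  assumes "mp_over I F" "j \<notin> I" 
  shows "mp_partial j F = 0"
proof (rule poly_mapping_eqI)
  fix m :: "'v \<Rightarrow>\<^sub>0 nat"
  have "j \<in> pmkeys (m + sgl j 1)" by (simp add: in_keys_iff lookup_add)
  then have "m + sgl j 1 \<notin> pmkeys F" using assms by (auto simp: mp_over_def)
  then show "lkp (mp_partial j F) m = lkp 0 m" by (simp add: lookup_mp_partial in_keys_iff)
qed

lemma pderiv_sum_set: "pderiv (\<Sum>i\<in>A. f i) = (\<Sum>i\<in>A. pderiv (f i))"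
  by (induction A rule: infinite_finite_induct) (auto simp: pderiv_add)

lemma mon_curve_deriv:
  fixes \<gamma> :: "'v \<Rightarrow> 'a::field_char_0 poly"
  assumes "finite A" "pmkeys m \<subseteq> A"
  shows "poly (pderiv (monval \<gamma> m)) t = 
    (\<Sum>i\<in>A. of_nat (lkp m i) * monval (\<lambda>i. poly (\<gamma> i) t) (m - sgl i 1) * poly (pderiv (\<gamma> i)) t)"
proof -
  have "poly (pderiv (monval \<gamma> m)) t = (\<Sum>i\<in>A. (\<Prod>j\<in>A-{i}. poly (\<gamma> j) t ^ lkp m j) * 
    (of_nat (lkp m i) * (poly (\<gamma> i) t ^ (lkp m i - 1) * poly (pderiv (\<gamma> i)) t)))"
    unfolding mon_superset[OF assms] pderiv_prod
    by (simp add: poly_sum poly_prod pderiv_power poly_power mult_ac)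
  also have "\<dots> = (\<Sum>i\<in>A. of_nat (lkp m i) * monval (\<lambda>i. poly (\<gamma> i) t) (m - sgl i 1) * poly (pderiv (\<gamma> i)) t)"
  proof (intro sum.cong refl)
    fix i assume i: "i \<in> A"
    have "pmkeys (m - sgl i 1) \<subseteq> A" using assms(2) by (auto simp: in_keys_iff lookup_minus)
    from mon_superset[OF assms(1) this, of "\<lambda>i. poly (\<gamma> i) t"]
    have "monval (\<lambda>i. poly (\<gamma> i) t) (m - sgl i 1) = (\<Prod>j\<in>A. poly (\<gamma> j) t ^ lkp (m - sgl i 1) j)" .
    also have "\<dots> = poly (\<gamma> i) t ^ lkp (m - sgl i 1) i * (\<Prod>j\<in>A-{i}. poly (\<gamma> j) t ^ lkp (m - sgl i 1) j)"
      by (rule prod.remove) (use assms i in auto)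
    also have "(\<Prod>j\<in>A-{i}. poly (\<gamma> j) t ^ lkp (m - sgl i 1) j) = (\<Prod>j\<in>A-{i}. poly (\<gamma> j) t ^ lkp m j)"
      by (intro prod.cong refl) (auto simp: lookup_minus lookup_single)
    finally show "(\<Prod>j\<in>A-{i}. poly (\<gamma> j) t ^ lkp m j) * 
      (of_nat (lkp m i) * (poly (\<gamma> i) t ^ (lkp m i - 1) * poly (pderiv (\<gamma> i)) t)) = 
      of_nat (lkp m i) * monval (\<lambda>i. poly (\<gamma> i) t) (m - sgl i 1) * poly (pderiv (\<gamma> i)) t"
      by (simp add: lookup_minus mult_ac)
  qed
  finally show ?thesis .
qed

lemma mp_eval_partial:
  "mp_eval x (mp_partial i F) = (\<Sum>m\<in>pmkeys F. of_nat (lkp m i) * lkp F m * monval x (m - sgl i 1))"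
  by (simp add: mp_partial_def mp_eval_sum mp_eval_single)

text \<open>The source of tangent vectors: \<open>F\<close> composed with the curve is the zero
  polynomial, and its derivative is given by the chain rule.\<close>

lemma curve_derivative_vanishes:
  fixes \<gamma> :: "'v \<Rightarrow> 'a::field_char_0 poly"
  assumes "finite A" "mp_over A F" "\<And>t. mp_eval (\<lambda>i. poly (\<gamma> i) t) F = 0"
  shows "(\<Sum>i\<in>A. mp_eval (\<lambda>i. poly (\<gamma> i) t) (mp_partial i F) * poly (pderiv (\<gamma> i)) t) = 0"
proof -
  define Q where "Q = (\<Sum>m\<in>pmkeys F. [:lkp F m:] * monval \<gamma> m)"
  have "poly (monval \<gamma> m) t = monval (\<lambda>i. poly (\<gamma> i) t) m" for m t
    by (simp add: monval_def poly_prod poly_power)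
  then have "poly Q t = mp_eval (\<lambda>i. poly (\<gamma> i) t) F" for t
    by (simp add: Q_def poly_sum mp_eval_mon)
  then have "Q = 0" using assms(3) by (intro infinite_poly_zero) auto
  then have "0 = poly (pderiv Q) t" by simp
  also have "\<dots> = (\<Sum>m\<in>pmkeys F. lkp F m * poly (pderiv (monval \<gamma> m)) t)"
    by (simp add: Q_def pderiv_sum_set poly_sum pderiv_mult pderiv_pCons pderiv_smult)
  also have "\<dots> = (\<Sum>m\<in>pmkeys F. lkp F m * 
    (\<Sum>i\<in>A. of_nat (lkp m i) * monval (\<lambda>i. poly (\<gamma> i) t) (m - sgl i 1) * poly (pderiv (\<gamma> i)) t))"
    using assms(2) by (intro sum.cong refl) (auto simp: mp_over_def mon_curve_deriv[OF assms(1)])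
  also have "\<dots> = (\<Sum>i\<in>A. \<Sum>m\<in>pmkeys F. of_nat (lkp m i) * lkp F m * monval (\<lambda>i. poly (\<gamma> i) t) (m - sgl i 1) * poly (pderiv (\<gamma> i)) t)"
    unfolding sum_distrib_left by (subst sum.swap) (simp add: mult_ac)
  finally show ?thesis by (simp add: mp_eval_partial sum_distrib_right)
qed

section \<open>Polynomials in the second factor\<close>

definition inr_mon :: "nat \<Rightarrow> (nat \<Rightarrow>\<^sub>0 nat) \<Rightarrow> (nat + nat \<Rightarrow>\<^sub>0 nat)" where
  "inr_mon d m = (\<Sum>i\<le>d. sgl (Inr i) (lkp m i))"

lemma lookup_inr_mon: "lkp (inr_mon d m) (Inr i) = (if i \<le> d then lkp m i else 0)" "lkp (inr_mon d m) (Inl i) = 0"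
  by (auto simp: inr_mon_def lookup_sum lookup_single when_def)

lemma keys_inr_mon: "pmkeys (inr_mon d m) \<subseteq> Inr ` {..d}"
proof
  fix k assume "k \<in> pmkeys (inr_mon d m)"
  then show "k \<in> Inr ` {..d}" by (cases k) (auto simp: in_keys_iff lookup_inr_mon split: if_splits)
qed

text \<open>The pullback along the second projection, of bidegree \<open>(0, e)\<close>; it provides
  the continuity of \<open>snd\<close>.\<close>

definition inr_poly :: "nat \<Rightarrow> (nat, 'a::field) mpolynomial \<Rightarrow> (nat + nat, 'a) mpolynomial" where
  "inr_poly d F = (\<Sum>m\<in>pmkeys F. sgl (inr_mon d m) (lkp F m))"

lemma inr_poly_eval:
  assumes "mp_over {..d} F"
  shows "mp_eval (case_sum x y) (inr_poly d F) = mp_eval y F"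
proof -
  have "monval (case_sum x y) (inr_mon d m) = monval y m" if "m \<in> pmkeys F" for m
  proof -
    have "monval (case_sum x y) (inr_mon d m) = (\<Prod>i\<in>Inr ` {..d}. case_sum x y i ^ lkp (inr_mon d m) i)"
      by (rule mon_superset) (use keys_inr_mon in auto)
    also have "\<dots> = (\<Prod>i\<le>d. y i ^ lkp m i)"
      by (subst prod.reindex) (auto simp: lookup_inr_mon)
    also have "\<dots> = monval y m" by (rule mon_superset[symmetric]) (use assms that in \<open>auto simp: mp_over_def\<close>)
    finally show ?thesis .
  qed
  then show ?thesis by (simp add: inr_poly_def mp_eval_sum mp_eval_single mp_eval_mon[of y F])
qed

lemma inr_poly_bihomogeneous:
  assumes "F \<in> homogeneous_polys d"
  shows "inr_poly d F \<in> bihomogeneous_polys d"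
proof -
  obtain e where e: "mp_over {..d} F" "mp_hom e F" using assms homogeneous_polys_iff by blast
  have k: "k \<in> inr_mon d ` pmkeys F" if "k \<in> pmkeys (inr_poly d F)" for k
    using that keys_sum[of "\<lambda>m. sgl (inr_mon d m) (lkp F m)" "pmkeys F"] unfolding inr_poly_def
    by (auto split: if_splits)
  have "pmkeys k \<subseteq> Inl ` {..d} \<union> Inr ` {..d} \<and> (\<Sum>i\<le>d. lkp k (Inl i)) = 0 \<and> (\<Sum>i\<le>d. lkp k (Inr i)) = e"
    if kk: "k \<in> pmkeys (inr_poly d F)" for k
  proof (intro conjI)
    obtain m where m: "m \<in> pmkeys F" "k = inr_mon d m" using k[OF kk] by blast
    show "pmkeys k \<subseteq> Inl ` {..d} \<union> Inr ` {..d}" using keys_inr_mon m(2) by blast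
    show "(\<Sum>i\<le>d. lkp k (Inl i)) = 0" by (simp add: m lookup_inr_mon)
    have "(\<Sum>i\<le>d. lkp k (Inr i)) = (\<Sum>i\<le>d. lkp m i)" by (simp add: m lookup_inr_mon)
    also have "\<dots> = tdeg m"
      using tdeg_superset[of "{..d}" m] e(1) m(1) by (auto simp: mp_over_def)
    finally show "(\<Sum>i\<le>d. lkp k (Inr i)) = e" using e m by (simp add: mp_hom_def)
  qed
  then show ?thesis unfolding bihomogeneous_polys_def by blast
qed

section \<open>Dehomogenization\<close>

text \<open>Setting \<open>u = 1\<close> identifies the forms of degree \<open>d\<close> with the polynomials in \<open>v\<close> of degree at most \<open>d\<close>;
  \<open>hmg d\<close> is the inverse. A drop of the degree is a root at infinity.\<close>

definition deh :: "'a::field poly poly \<Rightarrow> 'a poly" where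
  "deh f = map_poly (\<lambda>c. poly c 1) f"

lemma coeff_deh: "coeff (deh f) j = poly (coeff f j) 1"
  by (simp add: deh_def coeff_map_poly)

lemma deh_add: "deh (f + g) = deh f + deh g"
  by (rule poly_eqI) (simp add: coeff_deh)

lemma deh_mult: "deh (f * g) = deh f * deh g"
  by (rule poly_eqI) (simp add: coeff_deh coeff_mult poly_sum)

lemma deh_0 [simp]: "deh 0 = 0"
  by (rule poly_eqI) (simp add: coeff_deh)

lemma deh_1 [simp]: "deh 1 = 1"
  by (rule poly_eqI) (simp add: coeff_deh)

lemma deh_prod: "deh (\<Prod>i\<in>A. f i) = (\<Prod>i\<in>A. deh (f i))"
  by (induction A rule: infinite_finite_induct) (auto simp: deh_mult)

lemma deh_power: "deh (f ^ n) = deh f ^ n"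
  by (induction n) (auto simp: deh_mult)

lemma deh_scale: "deh (form_scale c f) = smult c (deh f)"
  by (rule poly_eqI) (simp add: coeff_deh)

definition hmg :: "nat \<Rightarrow> 'a::field poly \<Rightarrow> 'a poly poly" where
  "hmg d p = (\<Sum>j\<le>d. monom (monom (coeff p j) (d - j)) j)"

lemma coeff_hmg: "coeff (hmg d p) j = (if j \<le> d then monom (coeff p j) (d - j) else 0)"
  by (simp add: hmg_def coeff_sum)

lemma hmg_binary [simp]: "hmg d p \<in> binary_forms d"
  by (auto simp: binary_forms_def coeff_hmg split: if_splits)

lemma coeff_binary_form:
  assumes "f \<in> binary_forms d"
  shows "coeff f j = (if j \<le> d then monom (coeff (coeff f j) (d - j)) (d - j) else 0)"
proof (rule poly_eqI)
  fix i
  show "coeff (coeff f j) i = coeff (if j \<le> d then monom (coeff (coeff f j) (d - j)) (d - j) else 0) i"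
    using assms unfolding binary_forms_def by (cases "i + j = d") auto
qed

lemma form_coord_deh:
  assumes "f \<in> binary_forms d"
  shows "form_coord d f = coeff (deh f)"
proof
  fix j
  show "form_coord d f j = coeff (deh f) j"
  proof (cases "j \<le> d")
    case True
    then show ?thesis unfolding form_coord_def coeff_deh
      by (subst (2) coeff_binary_form[OF assms]) (simp add: poly_monom)
  next
    case False
    then have "coeff f j = 0" using coeff_binary_form[OF assms, of j] by simp
    then show ?thesis by (simp add: form_coord_def coeff_deh)
  qed
qed

lemma hmg_deh: "f \<in> binary_forms d \<Longrightarrow> hmg d (deh f) = f"
  by (rule poly_eqI, subst (2) coeff_binary_form)
     (auto simp: coeff_hmg form_coord_deh[symmetric] form_coord_def)

lemma degree_deh: 
  assumes "f \<in> binary_forms d"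
  shows "degree (deh f) \<le> d"
  by (rule degree_le) (use assms in \<open>simp add: coeff_deh coeff_binary_form[OF assms]\<close>)

lemma deh_hmg: "degree p \<le> d \<Longrightarrow> deh (hmg d p) = p"
  by (rule poly_eqI) (auto simp: coeff_deh coeff_hmg poly_monom coeff_eq_0)

lemma form_coord_hmg: "degree p \<le> d \<Longrightarrow> form_coord d (hmg d p) = coeff p"
  by (simp add: form_coord_deh deh_hmg)

lemma hmg_0 [simp]: "hmg d 0 = 0"
  by (rule poly_eqI) (simp add: coeff_hmg)

lemma deh_eqI: "f \<in> binary_forms d \<Longrightarrow> g \<in> binary_forms d \<Longrightarrow> deh f = deh g \<Longrightarrow> f = g"
  by (metis hmg_deh)

lemma deh_eq_0_iff: "f \<in> binary_forms d \<Longrightarrow> deh f = 0 \<longleftrightarrow> f = 0"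
  using hmg_deh[of f d] by auto

lemma hmg_scale: "form_scale c (hmg d p) = hmg d (smult c p)"
  by (rule poly_eqI) (simp add: coeff_hmg smult_monom)

lemma hmg_add: "hmg d (p + q) = hmg d p + hmg d q"
  by (rule poly_eqI) (simp add: coeff_hmg add_monom)

lemma hmg_eq_0_iff: "degree p \<le> d \<Longrightarrow> hmg d p = 0 \<longleftrightarrow> p = 0"
  using deh_hmg[of p d] by auto

lemma form_scale_binary: "f \<in> binary_forms d \<Longrightarrow> form_scale c f \<in> binary_forms d"
  by (auto simp: binary_forms_def)

lemma form_coord_scale: "form_coord d (form_scale c f) = (\<lambda>j. c * form_coord d f j)"
  by (auto simp: form_coord_def)

lemma binary_forms_mult:
  assumes "f \<in> binary_forms a" "g \<in> binary_forms b"
  shows "f * g \<in> binary_forms (a + b)"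
  unfolding binary_forms_def
proof (intro CollectI allI impI)
  fix i j assume "coeff (coeff (f * g) j) i \<noteq> 0"
  then have "(\<Sum>k\<le>j. \<Sum>l\<le>i. coeff (coeff f k) l * coeff (coeff g (j - k)) (i - l)) \<noteq> 0"
    by (simp add: coeff_mult coeff_sum)
  then obtain k where k: "k \<le> j" "(\<Sum>l\<le>i. coeff (coeff f k) l * coeff (coeff g (j - k)) (i - l)) \<noteq> 0"
    by (rule sum.not_neutral_contains_not_neutral) auto
  from k(2) obtain l where l: "l \<le> i" "coeff (coeff f k) l * coeff (coeff g (j - k)) (i - l) \<noteq> 0"
    by (rule sum.not_neutral_contains_not_neutral) auto
  then have "l + k = a" "i - l + (j - k) = b" using assms by (auto simp: binary_forms_def)
  then show "i + j = a + b" using k l by linarith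
qed

lemma binary_forms_power: "f \<in> binary_forms a \<Longrightarrow> f ^ n \<in> binary_forms (a * n)"
proof (induction n)
  case 0
  show ?case by (auto simp: binary_forms_def coeff_1 split: if_splits)
next
  case (Suc n)
  then show ?case using binary_forms_mult[of f a "f ^ n" "a * n"] by simp
qed

lemma binary_forms_prod: "(\<And>i. i \<in> A \<Longrightarrow> f i \<in> binary_forms (a i)) \<Longrightarrow> (\<Prod>i\<in>A. f i) \<in> binary_forms (\<Sum>i\<in>A. a i)"
proof (induction A rule: infinite_finite_induct)
  case (insert i A)
  then show ?case using binary_forms_mult[of "f i" "a i"] by simp
qed (auto simp: binary_forms_def coeff_1 split: if_splits)

lemma binary_forms_sum: "(\<And>i. i \<in> A \<Longrightarrow> f i \<in> binary_forms a) \<Longrightarrow> (\<Sum>i\<in>A. f i) \<in> binary_forms a"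
proof -
  assume a: "\<And>i. i \<in> A \<Longrightarrow> f i \<in> binary_forms a"
  show ?thesis unfolding binary_forms_def
  proof (intro CollectI allI impI)
    fix i j assume "coeff (coeff (sum f A) j) i \<noteq> 0"
    then have "(\<Sum>k\<in>A. coeff (coeff (f k) j) i) \<noteq> 0" by (simp add: coeff_sum)
    then obtain k where "k \<in> A" "coeff (coeff (f k) j) i \<noteq> 0"
      by (rule sum.not_neutral_contains_not_neutral) auto
    then show "i + j = a" using a by (auto simp: binary_forms_def)
  qed
qed

lemma binary_forms_zero: "0 \<in> binary_forms d"
  by (auto simp: binary_forms_def)

lemma proj_class_eqD: "proj_class f = proj_class g \<Longrightarrow> \<exists>c. c \<noteq> 0 \<and> f = form_scale c g"
proof -
  assume "proj_class f = proj_class g"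
  moreover have "f \<in> proj_class f" unfolding proj_class_def by (intro CollectI exI[of _ 1]) (auto simp flip: one_pCons)
  ultimately show ?thesis unfolding proj_class_def by blast
qed

lemma proj_class_scale: 
  assumes "c \<noteq> 0"
  shows "proj_class (form_scale c f) = proj_class f"
proof -
  have "form_scale e f = form_scale (e / c) (form_scale c f)" "e / c \<noteq> 0 \<longleftrightarrow> e \<noteq> 0" for e using assms by simp_all
  moreover have "form_scale e (form_scale c f) = form_scale (e * c) f" "e * c \<noteq> 0 \<longleftrightarrow> e \<noteq> 0" for e using assms by simp_all
  ultimately show ?thesis unfolding proj_class_def by blast
qed

section \<open>Zariski topology\<close>

definition zbasic :: "nat \<Rightarrow> (nat, 'a::field) mpolynomial \<Rightarrow> 'a poly poly set set" where
  "zbasic d F = {proj_class f | f. f \<in> binary_forms d - {0} \<and> mp_eval (form_coord d f) F \<noteq> 0}"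

lemma zariski_alt: "zariski d = topology_generated_by (zbasic d ` homogeneous_polys d)"
  unfolding zariski_def zbasic_def by (rule arg_cong[where f=topology_generated_by]) auto

lemma zbasic_iff:
  assumes "F \<in> homogeneous_polys d" "f \<in> binary_forms d - {0}"
  shows "proj_class f \<in> zbasic d F \<longleftrightarrow> mp_eval (form_coord d f) F \<noteq> 0"
proof
  assume "proj_class f \<in> zbasic d F"
  then obtain f' where f': "proj_class f = proj_class f'" "mp_eval (form_coord d f') F \<noteq> 0"
    unfolding zbasic_def by blast
  from proj_class_eqD[OF f'(1)] obtain c where "c \<noteq> 0" "f = form_scale c f'" by blast
  moreover obtain e where "mp_hom e F" using assms(1) homogeneous_polys_iff by blast
  ultimately show "mp_eval (form_coord d f) F \<noteq> 0" using f'(2) by (simp add: form_coord_scale mp_hom_scale)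
qed (use assms in \<open>auto simp: zbasic_def\<close>)

lemma topspace_zariski: "topspace (zariski d) = proj_class ` (binary_forms d - {0})"
proof -
  have "proj_class f \<in> zbasic d 1" if "f \<in> binary_forms d - {0}" for f :: "'a poly poly"
    using that zbasic_iff[OF one_homogeneous(1) that] by (simp add: one_homogeneous)
  then have "proj_class ` (binary_forms d - {0}) \<subseteq> (zbasic d 1 :: 'a poly poly set set)" by blast
  moreover have "zbasic d F \<subseteq> proj_class ` (binary_forms d - {0})" for F :: "(nat, 'a) mpolynomial" 
    unfolding zbasic_def by blast
  ultimately show ?thesis unfolding zariski_alt topology_generated_by_topspace
    by (intro equalityI UN_least order.trans[OF _ UN_upper[OF one_homogeneous(1)]])
qed

text \<open>Products of homogeneous polynomials turn finite intersections into basic sets, so the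
  generating sets form a basis.\<close>

lemma openin_zariskiD:
  assumes "openin (zariski d) T" "f \<in> binary_forms d - {0}" "proj_class f \<in> T"
  shows "\<exists>F\<in>homogeneous_polys d. mp_eval (form_coord d f) F \<noteq> 0 \<and> 
    (\<forall>f'\<in>binary_forms d - {0}. mp_eval (form_coord d f') F \<noteq> 0 \<longrightarrow> proj_class f' \<in> T)"
proof -
  have "generate_topology_on (zbasic d ` homogeneous_polys d) T"
    using assms(1) by (simp add: zariski_alt openin_topology_generated_by_iff)
  then show ?thesis using assms(3)
  proof (induction rule: generate_topology_on.induct)
    case (Int A B)
    then obtain F G where "F \<in> homogeneous_polys d" "G \<in> homogeneous_polys d"
      "mp_eval (form_coord d f) F \<noteq> 0" "mp_eval (form_coord d f) G \<noteq> 0"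
      "\<forall>f'\<in>binary_forms d - {0}. mp_eval (form_coord d f') F \<noteq> 0 \<longrightarrow> proj_class f' \<in> A"
      "\<forall>f'\<in>binary_forms d - {0}. mp_eval (form_coord d f') G \<noteq> 0 \<longrightarrow> proj_class f' \<in> B" by blast
    then show ?case
      by (intro bexI[of _ "F * G"]) (auto simp: mp_eval_mult homogeneous_polys_mult)
  next
    case (UN K)
    then obtain k where "k \<in> K" "proj_class f \<in> k" by blast
    from UN.IH[OF this] this(1) show ?case by blast
  next
    case (Basis s)
    then obtain F where "F \<in> homogeneous_polys d" "s = zbasic d F" by blast
    then show ?case using zbasic_iff Basis(2) assms(2) by blast
  qed auto
qed

text \<open>Only generators have to be tested: "contains \<open>p t\<close> for cofinitely many
  \<open>t\<close>" is inherited by finite intersections and by unions, so every neighbourhood of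
  \<open>p t0\<close> meets \<open>A\<close>.\<close>

lemma curve_in_closure_of:
  fixes p :: "'a::field_char_0 \<Rightarrow> 'b"
  assumes "p t0 \<in> \<Union>S" 
    and basic: "\<And>B. B \<in> S \<Longrightarrow> p t0 \<in> B \<Longrightarrow> \<forall>\<^sub>F t in cofinite. p t \<in> B"
    and "\<forall>\<^sub>F t in cofinite. p t \<in> A"
  shows "p t0 \<in> topology_generated_by S closure_of A"
  unfolding in_closure_of
proof (intro conjI allI impI)
  show "p t0 \<in> topspace (topology_generated_by S)" using assms(1) by (simp add: topology_generated_by_topspace)
  fix T assume T: "p t0 \<in> T \<and> openin (topology_generated_by S) T"
  then have "generate_topology_on S T" by (simp add: openin_topology_generated_by_iff)
  then have "p t0 \<in> T \<longrightarrow> (\<forall>\<^sub>F t in cofinite. p t \<in> T)"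
  proof (induction rule: generate_topology_on.induct)
    case (Int A B)
    then show ?case by (auto elim: eventually_elim2)
  next
    case (UN K)
    show ?case
    proof
      assume "p t0 \<in> \<Union>K"
      then obtain k where k: "k \<in> K" "p t0 \<in> k" by blast
      with UN.IH have "\<forall>\<^sub>F t in cofinite. p t \<in> k" by blast
      then show "\<forall>\<^sub>F t in cofinite. p t \<in> \<Union>K" by eventually_elim (use k in blast)
    qed
  qed (use basic in auto)
  with T assms(3) have "\<forall>\<^sub>F t in cofinite. p t \<in> A \<and> p t \<in> T" by (auto intro: eventually_conj)
  from cofinite_ex[OF this] show "\<exists>y. y \<in> A \<and> y \<in> T" by blast
qed

lemma mp_eval_curve:
  assumes "mp_over I F" "\<And>i. i \<in> I \<Longrightarrow> curvefun (\<lambda>t. x t i)"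
  shows "curvefun (\<lambda>t. mp_eval (x t) F)"
  by (rule polyfun_compose_coords[OF polyfun_mp_eval[OF assms(1)]]) (rule assms(2))

lemma form_curve_nonzero:
  fixes \<gamma> :: "'a::field_char_0 \<Rightarrow> 'a poly poly"
  assumes "\<And>t. \<gamma> t \<in> binary_forms d" "\<And>j. j \<le> d \<Longrightarrow> curvefun (\<lambda>t. form_coord d (\<gamma> t) j)" "\<gamma> t0 \<noteq> 0"
  shows "\<forall>\<^sub>F t in cofinite. \<gamma> t \<noteq> 0"
proof -
  have "deh (\<gamma> t0) \<noteq> 0" using assms(1,3) deh_eq_0_iff by blast
  then obtain j where j: "coeff (deh (\<gamma> t0)) j \<noteq> 0" by (metis leading_coeff_0_iff)
  then have "j \<le> d" using degree_deh[OF assms(1)] by (meson le_degree le_trans)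
  have "form_coord d (\<gamma> t0) j \<noteq> 0" using j form_coord_deh[OF assms(1)] by simp
  from curvefun_generic[of "\<lambda>t. form_coord d (\<gamma> t) j", OF assms(2)[OF \<open>j \<le> d\<close>] this]
  show ?thesis by eventually_elim (auto simp: form_coord_def)
qed

lemma zariski_curve_closure:
  fixes \<gamma> :: "'a::field_char_0 \<Rightarrow> 'a poly poly"
  assumes "\<And>t. \<gamma> t \<in> binary_forms d" "\<And>j. j \<le> d \<Longrightarrow> curvefun (\<lambda>t. form_coord d (\<gamma> t) j)" "\<gamma> t0 \<noteq> 0"
    and "\<forall>\<^sub>F t in cofinite. proj_class (\<gamma> t) \<in> A"
  shows "proj_class (\<gamma> t0) \<in> zariski d closure_of A"
  unfolding zariski_alt
proof (rule curve_in_closure_of[where p="\<lambda>t. proj_class (\<gamma> t)"])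
  have "proj_class (\<gamma> t0) \<in> topspace (zariski d)" unfolding topspace_zariski using assms(1,3) by auto
  then show "proj_class (\<gamma> t0) \<in> \<Union> (zbasic d ` homogeneous_polys d)" 
    by (simp only: zariski_alt topology_generated_by_topspace)
  fix B assume "B \<in> zbasic d ` homogeneous_polys d" and B: "proj_class (\<gamma> t0) \<in> B"
  then obtain F where F: "F \<in> homogeneous_polys d" "B = zbasic d F" by blast
  have ne: "mp_eval (form_coord d (\<gamma> t0)) F \<noteq> 0" using zbasic_iff[OF F(1)] B F(2) assms(1,3) by auto
  have "mp_over {..d} F" using F(1) homogeneous_polys_iff by blast
  then have "curvefun (\<lambda>t. mp_eval (form_coord d (\<gamma> t)) F)" by (rule mp_eval_curve) (use assms(2) in auto)
  moreover have "\<forall>\<^sub>F t in cofinite. \<gamma> t \<noteq> 0" by (rule form_curve_nonzero[OF assms(1) assms(2) assms(3)])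
  ultimately have "\<forall>\<^sub>F t in cofinite. mp_eval (form_coord d (\<gamma> t)) F \<noteq> 0 \<and> \<gamma> t \<noteq> 0"
    using ne by (intro eventually_conj curvefun_generic[where ?t0.0=t0]) auto
  then
  show "\<forall>\<^sub>F t in cofinite. proj_class (\<gamma> t) \<in> B"
    by eventually_elim (use zbasic_iff[OF F(1)] F(2) assms(1) in auto)
qed (rule assms(4))

text \<open>An inhomogeneous separating function is enough. The condition on \<open>Z\<close> is
  invariant under scaling, so each homogeneous component still vanishes on \<open>Z\<close>, and one
  of them is nonzero at \<open>f\<close>.\<close>

lemma closedin_zariskiI:
  assumes "Z \<subseteq> proj_class ` (binary_forms d - {0})"
    and "\<And>f. f \<in> binary_forms d - {0} \<Longrightarrow> proj_class f \<notin> Z \<Longrightarrow> 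
      \<exists>\<psi>. polyfun (coords {..d}) \<psi> \<and> \<psi> (form_coord d f) \<noteq> 0 \<and> 
        (\<forall>f'\<in>binary_forms d - {0}. proj_class f' \<in> Z \<longrightarrow> \<psi> (form_coord d f') = 0)"
  shows "closedin (zariski d) (Z :: 'a::field_char_0 poly poly set set)"
  unfolding closedin_def
proof (intro conjI)
  show "Z \<subseteq> topspace (zariski d)" using assms(1) topspace_zariski by blast
  show "openin (zariski d) (topspace (zariski d) - Z)"
  proof (subst openin_subopen, intro ballI)
    fix z assume "z \<in> topspace (zariski d) - Z"
    then obtain f where f: "z = proj_class f" "f \<in> binary_forms d - {0}" "proj_class f \<notin> Z"
      by (auto simp: topspace_zariski)
    obtain \<psi> where psi: "polyfun (coords {..d}) \<psi>" "\<psi> (form_coord d f) \<noteq> 0"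
      "\<forall>f'\<in>binary_forms d - {0}. proj_class f' \<in> Z \<longrightarrow> \<psi> (form_coord d f') = 0" using assms(2)[OF f(2,3)] by blast
    obtain F where F: "mp_over {..d} F" "\<forall>x. mp_eval x F = \<psi> x" using polyfun_imp_mp[OF psi(1)] by blast
    obtain e where e: "mp_eval (form_coord d f) (hcomp e F) \<noteq> 0" using hcomp_eval_nonzero psi(2) F(2) by metis
    have h: "hcomp e F \<in> homogeneous_polys d" using F(1) hcomp_hom homogeneous_polys_iff by blast
    have "proj_class f' \<notin> Z" if f': "f' \<in> binary_forms d - {0}" "mp_eval (form_coord d f') (hcomp e F) \<noteq> 0" for f'
    proof
      assume Z: "proj_class f' \<in> Z"
      have "mp_eval (\<lambda>i. c * form_coord d f' i) F = 0" if "c \<noteq> 0" for c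
      proof -
        have "form_scale c f' \<in> binary_forms d - {0}" using f' that form_scale_binary[of f' d c] by auto
        moreover have "proj_class (form_scale c f') \<in> Z" using Z proj_class_scale[OF that] by simp
        ultimately have "\<psi> (form_coord d (form_scale c f')) = 0" using psi(3) by blast
        then show ?thesis using F(2) by (simp only: form_coord_scale)
      qed
      from hcomp_vanishes[OF this] f'(2) show False by blast
    qed
    then have "zbasic d (hcomp e F) \<subseteq> topspace (zariski d) - Z" unfolding topspace_zariski zbasic_def by blast
    moreover have "openin (zariski d) (zbasic d (hcomp e F))" 
      unfolding zariski_alt by (rule topology_generated_by_Basis) (use h in auto)
    moreover have "z \<in> zbasic d (hcomp e F)" using zbasic_iff[OF h f(2)] e f(1) by blast
    ultimately show "\<exists>T. openin (zariski d) T \<and> z \<in> T \<and> T \<subseteq> topspace (zariski d) - Z" by blast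
  qed
qed

section \<open>The product of two projective spaces and its second projection\<close>

definition zpbasic :: "nat \<Rightarrow> (nat + nat, 'a::field) mpolynomial \<Rightarrow> ('a poly poly set \<times> 'a poly poly set) set" where
  "zpbasic d F = {(proj_class f, proj_class g) | f g.
         f \<in> binary_forms d - {0} \<and> g \<in> binary_forms d - {0} \<and>
         mp_eval (case_sum (form_coord d f) (form_coord d g)) F \<noteq> 0}"

lemma zariski_prod_alt: "zariski_prod d = topology_generated_by (zpbasic d ` bihomogeneous_polys d)"
  unfolding zariski_prod_def zpbasic_def by (rule arg_cong[where f=topology_generated_by]) auto

lemma bihomogeneous_scale:
  assumes "F \<in> bihomogeneous_polys d"
  shows "\<exists>a b. \<forall>c e x y. mp_eval (case_sum (\<lambda>i. c * x i) (\<lambda>i. e * y i)) F = c ^ a * e ^ b * mp_eval (case_sum x y) F"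
proof -
  let ?A = "Inl ` {..d} \<union> Inr ` {..d} :: (nat + nat) set"
  obtain a b where ab: "\<forall>m\<in>pmkeys F. pmkeys m \<subseteq> ?A"
    "\<forall>m\<in>pmkeys F. (\<Sum>i\<le>d. lkp m (Inl i)) = a \<and> (\<Sum>i\<le>d. lkp m (Inr i)) = b"
    using assms unfolding bihomogeneous_polys_def by blast
  have m: "monval (case_sum x y) m = (\<Prod>i\<le>d. x i ^ lkp m (Inl i)) * (\<Prod>i\<le>d. y i ^ lkp m (Inr i))"
    if "m \<in> pmkeys F" for m and x y :: "nat \<Rightarrow> 'a"
  proof -
    have "monval (case_sum x y) m = (\<Prod>i\<in>?A. case_sum x y i ^ lkp m i)"
      by (rule mon_superset) (use ab that in auto)
    also have "\<dots> = (\<Prod>i\<in>Inl ` {..d}. case_sum x y i ^ lkp m i) * (\<Prod>i\<in>Inr ` {..d}. case_sum x y i ^ lkp m i)"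
      by (rule prod.union_disjoint) auto
    finally show ?thesis by (simp add: prod.reindex)
  qed
  have "monval (case_sum (\<lambda>i. c * x i) (\<lambda>i. e * y i)) m = c ^ a * e ^ b * monval (case_sum x y) m"
    if "m \<in> pmkeys F" for m c e and x y :: "nat \<Rightarrow> 'a"
    unfolding m[OF that] power_mult_distrib prod.distrib power_sum[symmetric] using ab(2) that by (simp add: mult_ac)
  then have "mp_eval (case_sum (\<lambda>i. c * x i) (\<lambda>i. e * y i)) F = c ^ a * e ^ b * mp_eval (case_sum x y) F" for c e x y
    unfolding mp_eval_mon sum_distrib_left by (intro sum.cong) auto
  then show ?thesis by blast
qed

lemma zpbasic_iff:
  assumes "F \<in> bihomogeneous_polys d" "f \<in> binary_forms d - {0}" "g \<in> binary_forms d - {0}"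
  shows "(proj_class f, proj_class g) \<in> zpbasic d F \<longleftrightarrow> mp_eval (case_sum (form_coord d f) (form_coord d g)) F \<noteq> 0"
proof
  assume "(proj_class f, proj_class g) \<in> zpbasic d F"
  then obtain f' g' where f': "proj_class f = proj_class f'" "proj_class g = proj_class g'"
    "mp_eval (case_sum (form_coord d f') (form_coord d g')) F \<noteq> 0"
    unfolding zpbasic_def by blast
  obtain c e where ce: "c \<noteq> 0" "f = form_scale c f'" "e \<noteq> 0" "g = form_scale e g'" 
    using proj_class_eqD[OF f'(1)] proj_class_eqD[OF f'(2)] by blast
  obtain a b where "\<forall>c e x y. mp_eval (case_sum (\<lambda>i. c * x i) (\<lambda>i. e * y i)) F = c ^ a * e ^ b * mp_eval (case_sum x y) F"
    using bihomogeneous_scale[OF assms(1)] by blast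
  then show "mp_eval (case_sum (form_coord d f) (form_coord d g)) F \<noteq> 0" 
    unfolding ce(2,4) form_coord_scale using ce f'(3) by simp
qed (use assms in \<open>auto simp: zpbasic_def\<close>)

lemma one_bihomogeneous: "1 \<in> bihomogeneous_polys d"
  by (auto simp: bihomogeneous_polys_def)

lemma topspace_zariski_prod: 
  "topspace (zariski_prod d) = {(proj_class f, proj_class g) | f g. f \<in> binary_forms d - {0} \<and> g \<in> binary_forms d - {0}}"
proof -
  have "(proj_class f, proj_class g) \<in> zpbasic d 1" if "f \<in> binary_forms d - {0}" "g \<in> binary_forms d - {0}" for f g :: "'a poly poly"
    using that zpbasic_iff[OF one_bihomogeneous that] by (simp add: one_homogeneous)
  then have "{(proj_class f, proj_class g) | f g. f \<in> binary_forms d - {0} \<and> g \<in> binary_forms d - {0}} \<subseteq> 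
    (zpbasic d 1 :: ('a poly poly set \<times> _) set)" by blast
  moreover have "zpbasic d F \<subseteq> {(proj_class f, proj_class g) | f g. f \<in> binary_forms d - {0} \<and> g \<in> binary_forms d - {0}}"
    for F :: "(nat + nat, 'a) mpolynomial" unfolding zpbasic_def by blast
  ultimately show ?thesis unfolding zariski_prod_alt topology_generated_by_topspace
    by (intro equalityI UN_least order.trans[OF _ UN_upper[OF one_bihomogeneous]])
qed

lemma zariski_prod_curve_closure:
  fixes \<gamma> \<delta> :: "'a::field_char_0 \<Rightarrow> 'a poly poly"
  assumes g: "\<And>t. \<gamma> t \<in> binary_forms d" "\<And>j. j \<le> d \<Longrightarrow> curvefun (\<lambda>t. form_coord d (\<gamma> t) j)" "\<gamma> t0 \<noteq> 0"
    and d: "\<And>t. \<delta> t \<in> binary_forms d" "\<And>j. j \<le> d \<Longrightarrow> curvefun (\<lambda>t. form_coord d (\<delta> t) j)" "\<delta> t0 \<noteq> 0"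
    and "\<forall>\<^sub>F t in cofinite. (proj_class (\<gamma> t), proj_class (\<delta> t)) \<in> A"
  shows "(proj_class (\<gamma> t0), proj_class (\<delta> t0)) \<in> zariski_prod d closure_of A"
  unfolding zariski_prod_alt
proof (rule curve_in_closure_of[where p="\<lambda>t. (proj_class (\<gamma> t), proj_class (\<delta> t))"])
  have "(proj_class (\<gamma> t0), proj_class (\<delta> t0)) \<in> topspace (zariski_prod d)" 
    unfolding topspace_zariski_prod using g(1,3) d(1,3) by blast
  then show "(proj_class (\<gamma> t0), proj_class (\<delta> t0)) \<in> \<Union> (zpbasic d ` bihomogeneous_polys d)" 
    by (simp only: zariski_prod_alt topology_generated_by_topspace)
  fix B assume "B \<in> zpbasic d ` bihomogeneous_polys d" and B: "(proj_class (\<gamma> t0), proj_class (\<delta> t0)) \<in> B"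
  then obtain F where F: "F \<in> bihomogeneous_polys d" "B = zpbasic d F" by blast
  have ne: "mp_eval (case_sum (form_coord d (\<gamma> t0)) (form_coord d (\<delta> t0))) F \<noteq> 0" 
    using zpbasic_iff[OF F(1)] B F(2) g(1,3) d(1,3) by auto
  have "mp_over (Inl ` {..d} \<union> Inr ` {..d}) F" using F(1) by (auto simp: bihomogeneous_polys_def mp_over_def)
  then have "curvefun (\<lambda>t. mp_eval (case_sum (form_coord d (\<gamma> t)) (form_coord d (\<delta> t))) F)" 
    by (rule mp_eval_curve) (use g(2) d(2) in auto)
  moreover have "\<forall>\<^sub>F t in cofinite. \<gamma> t \<noteq> 0" by (rule form_curve_nonzero[OF g(1) g(2) g(3)])
  moreover have "\<forall>\<^sub>F t in cofinite. \<delta> t \<noteq> 0" by (rule form_curve_nonzero[OF d(1) d(2) d(3)])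
  ultimately have "\<forall>\<^sub>F t in cofinite. mp_eval (case_sum (form_coord d (\<gamma> t)) (form_coord d (\<delta> t))) F \<noteq> 0 \<and> \<gamma> t \<noteq> 0 \<and> \<delta> t \<noteq> 0"
    using ne by (intro eventually_conj curvefun_generic[where ?t0.0=t0]) auto
  then
  show "\<forall>\<^sub>F t in cofinite. (proj_class (\<gamma> t), proj_class (\<delta> t)) \<in> B"
    by eventually_elim (use zpbasic_iff[OF F(1)] F(2) g(1) d(1) in auto)
qed (rule assms(7))

text \<open>This is continuity of the second projection: the preimage of a basic open set is the
  basic open set of its pullback.\<close>

lemma snd_closure_subset:
  "snd ` (zariski_prod d closure_of A) \<subseteq> zariski d closure_of (snd ` (A :: ('a::field_char_0 poly poly set \<times> 'a poly poly set) set))"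
proof (rule continuous_map_image_closure_subset)
  show "continuous_map (zariski_prod d) (zariski d) (snd :: 'a poly poly set \<times> 'a poly poly set \<Rightarrow> _)"
    unfolding zariski_alt
  proof (rule continuous_on_generated_topo)
    fix U :: "'a poly poly set set" assume "U \<in> zbasic d ` homogeneous_polys d"
    then obtain F where F: "F \<in> homogeneous_polys d" "U = zbasic d F" by blast
    have over: "mp_over {..d} F" using F(1) homogeneous_polys_iff by blast
    have "snd -` U \<inter> topspace (zariski_prod d) = zpbasic d (inr_poly d F)"
    proof -
      have "snd -` U \<inter> topspace (zariski_prod d) = {(proj_class f, proj_class g) | f g. 
        f \<in> binary_forms d - {0} \<and> g \<in> binary_forms d - {0} \<and> proj_class g \<in> U}"
        unfolding topspace_zariski_prod by (auto; blast)
      also have "\<dots> = zpbasic d (inr_poly d F)"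
        unfolding zpbasic_def inr_poly_eval[OF over] F(2) using zbasic_iff[OF F(1)] by blast
      finally show ?thesis .
    qed
    then show "openin (zariski_prod d) (snd -` U \<inter> topspace (zariski_prod d))"
      unfolding zariski_prod_alt using inr_poly_bihomogeneous[OF F(1)]
      by (auto intro: topology_generated_by_Basis)
  next
    have "snd ` topspace (zariski_prod d) \<subseteq> topspace (zariski d)"
      unfolding topspace_zariski_prod topspace_zariski by auto
    then show "snd ` topspace (zariski_prod d) \<subseteq> \<Union> (zbasic d ` homogeneous_polys d)"
      by (simp only: zariski_alt topology_generated_by_topspace)
  qed
qed

section \<open>Apolarity\<close>

text \<open>The linear functional on polynomials of degree at most \<open>d\<close> whose moments
  are \<open>a\<close>. A form is studied through this functional, with the factorials of the
  pairing absorbed into \<open>a\<close>.\<close>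

definition ap :: "(nat \<Rightarrow> 'a::field) \<Rightarrow> nat \<Rightarrow> 'a poly \<Rightarrow> 'a" where
  "ap a d p = (\<Sum>j\<le>d. coeff p j * a j)"

lemma ap_add: "ap a d (p + q) = ap a d p + ap a d q"
  by (simp add: ap_def sum.distrib distrib_right)

lemma ap_smult: "ap a d (smult c p) = c * ap a d p"
  by (simp add: ap_def sum_distrib_left mult_ac)

lemma ap_0 [simp]: "ap a d 0 = 0"
  by (simp add: ap_def)

lemma ap_diff: "ap a d (p - q) = ap a d p - ap a d q"
  by (simp add: ap_def sum_subtractf left_diff_distrib)

lemma ap_sum: "ap a d (\<Sum>i\<in>A. f i) = (\<Sum>i\<in>A. ap a d (f i))"
  by (induction A rule: infinite_finite_induct) (auto simp: ap_add)

lemma ap_monom: "j \<le> d \<Longrightarrow> ap a d (monom 1 j) = a j"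
  by (simp add: ap_def if_distrib[where f="\<lambda>x. x * _"] cong: if_cong)

text \<open>The form \<open>h\<close> of degree \<open>n\<close> annihilates the form whose coefficients, multiplied by \<open>j! (d - j)!\<close>,
  are \<open>a\<close>. For \<open>n > d\<close> the condition on \<open>q\<close> is void.\<close>

definition apolar :: "(nat \<Rightarrow> 'a::field) \<Rightarrow> nat \<Rightarrow> nat \<Rightarrow> 'a poly \<Rightarrow> bool" where
  "apolar a d n h \<longleftrightarrow> degree h \<le> n \<and> (\<forall>q. degree q + n \<le> d \<longrightarrow> ap a d (h * q) = 0)"

lemma ap_mult_monom:
  assumes "degree h \<le> n" "e + n \<le> d"
  shows "ap a d (h * monom 1 e) = (\<Sum>j\<le>n. coeff h j * a (e + j))"
proof -
  have "ap a d (h * monom 1 e) = (\<Sum>i\<le>d. (if i < e then 0 else coeff h (i - e)) * a i)"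
    unfolding ap_def by (intro sum.cong refl) (auto simp: coeff_monom_mult mult.commute[of h])
  also have "\<dots> = (\<Sum>i\<in>{e..e+n}. coeff h (i - e) * a i)"
    using assms by (intro sum.mono_neutral_cong_right) (auto simp: coeff_eq_0)
  also have "\<dots> = (\<Sum>j\<le>n. coeff h j * a (e + j))"
    by (rule sum.reindex_bij_witness[of _ "\<lambda>j. e + j" "\<lambda>i. i - e"]) auto
  finally show ?thesis .
qed

text \<open>Testing on monomials suffices; the conditions become linear equations for the
  coefficients of \<open>h\<close> with a Hankel matrix.\<close>

lemma apolar_iff:
  "apolar a d n h \<longleftrightarrow> degree h \<le> n \<and> (\<forall>e. e + n \<le> d \<longrightarrow> (\<Sum>j\<le>n. coeff h j * a (e + j)) = 0)"
proof (cases "degree h \<le> n")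
  case True
  have "ap a d (h * q) = 0" if e: "\<forall>e. e + n \<le> d \<longrightarrow> (\<Sum>j\<le>n. coeff h j * a (e + j)) = 0" "degree q + n \<le> d" for q
  proof -
    have q: "q = (\<Sum>e\<le>degree q. smult (coeff q e) (monom 1 e))"
      by (simp add: smult_monom poly_as_sum_of_monoms)
    have "ap a d (h * q) = (\<Sum>e\<le>degree q. coeff q e * ap a d (h * monom 1 e))"
      by (subst q) (simp add: sum_distrib_left ap_sum ap_smult)
    also have "\<dots> = 0"
      using e by (intro sum.neutral) (auto simp: ap_mult_monom[OF True])
    finally show ?thesis .
  qed
  moreover have "(\<Sum>j\<le>n. coeff h j * a (e + j)) = 0" 
    if "\<forall>q. degree q + n \<le> d \<longrightarrow> ap a d (h * q) = 0" "e + n \<le> d" for e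
    using that(1)[rule_format, of "monom 1 e"] that(2) by (simp add: ap_mult_monom[OF True] degree_monom_eq)
  ultimately show ?thesis unfolding apolar_def using True by blast
qed (simp add: apolar_def)

lemma apolar_mono: "apolar a d n h \<Longrightarrow> n \<le> m \<Longrightarrow> apolar a d m h"
  by (auto simp: apolar_def)

lemma apolar_mult: 
  assumes "apolar a d n h" "degree r \<le> m" 
  shows "apolar a d (n + m) (h * r)"
  unfolding apolar_def
proof (intro conjI allI impI)
  show "degree (h * r) \<le> n + m" using assms by (metis add_mono apolar_def degree_mult_le le_trans)
  fix q :: "'a poly" assume "degree q + (n + m) \<le> d"
  then have "degree (r * q) + n \<le> d" using degree_mult_le[of r q] assms(2) by linarith
  then show "ap a d (h * r * q) = 0" using assms(1) by (simp add: apolar_def mult.assoc)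
qed

lemma apolar_add: "apolar a d n h \<Longrightarrow> apolar a d n g \<Longrightarrow> apolar a d n (h + g)"
  by (auto simp: apolar_def ap_add distrib_right degree_add_le)

lemma apolar_smult: "apolar a d n h \<Longrightarrow> apolar a d n (smult c h)"
  by (auto simp: apolar_def ap_smult intro: order.trans[OF degree_smult_le])

lemma apolar_smultD: "apolar a d n (smult c h) \<Longrightarrow> c \<noteq> 0 \<Longrightarrow> apolar a d n h"
  using apolar_smult[of a d n "smult c h" "inverse c"] by simp

definition no_apolar :: "(nat \<Rightarrow> 'a::field) \<Rightarrow> nat \<Rightarrow> nat \<Rightarrow> bool" where
  "no_apolar a d n \<longleftrightarrow> (\<forall>h. apolar a d n h \<longrightarrow> h = 0)"

text \<open>If two annihilators have small total degree, their greatest common divisor annihilates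
  as well: \<open>g * q\<close> is written as \<open>p * U + h * V\<close> with cofactors small
  enough for both terms to be killed. By \<open>le\<close>, the common multiplicity at infinity is
  that of \<open>h\<close>, so the divisor has degree \<open>degree g + (n2 - degree h)\<close> as a
  form.\<close>

lemma apolar_common_divisor_aux:
  fixes p h g :: "'a::field poly"
  assumes p: "apolar a d n1 p" "p \<noteq> 0" and h: "apolar a d n2 h" "h \<noteq> 0"
    and g: "g dvd p" "g dvd h" "g = A * p + B * h"
    and le: "n2 - degree h \<le> n1 - degree p" "n1 + n2 \<le> d + 1 + (degree g + (n2 - degree h))"
  shows "apolar a d (degree g + (n2 - degree h)) g"
  unfolding apolar_def
proof (intro conjI allI impI)
  define e where "e = degree g + (n2 - degree h)"
  fix q :: "'a poly" assume q: "degree q + (degree g + (n2 - degree h)) \<le> d"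
  obtain p' h' where p': "p = g * p'" and h': "h = g * h'" using g(1,2) by (auto elim!: dvdE)
  have nz: "g \<noteq> 0" "p' \<noteq> 0" "h' \<noteq> 0" using p(2) h(2) p' h' by auto
  have dp: "degree p = degree g + degree p'" and dh: "degree h = degree g + degree h'"
    using nz by (simp_all add: p' h' degree_mult_eq)
  have pn: "degree p \<le> n1" "degree h \<le> n2" using p(1) h(1) by (auto simp: apolar_def)
  have "g * (A * p' + B * h') = g * 1" using g(3) by (simp add: p' h' algebra_simps)
  then have bez: "A * p' + B * h' = 1" using nz(1) mult_cancel_left by blast
  \<comment> \<open>Reducing the first Bezout cofactor modulo \<open>h'\<close> bounds its degree;
    the quotient moves into \<open>V\<close>, whose degree is then controlled by that of
    \<open>q - U * p'\<close>.\<close>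
  define U where "U = (q * A) mod h'"
  define V where "V = q * B + p' * ((q * A) div h')"
  have "q = (q * A) * p' + q * B * h'" using arg_cong[OF bez, of "\<lambda>x. q * x"] by (simp add: algebra_simps)
  also have "q * A = h' * ((q * A) div h') + U" by (simp add: U_def)
  finally have qUV: "q = U * p' + V * h'" by (simp only: V_def algebra_simps)
  have U: "U = 0 \<or> degree U < degree h'" unfolding U_def using degree_mod_less[OF nz(3)] by blast
  have "g * q = p * U + h * V" using qUV by (simp add: p' h' algebra_simps)
  then have "ap a d (g * q) = ap a d (p * U) + ap a d (h * V)" by (simp add: ap_add)
  also have "ap a d (p * U) = 0"
  proof (cases "U = 0")
    case False
    with U have "degree U + n1 \<le> d" using le(2) dh pn by linarith
    then show ?thesis using p(1) by (simp add: apolar_def)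
  qed simp
  also have "ap a d (h * V) = 0"
  proof (cases "V = 0")
    case False
    have "V * h' = q - U * p'" using qUV by simp
    moreover have "degree (V * h') = degree V + degree h'" using False nz by (simp add: degree_mult_eq)
    moreover have "degree (U * p') + e \<le> d"
    proof (cases "U = 0")
      case False
      then have "degree (U * p') = degree U + degree p'" using nz by (simp add: degree_mult_eq)
      then show ?thesis using U False le pn dp dh by (simp add: e_def)
    qed (use q in \<open>simp add: e_def\<close>)
    moreover have "degree q + e \<le> d" using q by (simp add: e_def)
    ultimately have "degree V + degree h' + e \<le> d" 
      using degree_diff_le_max[of q "U * p'"] by (metis (no_types, lifting) add_le_mono1 le_trans max_def)
    then have "degree V + n2 \<le> d" using dh pn by (simp add: e_def)
    then show ?thesis using h(1) by (simp add: apolar_def)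
  qed simp
  finally show "ap a d (g * q) = 0" by simp
qed simp

text \<open>The minimum is the multiplicity at infinity of the greatest common divisor of the two forms.\<close>

lemma apolar_common_divisor:
  fixes p h g :: "'a::field poly"
  assumes "apolar a d n1 p" "p \<noteq> 0" "apolar a d n2 h" "h \<noteq> 0"
    and "g dvd p" "g dvd h" "g = A * p + B * h"
    and "n1 + n2 \<le> d + 1 + (degree g + min (n1 - degree p) (n2 - degree h))"
  shows "apolar a d (degree g + min (n1 - degree p) (n2 - degree h)) g"
proof (cases "n2 - degree h \<le> n1 - degree p")
  case True
  then show ?thesis using apolar_common_divisor_aux[OF assms(1-7) True] assms(8) by (simp add: min_absorb2)
next
  case False
  have "g = B * h + A * p" using assms(7) by (simp add: add.commute)
  from apolar_common_divisor_aux[OF assms(3,4,1,2,6,5) this] False assms(8)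
  show ?thesis by (simp add: min_absorb1 add.commute)
qed

section \<open>Sums of powers\<close>

text \<open>No binomial coefficients appear: in the factorial normalization they combine to the
  constant \<open>d!\<close>, which a \<open>d\<close>-th root absorbs into the linear
  forms.\<close>

definition psum :: "nat \<Rightarrow> nat \<Rightarrow> (nat \<Rightarrow> 'a::field) \<Rightarrow> bool" where
  "psum d r a \<longleftrightarrow> (\<exists>\<alpha> \<beta>. \<forall>j\<le>d. a j = (\<Sum>i<r. \<alpha> i ^ (d - j) * \<beta> i ^ j))"

lemma psum_Suc:
  assumes "psum d r a"
  shows "psum d (Suc r) (\<lambda>j. a j + \<alpha> ^ (d - j) * \<beta> ^ j)"
proof -
  obtain A B where "\<forall>j\<le>d. a j = (\<Sum>i<r. A i ^ (d - j) * B i ^ j)" using assms unfolding psum_def by blast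
  then have "\<forall>j\<le>d. a j + \<alpha> ^ (d - j) * \<beta> ^ j = (\<Sum>i<Suc r. (A(r := \<alpha>)) i ^ (d - j) * (B(r := \<beta>)) i ^ j)"
    by simp
  then show ?thesis unfolding psum_def by blast
qed

lemma psum_cong: "(\<And>j. j \<le> d \<Longrightarrow> a j = b j) \<Longrightarrow> psum d r a = psum d r b"
  unfolding psum_def by simp

section \<open>From squarefree annihilators to sums of powers\<close>

lemma prod_linear_dvd:
  fixes r :: "'a::field poly"
  assumes "finite R" "\<And>x. x \<in> R \<Longrightarrow> poly r x = 0"
  shows "(\<Prod>x\<in>R. [:-x, 1:]) dvd r"
  using assms
proof (induction R rule: finite_induct)
  case (insert x R)
  then obtain s where s: "r = (\<Prod>x\<in>R. [:-x, 1:]) * s" by (auto elim!: dvdE)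
  have "poly (\<Prod>x\<in>R. [:-x, 1:]) x \<noteq> 0" using insert by (auto simp: poly_prod)
  moreover have "poly r x = 0" using insert by auto
  ultimately have "poly s x = 0" by (simp add: s)
  then have "[:-x, 1:] dvd s" by (simp only: poly_eq_0_iff_dvd)
  then have "[:-x, 1:] * (\<Prod>x\<in>R. [:-x, 1:]) dvd s * (\<Prod>x\<in>R. [:-x, 1:])" by (rule mult_dvd_mono) simp
  then show ?case using insert.hyps by (simp only: prod.insert s mult.commute[of s] not_False_eq_True)
qed auto

lemma degree_prod_linear: "degree (\<Prod>x\<in>R. [:-x, 1::'a::field:]) = card R"
  by (subst degree_prod_eq_sum_degree) auto

lemma prod_linear_nonzero: "(\<Prod>x\<in>R. [:-x, 1::'a::field:]) \<noteq> 0"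
  by (cases "finite R") auto

lemma prod_linear_squarefree:
  fixes x :: "'a::field"
  assumes "finite R" "[:-x, 1:] ^ 2 dvd (\<Prod>x\<in>R. [:-x, 1:])"
  shows False
proof -
  have "poly (\<Prod>x\<in>R. [:-x, 1:]) x = 0" using assms(2) by (auto simp: power2_eq_square elim!: dvdE)
  then have "x \<in> R" using assms(1) by (auto simp: poly_prod)
  then have "(\<Prod>x\<in>R. [:-x, 1:]) = [:-x, 1:] * (\<Prod>x\<in>R - {x}. [:-x, 1:])" using assms(1) by (simp add: prod.remove)
  then have "[:-x, 1:] * [:-x, 1:] dvd [:-x, 1:] * (\<Prod>x\<in>R - {x}. [:-x, 1:])" using assms(2) by (simp add: power2_eq_square)
  then have "[:-x, 1:] dvd (\<Prod>x\<in>R - {x}. [:-x, 1:])" by (subst (asm) dvd_times_left_cancel_iff) auto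
  then have "poly (\<Prod>x\<in>R - {x}. [:-x, 1:]) x = 0" by (simp only: poly_eq_0_iff_dvd)
  then show False using assms(1) by (auto simp: poly_prod)
qed

lemma squarefree_poly_split:
  fixes p :: "'a::alg_closed_field poly"
  assumes "p \<noteq> 0" "\<And>x. \<not> [:-x, 1:] ^ 2 dvd p"
  shows "\<exists>R c. finite R \<and> c \<noteq> 0 \<and> p = smult c (\<Prod>x\<in>R. [:-x, 1:])"
proof -
  define R where "R = {x. poly p x = 0}"
  have fin: "finite R" using poly_roots_finite[OF assms(1)] by (simp add: R_def)
  have "(\<Prod>x\<in>R. [:-x, 1:]) dvd p" by (rule prod_linear_dvd[OF fin]) (simp add: R_def)
  then obtain s where s: "p = (\<Prod>x\<in>R. [:-x, 1:]) * s" by (elim dvdE)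
  have "degree s = 0"
  proof (rule ccontr)
    assume "degree s \<noteq> 0"
    then obtain x where x: "poly s x = 0" using alg_closed_imp_poly_has_root by blast
    then have "poly p x = 0" by (subst s) simp
    then have "x \<in> R" by (simp add: R_def)
    then have "[:-x, 1:] dvd (\<Prod>x\<in>R. [:-x, 1:])" using fin by (metis dvd_prodI)
    moreover have "[:-x, 1:] dvd s" using x by (simp add: poly_eq_0_iff_dvd)
    ultimately have "[:-x, 1:] ^ 2 dvd p" unfolding s power2_eq_square by (rule mult_dvd_mono)
    then show False using assms(2) by blast
  qed
  then obtain c where "s = [:c:]" by (metis degree_eq_zeroE)
  then have "p = smult c (\<Prod>x\<in>R. [:-x, 1:])" "c \<noteq> 0" using s assms(1) by auto
  then show ?thesis using fin by blast
qed

text \<open>A functional that kills the multiples of the product factors through the values at the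
  roots. The weights are its values on the Lagrange polynomials, which have degree at most
  \<open>d\<close> because \<open>card R \<le> d + 1\<close>.\<close>

lemma lagrange_functional:
  fixes a :: "nat \<Rightarrow> 'a::field"
  assumes "finite R" "card R \<le> d + 1" "apolar a d (card R) (\<Prod>x\<in>R. [:-x, 1:])"
  shows "\<exists>c. \<forall>j\<le>d. a j = (\<Sum>x\<in>R. c x * x ^ j)"
proof -
  define P where "P = (\<Prod>x\<in>R. [:-x, 1:])"
  define L where "L x = smult (inverse (\<Prod>y\<in>R-{x}. x - y)) (\<Prod>y\<in>R-{x}. [:-y, 1:])" for x
  have L1: "poly (L x) x = 1" if "x \<in> R" for x
  proof -
    have "(\<Prod>y\<in>R-{x}. x - y) \<noteq> 0" using assms(1) by auto
    then show ?thesis by (simp add: L_def poly_prod)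
  qed
  have L0: "poly (L x) y = 0" if "x \<in> R" "y \<in> R" "x \<noteq> y" for x y
    using that assms(1) by (auto simp: L_def poly_prod)
  have dL: "degree (L x) \<le> d" if "x \<in> R" for x
  proof -
    have "degree (L x) \<le> card (R - {x})"
      unfolding L_def using degree_smult_le degree_prod_linear by metis
    also have "\<dots> \<le> d" using that assms(1,2) by simp
    finally show ?thesis .
  qed
  have "a j = (\<Sum>x\<in>R. ap a d (L x) * x ^ j)" if j: "j \<le> d" for j
  proof -
    define r where "r = monom 1 j - (\<Sum>x\<in>R. smult (x ^ j) (L x))"
    have "poly r y = 0" if "y \<in> R" for y
    proof -
      have "(\<Sum>x\<in>R. x ^ j * poly (L x) y) = (\<Sum>x\<in>R. if x = y then y ^ j else 0)"
        by (intro sum.cong refl) (use that L1 L0 in auto)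
      then show ?thesis using that assms(1) by (simp add: r_def poly_monom poly_sum)
    qed
    then have "P dvd r" unfolding P_def by (rule prod_linear_dvd[OF assms(1)])
    then obtain s where s: "r = P * s" by (elim dvdE)
    have "degree r \<le> d"
      unfolding r_def using j dL assms(1)
      by (intro degree_diff_le degree_sum_le) (auto simp: degree_monom_eq intro: order.trans[OF degree_smult_le])
    have "ap a d r = 0"
    proof (cases "r = 0")
      case False
      then have "degree r = card R + degree s" using s by (simp add: degree_mult_eq P_def degree_prod_linear)
      then show ?thesis using assms(3) \<open>degree r \<le> d\<close> unfolding apolar_def s P_def by (simp add: add.commute)
    qed simp
    then show ?thesis using j by (simp add: r_def ap_diff ap_monom ap_sum ap_smult mult.commute)
  qed
  then show ?thesis by (intro exI[of _ "\<lambda>x. ap a d (L x)"]) auto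
qed

text \<open>With \<open>g x ^ d = c x\<close>, the weighted evaluation at \<open>x\<close> is the
  \<open>d\<close>-th power of a linear form with coefficients \<open>g x\<close> and
  \<open>g x * x\<close>.\<close>

lemma psum_of_roots:
  fixes a :: "nat \<Rightarrow> 'a::alg_closed_field"
  assumes "finite R" "card R \<le> d + 1" "apolar a d (card R) (\<Prod>x\<in>R. [:-x, 1:])" "d > 0"
  shows "psum d (card R) a"
proof -
  obtain c where c: "\<forall>j\<le>d. a j = (\<Sum>x\<in>R. c x * x ^ j)" using lagrange_functional[OF assms(1-3)] by blast
  have "\<exists>y. y ^ d = c x" for x using nth_root_exists[OF assms(4)] by blast
  then obtain g where g: "\<And>x. g x ^ d = c x" by metis
  obtain f where f: "bij_betw f {..<card R} R" using ex_bij_betw_nat_finite[OF assms(1)] by (auto simp: atLeast0LessThan)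
  have "a j = (\<Sum>i<card R. g (f i) ^ (d - j) * (g (f i) * f i) ^ j)" if "j \<le> d" for j
  proof -
    have "a j = (\<Sum>x\<in>R. g x ^ (d - j) * (g x * x) ^ j)"
      unfolding c[rule_format, OF that]
    proof (intro sum.cong refl)
      fix x
      have "g x ^ d = g x ^ (d - j) * g x ^ j" using that by (simp flip: power_add)
      then show "c x * x ^ j = g x ^ (d - j) * (g x * x) ^ j" by (simp add: g power_mult_distrib flip: mult.assoc)
    qed
    also have "\<dots> = (\<Sum>i<card R. g (f i) ^ (d - j) * (g (f i) * f i) ^ j)"
      by (rule sum.reindex_bij_betw[OF f, symmetric])
    finally show ?thesis .
  qed
  then show ?thesis unfolding psum_def by (intro exI[of _ "\<lambda>i. g (f i)"] exI[of _ "\<lambda>i. g (f i) * f i"]) auto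
qed

lemma psum_of_squarefree:
  fixes a :: "nat \<Rightarrow> 'a::alg_closed_field"
  assumes "apolar a d n h" "h \<noteq> 0" "degree h = n" "\<And>x. \<not> [:-x, 1:] ^ 2 dvd h" "n \<le> d + 1" "d > 0"
  shows "psum d n a"
proof -
  obtain R c where R: "finite R" "c \<noteq> 0" "h = smult c (\<Prod>x\<in>R. [:-x, 1:])"
    using squarefree_poly_split[OF assms(2,4)] by blast
  then have "card R = n" using assms(3) by (simp add: degree_prod_linear)
  then show ?thesis using psum_of_roots[OF R(1)] assms apolar_smultD R by metis
qed

text \<open>A simple root at infinity of a form \<open>h\<close> of degree \<open>n\<close> contributes the \<open>d\<close>-th power of \<open>v\<close>.\<close>

lemma psum_of_squarefree_infinity:
  fixes a :: "nat \<Rightarrow> 'a::alg_closed_field"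
  assumes "apolar a d n h" "h \<noteq> 0" "n = Suc (degree h)" "\<And>x. \<not> [:-x, 1:] ^ 2 dvd h" "n \<le> d + 1" "d > 0"
  shows "psum d n a"
proof -
  define m where "m = degree h"
  \<comment> \<open>Regarded in degree \<open>m = n - 1\<close>, \<open>h\<close> must satisfy one
    further equation, the one with \<open>e = d - m\<close>. Changing only the last moment
    \<open>a d\<close> by \<open>c\<close> makes it hold and leaves the others alone.\<close>
  define c where "c = (\<Sum>j\<le>m. coeff h j * a ((d - m) + j)) / coeff h m"
  define a' where "a' j = a j - (if j = d then c else 0)" for j
  have m: "m \<le> d" using assms by (simp add: m_def)
  have cm: "coeff h m \<noteq> 0" using assms(2) by (simp add: m_def)
  have "apolar a' d m h"
    unfolding apolar_iff
  proof (intro conjI allI impI)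
    show "degree h \<le> m" by (simp add: m_def)
    fix e assume e: "e + m \<le> d"
    have "(\<Sum>j\<le>m. coeff h j * a' (e + j)) = (\<Sum>j\<le>m. coeff h j * a (e + j)) - (\<Sum>j\<le>m. if j = d - e then coeff h j * c else 0)"
      unfolding sum_subtractf[symmetric] by (intro sum.cong) (use e in \<open>auto simp: a'_def right_diff_distrib\<close>)
    also have "(\<Sum>j\<le>m. if j = d - e then coeff h j * c else 0) = (if d - e \<le> m then coeff h (d - e) * c else 0)" by simp
    also have "(\<Sum>j\<le>m. coeff h j * a (e + j)) - \<dots> = 0"
    proof (cases "e + m = d")
      case True
      then have "e = d - m" by simp
      then show ?thesis using cm m by (simp add: c_def)
    next
      case False
      then have "e + n \<le> d" using e assms(3) by (simp add: m_def)
      then have "(\<Sum>j\<le>n. coeff h j * a (e + j)) = 0" using assms(1) by (simp add: apolar_iff)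
      then have "(\<Sum>j\<le>m. coeff h j * a (e + j)) = 0" using assms(3) by (simp add: m_def coeff_eq_0)
      then show ?thesis using False e by simp
    qed
    finally show "(\<Sum>j\<le>m. coeff h j * a' (e + j)) = 0" .
  qed
  from psum_of_squarefree[OF this assms(2)] have "psum d m a'" using assms m by (simp add: m_def)
  moreover obtain y where y: "y ^ d = c" using nth_root_exists[OF assms(6)] by blast
  ultimately have "psum d (Suc m) (\<lambda>j. a' j + 0 ^ (d - j) * y ^ j)" by (intro psum_Suc)
  moreover have "a' j + 0 ^ (d - j) * y ^ j = a j" if "j \<le> d" for j
    using that y by (auto simp: a'_def power_0_left)
  ultimately have "psum d (Suc m) a" 
    using psum_cong[of d "\<lambda>j. a' j + 0 ^ (d - j) * y ^ j" a "Suc m"] by blast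
  then show ?thesis using assms(3) by (simp add: m_def)
qed

section \<open>Bounds for the rank in terms of the smallest annihilator\<close>

lemma double_root_deriv:
  assumes "[:-x, 1::'a::field:] ^ 2 dvd r"
  shows "poly r x = 0" "poly (pderiv r) x = 0"
proof -
  obtain k where k: "r = [:-x, 1:] * ([:-x, 1:] * k)" using assms by (auto simp only: power2_eq_square mult.assoc elim!: dvdE)
  show "poly r x = 0" unfolding k poly_mult by simp
  show "poly (pderiv r) x = 0" unfolding k pderiv_mult poly_add poly_mult by simp
qed

lemma dvd_pderiv_const:
  fixes p :: "'a::field_char_0 poly"
  assumes "p dvd pderiv p"
  shows "degree p = 0"
proof (rule ccontr)
  assume "degree p \<noteq> 0"
  then have "pderiv p \<noteq> 0" by (simp add: pderiv_eq_0_iff)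
  then have "degree p \<le> degree (pderiv p)" using assms by (rule dvd_imp_degree_le[rotated])
  then show False using \<open>degree p \<noteq> 0\<close> by (simp add: degree_pderiv)
qed

text \<open>A double root of a member of the pencil is a zero of the Wronskian of \<open>p\<close> and \<open>H\<close>, and it determines \<open>s\<close>.\<close>

lemma squarefree_pencil:
  fixes p H :: "'a::{alg_closed_field, field_char_0} poly"
  assumes "\<And>x. poly p x = 0 \<Longrightarrow> poly H x \<noteq> 0" "degree p \<le> N" "degree H \<le> N"
    "degree p = N \<or> degree H = N" "N \<ge> 1"
  shows "\<exists>s. degree (p + smult s H) = N \<and> (\<forall>x. \<not> [:-x, 1:] ^ 2 dvd p + smult s H)"
proof -
  have noroot: "degree q = 0" if "\<And>x. poly q x \<noteq> 0" for q :: "'a poly" 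
    using that alg_closed_imp_poly_has_root[of q] by blast
  have p0: "p \<noteq> 0" using noroot[of H] assms by fastforce
  have H0: "H \<noteq> 0" using noroot[of p] assms by fastforce
  obtain A B where bez: "A * p + B * H = 1" using poly_bezout_no_common_root[OF assms(1) p0] by blast
  define W where "W = p * pderiv H - pderiv p * H"
  have "W \<noteq> 0"
  proof
    assume "W = 0"
    then have eq: "p * pderiv H = pderiv p * H" by (simp add: W_def)
    then have "p dvd pderiv p * H" by (metis dvd_triv_left)
    then have "p dvd pderiv p" by (rule poly_bezout_dvd[OF bez])
    moreover have "H dvd pderiv H * p" using eq[symmetric] by (metis dvd_triv_right mult.commute)
    have "B * H + A * p = 1" using bez by (simp only: add.commute)
    from poly_bezout_dvd[OF this \<open>H dvd pderiv H * p\<close>] have "H dvd pderiv H" .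
    ultimately show False using dvd_pderiv_const assms(4,5) by fastforce
  qed
  \<comment> \<open>Finitely many values: those that can produce a double root, and the one that
    lowers the degree below \<open>N\<close>, that is, creates a root at infinity.\<close>
  let ?bad = "(\<lambda>x. - poly p x / poly H x) ` {x. poly W x = 0} \<union> {- coeff p N / coeff H N}"
  have "finite ?bad" using poly_roots_finite[OF \<open>W \<noteq> 0\<close>] by auto
  then obtain s where s: "s \<notin> ?bad" using ex_new_if_finite[OF infinite_UNIV_char_0] by blast
  let ?r = "p + smult s H"
  have "coeff ?r N \<noteq> 0"
  proof
    assume r: "coeff ?r N = 0"
    show False
    proof (cases "coeff H N = 0")
      case True
      then have "degree H \<noteq> N" using H0 by auto
      then have "coeff p N \<noteq> 0" using assms(4) p0 by auto
      then show False using r True by simp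
    next
      case False
      then have "s = - coeff p N / coeff H N" using r by (simp add: field_simps eq_neg_iff_add_eq_0)
      then show False using s by simp
    qed
  qed
  then have "degree ?r = N" using assms(2,3)
    by (intro antisym le_degree degree_add_le) (auto intro: order.trans[OF degree_smult_le])
  moreover have "\<not> [:-x, 1:] ^ 2 dvd ?r" for x
  proof
    assume "[:-x, 1:] ^ 2 dvd ?r"
    from double_root_deriv[OF this] have 1: "poly p x = - s * poly H x" "poly (pderiv p) x = - s * poly (pderiv H) x"
      by (auto simp: pderiv_add pderiv_smult eq_neg_iff_add_eq_0)
    then have W: "poly W x = 0" by (simp add: W_def)
    show False
    proof (cases "poly H x = 0")
      case True
      then show False using 1 assms(1) by auto
    next
      case False
      then have "s = - poly p x / poly H x" using 1(1) by simp
      then show False using s W by blast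
    qed
  qed
  ultimately show ?thesis by blast
qed

text \<open>The monomials with exponent in \<open>J\<close> span a complement of the multiples of \<open>h\<close> of degree \<open>N\<close>; their
  number exceeds the number of conditions by one.\<close>

lemma apolar_complement:
  fixes a :: "nat \<Rightarrow> 'a::field"
  assumes "h \<noteq> 0" "degree h \<le> n" "n \<ge> 1" "2 * n \<le> d + 2"
  defines "N \<equiv> d + 2 - n"
  shows "\<exists>p. p \<noteq> 0 \<and> apolar a d N p \<and> \<not> (h dvd p \<and> n - degree h \<le> N - degree p)"
proof -
  \<comment> \<open>Multiples of the form \<open>h\<close> occupy the degrees from
    \<open>degree h\<close> to \<open>N - n + degree h\<close>. The lower range holds remainders
    modulo the finite roots, the upper range those modulo the root at infinity.\<close>
  let ?J = "{..<degree h} \<union> {N + 1 - (n - degree h)..N}"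
  have N: "n \<le> N" "N + n = d + 2" using assms by auto
  have "card ?J = n"
    using assms(2) N by (subst card_Un_disjoint) auto
  then have "card {..<n - 1} < card ?J" using assms(3) by simp
  from homogeneous_system_nontrivial[OF _ _ this, of "\<lambda>e j. a (e + j)"] obtain x where
    x: "\<exists>j\<in>?J. x j \<noteq> 0" "\<forall>e\<in>{..<n - 1}. (\<Sum>j\<in>?J. a (e + j) * x j) = 0" by auto
  define p where "p = (\<Sum>j\<in>?J. monom (x j) j)"
  have cp: "coeff p j = (if j \<in> ?J then x j else 0)" for j
    unfolding p_def coeff_sum coeff_monom by (subst sum.delta) auto
  have dp: "degree p \<le> N" using assms(2) N by (intro degree_le) (auto simp: cp)
  have "p \<noteq> 0" using x(1) cp by (metis coeff_0)
  moreover have "apolar a d N p" unfolding apolar_iff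
  proof (intro conjI allI impI)
    fix e assume "e + N \<le> d"
    then have e: "e \<in> {..<n-1}" using N by auto
    have "(\<Sum>j\<le>N. coeff p j * a (e + j)) = (\<Sum>j\<in>?J. a (e + j) * x j)"
      using assms(2) N by (intro sum.mono_neutral_cong_right) (auto simp: cp)
    then show "(\<Sum>j\<le>N. coeff p j * a (e + j)) = 0" using x(2) e by simp
  qed (rule dp)
  moreover have False if "h dvd p" "n - degree h \<le> N - degree p"
  proof -
    have "degree h \<le> degree p" using that(1) \<open>p \<noteq> 0\<close> by (rule dvd_imp_degree_le)
    moreover have "degree p \<in> ?J" using \<open>p \<noteq> 0\<close> cp[of "degree p"] by (metis leading_coeff_0_iff)
    ultimately show False using that(2) dp assms(2) N by auto
  qed
  ultimately show ?thesis by blast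
qed

text \<open>Minimality of \<open>n\<close> makes \<open>h\<close> coprime to a second annihilator
  \<open>p\<close> of degree \<open>d + 2 - n\<close>. Both are brought to that degree, and a
  squarefree member of the pencil yields the sum of powers.\<close>

lemma psum_complementary:
  fixes a :: "nat \<Rightarrow> 'a::{alg_closed_field, field_char_0}"
  assumes "no_apolar a d (n - 1)" "apolar a d n h" "h \<noteq> 0" "n \<ge> 1" "2 * n \<le> d + 2" "d > 0"
  shows "psum d (d + 2 - n) a"
proof -
  define N where "N = d + 2 - n"
  have N: "n \<le> N" "N + n = d + 2" using assms by (auto simp: N_def)
  have dh: "degree h \<le> n" using assms(2) by (simp add: apolar_def)
  obtain p where p: "p \<noteq> 0" "apolar a d N p" "\<not> (h dvd p \<and> n - degree h \<le> N - degree p)"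
    using apolar_complement[OF assms(3) dh assms(4,5)] unfolding N_def by blast
  have dp: "degree p \<le> N" using p(2) by (simp add: apolar_def)
  obtain g A B where g: "g dvd p" "g dvd h" "g = A * p + B * h" using poly_bezout by blast
  have "g \<noteq> 0" using g(1) p(1) by auto
  \<comment> \<open>The degree of the common divisor as a form, infinity included. A positive value
    below \<open>n\<close> contradicts \<open>no_apolar\<close>; the value \<open>n\<close> would
    make \<open>p\<close> a multiple of \<open>h\<close>.\<close>
  define e where "e = degree g + min (N - degree p) (n - degree h)"
  have "e = 0"
  proof (rule ccontr)
    assume "e \<noteq> 0"
    then have "apolar a d e g" unfolding e_def
      by (intro apolar_common_divisor[OF p(2,1) assms(2,3) g]) (use N in auto)
    have dg: "degree g \<le> degree h" using g(2) assms(3) by (rule dvd_imp_degree_le)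
    show False
    proof (cases "e \<le> n - 1")
      case True
      then show False using \<open>apolar a d e g\<close> assms(1) \<open>g \<noteq> 0\<close> apolar_mono unfolding no_apolar_def by blast
    next
      case False
      then have "degree g = degree h" "n - degree h \<le> N - degree p" using dg dh assms(4) by (auto simp: e_def)
      moreover have "h dvd g"
      proof -
        obtain c where c: "h = g * c" using g(2) by (elim dvdE)
        with assms(3) have "degree c = 0" using \<open>degree g = degree h\<close> by (auto simp: degree_mult_eq)
        then obtain k where "c = [:k:]" by (metis degree_eq_zeroE)
        with c assms(3) have "g = h * [:inverse k:]" by auto
        then show ?thesis by (metis dvd_triv_left)
      qed
      ultimately show False using p(3) g(1) dvd_trans by blast
    qed
  qed
  then have e0: "degree g = 0" "degree p = N \<or> degree h = n" using dp dh by (auto simp: e_def min_def split: if_splits)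
  obtain z where z: "poly p z \<noteq> 0"
  proof -
    have "finite {z. poly p z = 0}" using p(1) by (rule poly_roots_finite)
    then show ?thesis using ex_new_if_finite[OF infinite_UNIV_char_0] that by blast
  qed
  \<comment> \<open>Lifts \<open>h\<close> to degree \<open>N\<close> without a new common root:
    \<open>z\<close> is not a root of \<open>p\<close>, and being finite it leaves the multiplicity
    at infinity of \<open>h\<close> unchanged.\<close>
  define q where "q = [:-z, 1:] ^ (N - n)"
  have dq: "degree q = N - n" by (simp add: q_def degree_power_eq)
  define H where "H = h * q"
  have dH: "degree H = degree h + (N - n)" using assms(3) dq by (simp add: H_def degree_mult_eq q_def)
  have "poly H x \<noteq> 0" if x: "poly p x = 0" for x
  proof
    assume "poly H x = 0"
    moreover have "poly q x \<noteq> 0" using z x by (auto simp: q_def poly_power)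
    ultimately have "poly h x = 0" by (simp add: H_def)
    then have "poly g x = 0" using x by (simp add: g(3))
    then show False using e0(1) \<open>g \<noteq> 0\<close> by (metis degree_eq_zeroE mult_zero_right pCons_0_0 poly_pCons add.right_neutral poly_0)
  qed
  then have "\<exists>s. degree (p + smult s H) = N \<and> (\<forall>x. \<not> [:-x, 1:] ^ 2 dvd p + smult s H)"
    using dH dh dp N e0(2) assms(4) by (intro squarefree_pencil) auto
  then obtain s where s: "degree (p + smult s H) = N" "\<And>x. \<not> [:-x, 1:] ^ 2 dvd p + smult s H" by blast
  have "apolar a d (n + (N - n)) H" unfolding H_def by (rule apolar_mult[OF assms(2)]) (simp add: dq)
  then have "apolar a d N (p + smult s H)" using N p(2) by (intro apolar_add apolar_smult) auto
  moreover have "p + smult s H \<noteq> 0" using s(1) N assms(4) by auto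
  ultimately show ?thesis
    unfolding N_def[symmetric] using s N assms(4,6) by (intro psum_of_squarefree) auto
qed

text \<open>The \<open>r\<close> powers are annihilated by a squarefree product \<open>p\<close>. If
  \<open>r + n \<le> d + 1\<close>, the common divisor of \<open>p\<close> and \<open>h\<close>
  annihilates too; it is a proper divisor of \<open>h\<close>, which has a square factor, and so
  contradicts the minimality of \<open>n\<close>. Since \<open>degree h = n\<close>, infinity
  contributes nothing to it.\<close>

lemma psum_lower_bound:
  fixes a :: "nat \<Rightarrow> 'a::field"
  assumes "no_apolar a d (n - 1)" "apolar a d n h" "degree h = n" "n \<ge> 1" "[:-x, 1:] ^ 2 dvd h" "psum d r a"
  shows "d + 2 \<le> r + n"
proof (rule ccontr)
  assume "\<not> ?thesis"
  then have rn: "r + n \<le> d + 1" by simp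
  obtain \<alpha> \<beta> where ab: "\<forall>j\<le>d. a j = (\<Sum>i<r. \<alpha> i ^ (d - j) * \<beta> i ^ j)" using assms(6) unfolding psum_def by blast
  define I where "I = {i. i < r \<and> \<alpha> i \<noteq> 0}"
  define R where "R = (\<lambda>i. \<beta> i / \<alpha> i) ` I"
  have fin: "finite I" "finite R" by (auto simp: I_def R_def)
  have cI: "card R \<le> card I" using fin by (simp add: R_def card_image_le)
  have "card I \<le> card {..<r}" by (rule card_mono) (auto simp: I_def)
  then have cr: "card R \<le> r" using cI by simp
  \<comment> \<open>A power of \<open>v\<close> belongs to the root at infinity. It is missing from
    \<open>R\<close>, so \<open>p\<close> has degree below \<open>r\<close>, and
    \<open>p * q\<close> has no coefficient at index \<open>d\<close>, the only one such a power
    sees.\<close>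
  have cr': "card R < r" if "i < r" "\<alpha> i = 0" for i
  proof -
    have "card I < card {..<r}" by (rule psubset_card_mono) (use that in \<open>auto simp: I_def\<close>)
    then show ?thesis using cI by simp
  qed
  define p where "p = (\<Prod>x\<in>R. [:-x, 1:])"
  have dp: "degree p = card R" by (simp add: p_def degree_prod_linear)
  have p0: "p \<noteq> 0" by (simp add: p_def prod_linear_nonzero)
  have "apolar a d r p" unfolding apolar_def
  proof (intro conjI allI impI)
    fix q :: "'a poly" assume q: "degree q + r \<le> d"
    have "ap a d (p * q) = (\<Sum>i<r. \<Sum>j\<le>d. coeff (p * q) j * (\<alpha> i ^ (d - j) * \<beta> i ^ j))"
      unfolding ap_def by (subst sum.swap) (use ab in \<open>simp add: sum_distrib_left\<close>)
    also have "\<dots> = 0"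
    proof (rule sum.neutral, rule ballI)
      fix i assume i: "i \<in> {..<r}"
      have dpq: "degree (p * q) \<le> card R + degree q" using degree_mult_le[of p q] dp by simp
      show "(\<Sum>j\<le>d. coeff (p * q) j * (\<alpha> i ^ (d - j) * \<beta> i ^ j)) = 0"
      proof (cases "\<alpha> i = 0")
        case True
        then have "degree (p * q) < d" using cr'[of i] i q dpq by simp
        have "(\<Sum>j\<le>d. coeff (p * q) j * (\<alpha> i ^ (d - j) * \<beta> i ^ j)) = 0"
        proof (intro sum.neutral ballI)
          fix j assume "j \<in> {..d}"
          then show "coeff (p * q) j * (\<alpha> i ^ (d - j) * \<beta> i ^ j) = 0"
            using True \<open>degree (p * q) < d\<close> by (cases "j = d") (auto simp: coeff_eq_0)
        qed
        then show ?thesis .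
      next
        case False
        have "(\<Sum>j\<le>d. coeff (p * q) j * (\<alpha> i ^ (d - j) * \<beta> i ^ j)) = 
          (\<Sum>j\<le>d. \<alpha> i ^ d * (coeff (p * q) j * (\<beta> i / \<alpha> i) ^ j))"
          by (intro sum.cong refl) (use False in \<open>simp add: power_diff power_divide\<close>)
        also have "\<dots> = \<alpha> i ^ d * poly (p * q) (\<beta> i / \<alpha> i)"
          using dpq q cr by (subst poly_eq_sum_le[of _ d]) (auto simp: sum_distrib_left)
        also have "\<dots> = 0"
        proof -
          have "poly p (\<beta> i / \<alpha> i) = 0" 
            using i False fin by (auto simp: p_def poly_prod R_def I_def)
          then show ?thesis by simp
        qed
        finally show ?thesis .
      qed
    qed
    finally show "ap a d (p * q) = 0" .
  qed (use dp cr in simp)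
  moreover obtain g A B where g: "g dvd p" "g dvd h" "g = A * p + B * h" using poly_bezout by blast
  moreover have h0: "h \<noteq> 0" using assms(3,4) by auto
  ultimately have "apolar a d (degree g + min (r - degree p) (n - degree h)) g"
    using apolar_common_divisor[OF _ p0 assms(2) h0 g, of r] rn by simp
  then have ag: "apolar a d (degree g) g" using assms(3) by simp
  have "g \<noteq> 0" using g(1) p0 by auto
  have "degree g \<le> n" using dvd_imp_degree_le[OF g(2) h0] assms(3) by simp
  moreover have "degree g \<noteq> n"
  proof
    assume dg: "degree g = n"
    obtain c where c: "h = g * c" using g(2) by (elim dvdE)
    with h0 have "degree c = 0" using assms(3) dg by (auto simp: degree_mult_eq)
    then obtain k where "c = [:k:]" by (metis degree_eq_zeroE)
    with c h0 have "g = h * [:inverse k:]" by auto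
    then have "h dvd p" using g(1) by (metis dvd_mult_left)
    then have "[:-x, 1:] ^ 2 dvd p" using assms(5) dvd_trans by blast
    then show False using prod_linear_squarefree[OF fin(2)] unfolding p_def by blast
  qed
  ultimately have "degree g \<le> n - 1" by simp
  then show False using ag assms(1) \<open>g \<noteq> 0\<close> apolar_mono unfolding no_apolar_def by blast
qed

text \<open>Let \<open>n\<close> be the least degree of an annihilator. The complementary bound
  \<open>d + 2 - n\<close> on the rank forces \<open>n \<le> k + 2\<close>. If the annihilator were
  squarefree, infinity included, the rank would be at most
  \<open>n \<le> d div 2 + 1 < d - k\<close>.\<close>

lemma exact_rank_imp_double_root:
  fixes a :: "nat \<Rightarrow> 'a::{alg_closed_field, field_char_0}"
  assumes "psum d (d - k) a" "\<And>s. s < d - k \<Longrightarrow> \<not> psum d s a" "d - k \<ge> d div 2 + 2" "d > 0"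
  shows "\<exists>l m. l \<noteq> 0 \<and> m \<noteq> 0 \<and> degree l \<le> 1 \<and> degree m \<le> k \<and> apolar a d (k + 2) (l ^ 2 * m)"
proof -
  let ?P = "\<lambda>n. \<exists>h. h \<noteq> 0 \<and> apolar a d n h"
  \<comment> \<open>In this degree the annihilator has more coefficients than there are equations:
    \<open>?n + 1\<close> against \<open>d - ?n + 1\<close>.\<close>
  let ?n = "d div 2 + 1"
  have "?P ?n"
  proof -
    have "card {..d - ?n} < card {..?n}" by simp
    from homogeneous_system_nontrivial[OF _ _ this, of "\<lambda>e j. a (e + j)"] obtain x where
      x: "\<exists>j\<in>{..?n}. x j \<noteq> 0" "\<forall>e\<in>{..d - ?n}. (\<Sum>j\<le>?n. a (e + j) * x j) = 0" by auto
    define h where "h = (\<Sum>j\<le>?n. monom (x j) j)"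
    have ch: "coeff h j = (if j \<le> ?n then x j else 0)" for j
      unfolding h_def coeff_sum coeff_monom by (subst sum.delta) auto
    have "h \<noteq> 0" using x(1) ch by (metis atMost_iff coeff_0)
    moreover have "apolar a d ?n h" unfolding apolar_iff
      using x(2) by (auto simp: ch mult.commute intro!: degree_le)
    ultimately show ?thesis by blast
  qed
  define n where "n = (LEAST n. ?P n)"
  obtain h where h: "h \<noteq> 0" "apolar a d n h" unfolding n_def using LeastI[of ?P, OF \<open>?P ?n\<close>] by blast
  have n_le: "n \<le> ?n" unfolding n_def by (rule Least_le[of ?P, OF \<open>?P ?n\<close>])
  have min: "\<not> ?P m" if "m < n" for m using that not_less_Least unfolding n_def by blast
  have dh: "degree h \<le> n" using h(2) by (simp add: apolar_def)
  have n1: "n \<ge> 1"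
  proof (rule ccontr)
    assume "\<not> n \<ge> 1"
    then have "n = 0" by simp
    then obtain c where c: "h = [:c:]" using dh by (metis degree_eq_zeroE le_zero_eq)
    have "a j = 0" if "j \<le> d" for j
      using h that by (auto simp: apolar_iff \<open>n = 0\<close> c)
    then have "psum d 0 a" unfolding psum_def by simp
    then show False using assms(2)[of 0] assms(3) by simp
  qed
  have na: "no_apolar a d (n - 1)" using min[of "n - 1"] n1 unfolding no_apolar_def by auto
  have "psum d (d + 2 - n) a"
    by (rule psum_complementary[OF na h(2,1) n1 _ assms(4)]) (use n_le in simp)
  then have "\<not> d + 2 - n < d - k" using assms(2) by blast
  then have nk: "n \<le> k + 2" using n_le by simp
  have "\<exists>l m. l \<noteq> 0 \<and> degree l \<le> 1 \<and> h = l ^ 2 * m \<and> degree m + 2 \<le> n"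
  proof (cases "\<exists>x. [:-x, 1:] ^ 2 dvd h")
    case True
    then obtain x m where m: "h = [:-x, 1:] ^ 2 * m" by (auto elim!: dvdE)
    have "m \<noteq> 0" using m h(1) by auto
    then have "degree h = 2 + degree m" unfolding m by (subst degree_mult_eq) (auto simp: degree_power_eq)
    then show ?thesis using m dh by (intro exI[of _ "[:-x, 1:]"] exI[of _ m]) auto
  next
    case False
    have "n \<noteq> degree h"
    proof
      assume "n = degree h"
      then have "psum d n a" using psum_of_squarefree[OF h(2,1)] False n_le assms(3,4) by auto
      then show False using assms(2)[of n] n_le assms(3) by simp
    qed
    moreover have "n \<noteq> Suc (degree h)"
    proof
      assume "n = Suc (degree h)"
      then have "psum d n a" using psum_of_squarefree_infinity[OF h(2,1)] False n_le assms(3,4) by auto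
      then show False using assms(2)[of n] n_le assms(3) by simp
    qed
    \<comment> \<open>The remaining case is a multiple root at infinity,
      \<open>degree h + 2 \<le> n\<close>; its linear form \<open>u\<close> dehomogenizes to
      1.\<close>
    ultimately show ?thesis using dh by (intro exI[of _ 1] exI[of _ h]) auto
  qed
  then obtain l m where lm: "l \<noteq> 0" "degree l \<le> 1" "h = l ^ 2 * m" "degree m + 2 \<le> n" by blast
  moreover have "m \<noteq> 0" using lm h by auto
  moreover have "apolar a d (k + 2) (l ^ 2 * m)" using h(2) nk apolar_mono lm(3) by blast
  ultimately show ?thesis using nk by (intro exI[of _ l] exI[of _ m]) auto
qed

text \<open>The Hankel matrix is that of the equations for annihilators of degree
  \<open>n - 1\<close>. The bound \<open>2 * (n - 1) \<le> d\<close> makes all its rows genuine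
  equations.\<close>

lemma hankel_imp_no_apolar:
  fixes a :: "nat \<Rightarrow> 'a::field"
  assumes "dt n (\<lambda>i j. a (i + j)) \<noteq> 0" "2 * (n - 1) \<le> d" "n \<ge> 1"
  shows "no_apolar a d (n - 1)"
  unfolding no_apolar_def
proof (intro allI impI)
  fix h assume h: "apolar a d (n - 1) h"
  have "{..n-1} = {..<n}" using assms(3) by auto
  then have "\<forall>i<n. (\<Sum>j<n. a (i + j) * coeff h j) = 0"
    using h assms(2,3) unfolding apolar_iff by (auto simp: mult.commute)
  then have "\<forall>j<n. coeff h j = 0" using assms(1) unfolding dt_eq_0_iff by blast
  moreover have "coeff h j = 0" if "\<not> j < n" for j using h that assms(3) by (intro coeff_eq_0) (auto simp: apolar_def)
  ultimately show "h = 0" by (metis coeff_0 poly_eqI)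
qed

lemma mod_sum_poly: "(\<Sum>i\<in>A. f i) mod (h::'a::field poly) = (\<Sum>i\<in>A. f i mod h)"
  by (induction A rule: infinite_finite_induct) (auto simp: poly_mod_add_left)

text \<open>The sequence reads off the top coefficient of residues modulo \<open>h\<close>.\<close>

lemma hankel_exists:
  fixes h :: "'a::field poly"
  assumes "degree h = n" "n \<ge> 1"
  shows "\<exists>a. apolar a d n h \<and> dt n (\<lambda>i j. a (i + j)) \<noteq> 0"
proof -
  define a where "a j = coeff (monom 1 j mod h) (n - 1)" for j
  have a: "(\<Sum>j\<le>N. coeff q j * a j) = coeff (q mod h) (n - 1)" if "degree q \<le> N" for q N
  proof -
    have "q = (\<Sum>j\<le>N. smult (coeff q j) (monom 1 j))"
      using poly_as_sum_of_monoms'[OF that] by (simp add: smult_monom)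
    then have "q mod h = (\<Sum>j\<le>N. smult (coeff q j) (monom 1 j mod h))"
      by (metis (no_types, lifting) mod_sum_poly mod_smult_left sum.cong)
    then show ?thesis by (simp add: coeff_sum a_def)
  qed
  have "apolar a d n h" unfolding apolar_def
  proof (intro conjI allI impI)
    fix q :: "'a poly" assume "degree q + n \<le> d"
    then have "degree (h * q) \<le> d" using degree_mult_le[of h q] assms(1) by simp
    from a[OF this] show "ap a d (h * q) = 0" by (simp add: ap_def)
  qed (use assms in simp)
  moreover have "dt n (\<lambda>i j. a (i + j)) \<noteq> 0"
  proof
    assume "dt n (\<lambda>i j. a (i + j)) = 0"
    then obtain v where v: "\<exists>j<n. v j \<noteq> 0" "\<forall>i<n. (\<Sum>j<n. a (i + j) * v j) = 0" unfolding dt_eq_0_iff by blast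
    define p where "p = (\<Sum>j<n. monom (v j) j)"
    have cp: "coeff p j = (if j < n then v j else 0)" for j
      unfolding p_def coeff_sum coeff_monom by (subst sum.delta) auto
    have "p \<noteq> 0" using v(1) cp by (metis coeff_0)
    have dp: "degree p \<le> n - 1" by (rule degree_le) (auto simp: cp)
    \<comment> \<open>Shifting \<open>p\<close> to degree exactly \<open>n - 1\<close> leaves it
      reduced modulo \<open>h\<close> with nonzero top coefficient, so row \<open>i\<close> of the
      matrix does not kill it.\<close>
    define i where "i = n - 1 - degree p"
    have i: "i < n" using assms(2) by (simp add: i_def)
    let ?q = "p * monom 1 i"
    have dq: "degree ?q = n - 1" using \<open>p \<noteq> 0\<close> dp by (simp add: degree_mult_eq degree_monom_eq i_def)
    have "?q \<noteq> 0" using \<open>p \<noteq> 0\<close> by simp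
    then have "coeff ?q (n - 1) \<noteq> 0" using dq by (metis leading_coeff_0_iff)
    moreover have "?q mod h = ?q" using dq assms by (intro mod_poly_less) simp
    moreover have "(\<Sum>j\<le>i + (n-1). coeff ?q j * a j) = (\<Sum>j\<le>n - 1. coeff p j * a (i + j))"
      using ap_mult_monom[OF dp, of i "i + (n - 1)" a] by (simp add: ap_def)
    moreover have "(\<Sum>j\<le>n - 1. coeff p j * a (i + j)) = (\<Sum>j<n. a (i + j) * v j)"
    proof -
      have "{..n-1} = {..<n}" using assms(2) by auto
      then show ?thesis by (simp add: cp mult.commute)
    qed
    moreover have "degree ?q \<le> i + (n - 1)" using dq by simp
    ultimately show False using a[of ?q "i + (n-1)"] v(2) i by metis
  qed
  ultimately show ?thesis by blast
qed

section \<open>Products of linear forms\<close>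

definition lprod :: "nat \<Rightarrow> (nat \<Rightarrow> nat) \<Rightarrow> (nat \<Rightarrow> 'a) \<Rightarrow> 'a::field poly" where
  "lprod M e x = (\<Prod>i<M. [:x (2*i), x (2*i+1):] ^ e i)"

lemma degree_linear_le: "degree [:a, b:] \<le> 1"
  by simp

lemma degree_lprod: "degree (lprod M e x) \<le> (\<Sum>i<M. e i)"
proof -
  have "degree (lprod M e x) \<le> (\<Sum>i<M. degree ([:x (2*i), x (2*i+1):] ^ e i))"
    unfolding lprod_def using degree_prod_sum_le[of "{..<M}" "\<lambda>i. [:x (2*i), x (2*i+1):] ^ e i"] by (simp add: comp_def)
  also have "\<dots> \<le> (\<Sum>i<M. e i)"
  proof (rule sum_mono)
    fix i
    have "degree ([:x (2*i), x (2*i+1):] ^ e i) \<le> degree [:x (2*i), x (2*i+1):] * e i" by (rule degree_power_le)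
    also have "\<dots> \<le> 1 * e i" by (intro mult_right_mono degree_linear_le) auto
    finally show "degree ([:x (2*i), x (2*i+1):] ^ e i) \<le> e i" by simp
  qed
  finally show ?thesis .
qed

lemma nonzero_pairs_linear: "nonzero_pairs M x \<Longrightarrow> i < M \<Longrightarrow> [:x (2*i), x (2*i+1):] \<noteq> 0"
  by (auto simp: nonzero_pairs_def)

lemma lprod_nonzero: "nonzero_pairs M x \<Longrightarrow> lprod M e x \<noteq> 0"
  unfolding lprod_def using nonzero_pairs_linear by (auto simp: nonzero_pairs_def)

lemma polyfun_lprod:
  assumes "\<And>i. i < 2 * M \<Longrightarrow> polyfun C (\<lambda>t. x t i)"
  shows "polyfun C (\<lambda>t. coeff (lprod M e (x t)) j)"
  unfolding lprod_def by (intro polyfun_coeff_prod polyfun_coeff_power polyfun_coeff_linear assms) auto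

lemma lprod_cong: "(\<And>i. i < 2 * M \<Longrightarrow> x i = y i) \<Longrightarrow> lprod M e x = lprod M e y"
  unfolding lprod_def by (intro prod.cong refl) auto

lemma lprod_mergep: "lprod M e (mergep M x z) = lprod M e x"
  by (rule lprod_cong) (simp add: mergep_def)

lemma lprod_scale:
  assumes "i < M"
  shows "lprod M e (x(2*i := c * x (2*i), 2*i+1 := c * x (2*i+1))) = smult (c ^ e i) (lprod M e x)"
proof -
  let ?y = "x(2*i := c * x (2*i), 2*i+1 := c * x (2*i+1))"
  have "lprod M e ?y = [:?y (2*i), ?y (2*i+1):] ^ e i * (\<Prod>j\<in>{..<M}-{i}. [:?y (2*j), ?y (2*j+1):] ^ e j)"
    unfolding lprod_def by (rule prod.remove) (use assms in auto)
  also have "(\<Prod>j\<in>{..<M}-{i}. [:?y (2*j), ?y (2*j+1):] ^ e j) = (\<Prod>j\<in>{..<M}-{i}. [:x (2*j), x (2*j+1):] ^ e j)"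
  proof (intro prod.cong refl)
    fix j assume "j \<in> {..<M} - {i}"
    then have "2*j \<noteq> 2*i" "2*j \<noteq> 2*i+1" "2*j+1 \<noteq> 2*i" "2*j+1 \<noteq> 2*i+1" by auto
    then show "[:?y (2*j), ?y (2*j+1):] ^ e j = [:x (2*j), x (2*j+1):] ^ e j" by simp
  qed
  also have "[:?y (2*i), ?y (2*i+1):] = smult c [:x (2*i), x (2*i+1):]" by simp
  also have "\<dots> ^ e i = smult (c ^ e i) ([:x (2*i), x (2*i+1):] ^ e i)" by (simp only: smult_power)
  also have "smult (c ^ e i) ([:x (2*i), x (2*i+1):] ^ e i) * (\<Prod>j\<in>{..<M}-{i}. [:x (2*j), x (2*j+1):] ^ e j)
    = smult (c ^ e i) (lprod M e x)"
    unfolding lprod_def using assms by (subst (2) prod.remove[of _ i]) auto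
  finally show ?thesis .
qed

definition locus :: "nat \<Rightarrow> (nat \<Rightarrow> nat) \<Rightarrow> 'a::field poly poly set set" where
  "locus M e = {proj_class (hmg (\<Sum>i<M. e i) (lprod M e x)) | x. nonzero_pairs M x}"

lemma multiple_root_locus_eq: "multiple_root_locus p = locus (length p) ((!) p)"
proof -
  let ?M = "length p" and ?d = "\<Sum>i<length p. p ! i"
  have form: "(\<Prod>i<?M. l i ^ (p ! i)) = hmg ?d (lprod ?M ((!) p) x)"
    if "\<And>i. i < ?M \<Longrightarrow> l i \<in> binary_forms 1" "\<And>i. i < ?M \<Longrightarrow> deh (l i) = [:x (2*i), x (2*i+1):]" 
    for l :: "nat \<Rightarrow> 'a poly poly" and x
  proof (rule deh_eqI)
    have "l i ^ (p ! i) \<in> binary_forms (p ! i)" if "i < ?M" for i 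
      using binary_forms_power[of "l i" 1 "p ! i"] that \<open>\<And>i. i < ?M \<Longrightarrow> l i \<in> binary_forms 1\<close> by simp
    then show "(\<Prod>i<?M. l i ^ (p ! i)) \<in> binary_forms ?d" by (intro binary_forms_prod) auto
    show "deh (\<Prod>i<?M. l i ^ (p ! i)) = deh (hmg ?d (lprod ?M ((!) p) x))"
      unfolding deh_hmg[OF degree_lprod] unfolding lprod_def deh_prod deh_power
      by (intro prod.cong refl) (use that(2) in auto)
  qed simp
  show ?thesis
  proof (intro equalityI subsetI)
    fix c assume "c \<in> (multiple_root_locus p :: 'a poly poly set set)"
    then obtain l :: "nat \<Rightarrow> 'a poly poly" where l: "\<forall>i<?M. l i \<in> binary_forms 1 - {0}" "c = proj_class (\<Prod>i<?M. l i ^ (p ! i))"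
      unfolding multiple_root_locus_def by blast
    define x where "x k = coeff (deh (l (k div 2))) (k mod 2)" for k
    have dl: "deh (l i) = [:x (2*i), x (2*i+1):]" if "i < ?M" for i
    proof (rule poly_eqI)
      fix j
      have "degree (deh (l i)) \<le> 1" using l(1) that degree_deh by blast
      then show "coeff (deh (l i)) j = coeff [:x (2*i), x (2*i+1):] j"
        by (cases j; cases "j - 1") (auto simp: x_def coeff_eq_0 coeff_pCons split: nat.splits)
    qed
    have "nonzero_pairs ?M x" unfolding nonzero_pairs_def
    proof (intro allI impI notI)
      fix i assume i: "i < ?M" "(x (2*i), x (2*i+1)) = (0, 0)"
      then have "deh (l i) = 0" using dl by simp
      moreover have "l i \<in> binary_forms 1" "l i \<noteq> 0" using l(1) i(1) by auto
      ultimately show False using deh_eq_0_iff by blast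
    qed
    moreover have "(\<Prod>i<?M. l i ^ (p ! i)) = hmg ?d (lprod ?M ((!) p) x)" by (rule form) (use l(1) dl in auto)
    ultimately show "c \<in> locus ?M ((!) p)" unfolding locus_def l(2) by auto
  next
    fix c assume "c \<in> (locus ?M ((!) p) :: 'a poly poly set set)"
    then obtain x :: "nat \<Rightarrow> 'a" where x: "nonzero_pairs ?M x" "c = proj_class (hmg ?d (lprod ?M ((!) p) x))" unfolding locus_def by blast
    define l where "l i = hmg 1 [:x (2*i), x (2*i+1):]" for i
    have "l i \<in> binary_forms 1 - {0}" if "i < ?M" for i
      using nonzero_pairs_linear[OF x(1) that] by (simp add: l_def hmg_eq_0_iff)
    moreover have "(\<Prod>i<?M. l i ^ (p ! i)) = hmg ?d (lprod ?M ((!) p) x)" 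
      by (rule form) (auto simp: l_def deh_hmg)
    ultimately have "c = proj_class (\<Prod>i<?M. l i ^ (p ! i)) \<and> (\<forall>i<?M. l i \<in> binary_forms 1 - {0})" using x(2) by simp
    then show "c \<in> multiple_root_locus p" unfolding multiple_root_locus_def by blast
  qed
qed

section \<open>Closedness of the loci\<close>

lemma aclosed_zero_set:
  assumes "\<And>\<phi>. \<phi> \<in> \<Phi> \<Longrightarrow> polyfun (coords UNIV) \<phi>"
  shows "aclosed {z. \<forall>\<phi>\<in>\<Phi>. \<phi> z = 0}"
  unfolding aclosed_def using assms by blast

definition shiftc :: "nat \<Rightarrow> (nat \<Rightarrow> 'a) \<Rightarrow> nat \<Rightarrow> 'a::zero" where
  "shiftc M y k = (if k < 2 * M then 0 else y (k - 2 * M))"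

lemma form_coord_beyond: "f \<in> binary_forms d \<Longrightarrow> j > d \<Longrightarrow> form_coord d f j = 0"
  using degree_deh[of f d] by (simp add: form_coord_deh coeff_eq_0)

lemma closedin_zariski_of_aclosed:
  fixes Z :: "'a::field_char_0 poly poly set set"
  assumes "aclosed E" "Z \<subseteq> proj_class ` (binary_forms d - {0})"
    and iff: "\<And>f. f \<in> binary_forms d - {0} \<Longrightarrow> proj_class f \<in> Z \<longleftrightarrow> shiftc M (form_coord d f) \<in> E"
  shows "closedin (zariski d) Z"
proof (rule closedin_zariskiI[OF assms(2)])
  fix f assume f: "f \<in> binary_forms d - {0}" "proj_class f \<notin> Z"
  then obtain \<phi> where phi: "polyfun (coords UNIV) \<phi>" "\<phi> (shiftc M (form_coord d f)) \<noteq> 0" "\<forall>y\<in>E. \<phi> y = 0"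
    using assms(1) iff unfolding aclosed_def by meson
  \<comment> \<open>Agrees with \<open>shiftc\<close> on coordinates of forms, but mentions only the
    coordinates up to \<open>d\<close>, as the homogeneous coordinate ring demands.\<close>
  define s where "s y k = (if k < 2 * M then 0 else if k - 2 * M \<le> d then y (k - 2 * M) else (0::'a))" for y :: "nat \<Rightarrow> 'a" and k
  have s: "s (form_coord d f) = shiftc M (form_coord d f)" if "f \<in> binary_forms d" for f
    using form_coord_beyond[OF that] by (auto simp: fun_eq_iff s_def shiftc_def)
  have "polyfun (coords {..d}) (\<lambda>y. \<phi> (s y))"
  proof (rule polyfun_compose_coords[OF phi(1)])
    fix k
    show "polyfun (coords {..d}) (\<lambda>y. s y k)"
      unfolding s_def by (cases "k < 2 * M"; cases "k - 2 * M \<le> d") (simp_all add: polyfun.const polyfun_coord)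
  qed
  then show "\<exists>\<psi>. polyfun (coords {..d}) \<psi> \<and> \<psi> (form_coord d f) \<noteq> 0 \<and> 
        (\<forall>f'\<in>binary_forms d - {0}. proj_class f' \<in> Z \<longrightarrow> \<psi> (form_coord d f') = 0)"
    using phi s f iff by (intro exI[of _ "\<lambda>y. \<phi> (s y)"]) auto
qed

lemma locus_subset_topspace: "locus M e \<subseteq> proj_class ` (binary_forms (\<Sum>i<M. e i) - {0})"
proof
  fix c assume "c \<in> locus M e"
  then obtain x where x: "nonzero_pairs M x" "c = proj_class (hmg (\<Sum>i<M. e i) (lprod M e x))" unfolding locus_def by blast
  then show "c \<in> proj_class ` (binary_forms (\<Sum>i<M. e i) - {0})"
    using lprod_nonzero[OF x(1), of e] hmg_eq_0_iff[OF degree_lprod[of M e x]] by (intro image_eqI[of _ _ "hmg (\<Sum>i<M. e i) (lprod M e x)"]) auto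
qed

text \<open>Proportionality to the product of powers is the vanishing of two-by-two minors, which is
  unaffected by scaling a linear form; the pairs are then eliminated.\<close>

lemma closedin_locus:
  "closedin (zariski (\<Sum>i<M. e i)) (locus M e :: 'a::{alg_closed_field, field_char_0} poly poly set set)"
proof -
  define d where "d = (\<Sum>i<M. e i)"
  define Y where "Y = {z::nat \<Rightarrow> 'a. \<forall>\<phi>\<in>(\<lambda>(i,j) z. z (2*M+i) * coeff (lprod M e z) j - z (2*M+j) * coeff (lprod M e z) i) ` ({..d} \<times> {..d}). \<phi> z = 0}"
  have Y: "z \<in> Y \<longleftrightarrow> (\<forall>i\<le>d. \<forall>j\<le>d. z (2*M+i) * coeff (lprod M e z) j = z (2*M+j) * coeff (lprod M e z) i)" for z
    unfolding Y_def by auto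
  have "aclosed Y" unfolding Y_def
    by (rule aclosed_zero_set) (auto intro!: polyfun_diff polyfun.mult polyfun_coord polyfun_lprod)
  then have "aclosed {z. \<exists>x. nonzero_pairs M x \<and> mergep M x z \<in> Y}"
  proof (rule aclosed_project_pairs)
    fix i x c assume "i < M" "x \<in> Y" "(c::'a) \<noteq> 0"
    moreover have "2*M + k \<noteq> 2*i" "2*M + k \<noteq> 2*i+1" for k using \<open>i < M\<close> by auto
    ultimately show "x(2*i := c * x (2*i), 2*i+1 := c * x (2*i+1)) \<in> Y"
      unfolding Y lprod_scale[OF \<open>i < M\<close>] by simp
  qed
  then show ?thesis unfolding d_def[symmetric]
  proof (rule closedin_zariski_of_aclosed[where M=M])
    show "locus M e \<subseteq> proj_class ` (binary_forms d - {0})" unfolding d_def by (rule locus_subset_topspace)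
    fix f :: "'a poly poly" assume f: "f \<in> binary_forms d - {0}"
    have mem: "mergep M x (shiftc M (form_coord d f)) \<in> Y \<longleftrightarrow> 
      (\<forall>i\<le>d. \<forall>j\<le>d. form_coord d f i * coeff (lprod M e x) j = form_coord d f j * coeff (lprod M e x) i)" for x
      unfolding Y lprod_mergep by (simp add: mergep_def shiftc_def)
    have "proj_class f \<in> locus M e \<longleftrightarrow> (\<exists>x. nonzero_pairs M x \<and> 
      (\<forall>i\<le>d. \<forall>j\<le>d. form_coord d f i * coeff (lprod M e x) j = form_coord d f j * coeff (lprod M e x) i))"
    proof
      assume "proj_class f \<in> locus M e"
      then obtain x where x: "nonzero_pairs M x" "proj_class f = proj_class (hmg d (lprod M e x))" unfolding locus_def d_def by blast
      from proj_class_eqD[OF x(2)] obtain c where "f = form_scale c (hmg d (lprod M e x))" by blast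
      then have "form_coord d f = (\<lambda>j. c * coeff (lprod M e x) j)"
        by (simp only: form_coord_scale form_coord_hmg[OF degree_lprod[of M e x, folded d_def]])
      with x(1) show "\<exists>x. nonzero_pairs M x \<and> 
        (\<forall>i\<le>d. \<forall>j\<le>d. form_coord d f i * coeff (lprod M e x) j = form_coord d f j * coeff (lprod M e x) i)" by auto
    next
      assume "\<exists>x. nonzero_pairs M x \<and> 
        (\<forall>i\<le>d. \<forall>j\<le>d. form_coord d f i * coeff (lprod M e x) j = form_coord d f j * coeff (lprod M e x) i)"
      then obtain x where x: "nonzero_pairs M x" 
        "\<forall>i\<le>d. \<forall>j\<le>d. form_coord d f i * coeff (lprod M e x) j = form_coord d f j * coeff (lprod M e x) i" by blast
      let ?p = "lprod M e x"
      have p0: "?p \<noteq> 0" using lprod_nonzero[OF x(1)] .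
      have dp: "degree ?p \<le> d" unfolding d_def by (rule degree_lprod)
      define c where "c = form_coord d f (degree ?p) / coeff ?p (degree ?p)"
      have "deh f = smult c ?p"
      proof (rule poly_eqI)
        fix i
        show "coeff (deh f) i = coeff (smult c ?p) i"
        proof (cases "i \<le> d")
          case True
          then show ?thesis using x(2)[rule_format, OF True dp] p0 f by (simp add: c_def form_coord_deh field_simps)
        next
          case False
          then show ?thesis using dp degree_deh[of f d] f by (simp add: coeff_eq_0)
        qed
      qed
      then have fs: "f = form_scale c (hmg d ?p)" using hmg_deh[of f d] f by (simp add: hmg_scale)
      moreover have "c \<noteq> 0" using fs f by auto
      ultimately have "proj_class f = proj_class (hmg d ?p)" using proj_class_scale by blast
      then show "proj_class f \<in> locus M e" unfolding locus_def d_def using x(1) by blast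
    qed
    then show "proj_class f \<in> locus M e \<longleftrightarrow> shiftc M (form_coord d f) \<in> {z. \<exists>x. nonzero_pairs M x \<and> mergep M x z \<in> Y}"
      unfolding mem[symmetric] by simp
  qed
qed

text \<open>The factorials come from differentiating the monomial with exponents
  \<open>d - j\<close> and \<open>j\<close> down to a constant; \<open>ap (dual_seq d g) d\<close>
  is the pairing with \<open>g\<close>.\<close>

definition dual_seq :: "nat \<Rightarrow> 'a::field_char_0 poly poly \<Rightarrow> nat \<Rightarrow> 'a" where
  "dual_seq d g j = fact j * fact (d - j) * form_coord d g j"

lemma dual_seq_scale: "dual_seq d (form_scale c g) = (\<lambda>j. c * dual_seq d g j)"
  by (simp add: dual_seq_def form_coord_scale fun_eq_iff mult_ac)

lemma apolar_scale: 
  assumes "c \<noteq> 0"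
  shows "apolar (\<lambda>j. c * a j) d n h \<longleftrightarrow> apolar a d n h"
proof -
  have "(\<Sum>j\<le>n. coeff h j * (c * a (e + j))) = c * (\<Sum>j\<le>n. coeff h j * a (e + j))" for e
    by (simp add: sum_distrib_left mult_ac)
  then show ?thesis unfolding apolar_iff using assms by simp
qed

definition apolar_locus :: "nat \<Rightarrow> nat \<Rightarrow> (nat \<Rightarrow> nat) \<Rightarrow> 'a::field_char_0 poly poly set set" where
  "apolar_locus d M r = {proj_class g | g. g \<in> binary_forms d - {0} \<and> 
     (\<exists>x. nonzero_pairs M x \<and> apolar (dual_seq d g) d (\<Sum>i<M. r i) (lprod M r x))}"

lemma apolar_locus_iff:
  assumes "g \<in> binary_forms d - {0}"
  shows "proj_class g \<in> apolar_locus d M r \<longleftrightarrow> 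
    (\<exists>x. nonzero_pairs M x \<and> apolar (dual_seq d g) d (\<Sum>i<M. r i) (lprod M r x))"
proof
  assume "proj_class g \<in> apolar_locus d M r"
  then obtain g' x where g': "proj_class g = proj_class g'" "nonzero_pairs M x" "apolar (dual_seq d g') d (\<Sum>i<M. r i) (lprod M r x)"
    unfolding apolar_locus_def by blast
  from proj_class_eqD[OF g'(1)] obtain c where "c \<noteq> 0" "g = form_scale c g'" by blast
  then show "\<exists>x. nonzero_pairs M x \<and> apolar (dual_seq d g) d (\<Sum>i<M. r i) (lprod M r x)"
    unfolding \<open>g = form_scale c g'\<close> dual_seq_scale apolar_scale[OF \<open>c \<noteq> 0\<close>] using g'(2,3) by blast
qed (use assms in \<open>auto simp: apolar_locus_def\<close>)

text \<open>The equations of annihilation are linear in the form and homogeneous of degree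
  \<open>r i\<close> in the \<open>i\<close>-th linear form, so the pairs can be eliminated.\<close>

lemma closedin_apolar_locus:
  "closedin (zariski d) (apolar_locus d M r :: 'a::{alg_closed_field, field_char_0} poly poly set set)"
proof -
  define n where "n = (\<Sum>i<M. r i)"
  define \<Phi> where "\<Phi> e z = (\<Sum>j\<le>n. coeff (lprod M r z) j * (fact (e+j) * fact (d-(e+j)) * z (2*M+(e+j))))" 
    for e and z :: "nat \<Rightarrow> 'a"
  define Y where "Y = {z. \<forall>\<phi>\<in>{\<Phi> e | e. e + n \<le> d}. \<phi> z = 0}"
  have Y: "z \<in> Y \<longleftrightarrow> (\<forall>e. e + n \<le> d \<longrightarrow> \<Phi> e z = 0)" for z
    unfolding Y_def by auto
  have "polyfun (coords UNIV) (\<Phi> e)" for e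
    unfolding \<Phi>_def[abs_def] by (intro polyfun_sum polyfun.mult polyfun.const polyfun_coord polyfun_lprod) auto
  then have "aclosed Y" unfolding Y_def by (intro aclosed_zero_set) auto
  then have "aclosed {z. \<exists>x. nonzero_pairs M x \<and> mergep M x z \<in> Y}"
  proof (rule aclosed_project_pairs)
    fix i x c assume i: "i < M" and x: "x \<in> Y" and c: "(c::'a) \<noteq> 0"
    have ne: "2*M + k \<noteq> 2*i" "2*M + k \<noteq> 2*i+1" for k using i by auto
    have "\<Phi> e (x(2*i := c * x (2*i), 2*i+1 := c * x (2*i+1))) = c ^ r i * \<Phi> e x" for e
      unfolding \<Phi>_def lprod_scale[OF i] sum_distrib_left using ne by (intro sum.cong refl) simp
    then show "x(2*i := c * x (2*i), 2*i+1 := c * x (2*i+1)) \<in> Y"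
      using x unfolding Y by simp
  qed
  then show ?thesis
  proof (rule closedin_zariski_of_aclosed[where M=M])
    show "apolar_locus d M r \<subseteq> proj_class ` (binary_forms d - {0 :: 'a poly poly})" unfolding apolar_locus_def by blast
    fix f :: "'a poly poly" assume f: "f \<in> binary_forms d - {0}"
    have "\<Phi> e (mergep M x (shiftc M (form_coord d f))) = (\<Sum>j\<le>n. coeff (lprod M r x) j * dual_seq d f (e + j))" for e x
      unfolding \<Phi>_def lprod_mergep by (simp add: mergep_def shiftc_def dual_seq_def)
    then have "mergep M x (shiftc M (form_coord d f)) \<in> Y \<longleftrightarrow> apolar (dual_seq d f) d n (lprod M r x)" for x
      unfolding Y apolar_iff using degree_lprod[of M r x, folded n_def] by simp
    then show "proj_class f \<in> apolar_locus d M r \<longleftrightarrow> shiftc M (form_coord d f) \<in> {z. \<exists>x. nonzero_pairs M x \<and> mergep M x z \<in> Y}"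
      unfolding apolar_locus_iff[OF f] n_def[symmetric] by simp
  qed
qed

section \<open>Algebraic independence\<close>

text \<open>The degree is bounded in each variable separately: the monomials form a box with
  \<open>(D + 1) ^ n\<close> elements, which makes them easy to count.\<close>

inductive bddf :: "nat \<Rightarrow> nat \<Rightarrow> ((nat \<Rightarrow> 'a::field) \<Rightarrow> 'a) \<Rightarrow> bool" for n D where
  zero: "bddf n D (\<lambda>y. 0)"
| add_mon: "bddf n D f \<Longrightarrow> (\<And>i. i < n \<Longrightarrow> \<epsilon> i \<le> D) \<Longrightarrow> bddf n D (\<lambda>y. f y + c * (\<Prod>i<n. y i ^ \<epsilon> i))"

lemma bddf_mon: "(\<And>i. i < n \<Longrightarrow> \<epsilon> i \<le> D) \<Longrightarrow> bddf n D (\<lambda>y. c * (\<Prod>i<n. y i ^ \<epsilon> i))"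
  using bddf.add_mon[OF bddf.zero, of n \<epsilon> D c] by simp

lemma bddf_mono: "bddf n D f \<Longrightarrow> D \<le> D' \<Longrightarrow> bddf n D' f"
  by (induction rule: bddf.induct) (auto intro!: bddf.intros intro: order.trans)

lemma bddf_add: "bddf n D g \<Longrightarrow> bddf n D f \<Longrightarrow> bddf n D (\<lambda>y. f y + g y)"
proof (induction rule: bddf.induct)
  case (add_mon g \<epsilon> c)
  then show ?case using bddf.add_mon[of n D "\<lambda>y. f y + g y" \<epsilon> c] by (simp add: add.assoc)
qed simp

lemma bddf_mult_mon: 
  assumes "bddf n D f" "\<And>i. i < n \<Longrightarrow> \<epsilon> i \<le> D'"
  shows "bddf n (D + D') (\<lambda>y. f y * (c * (\<Prod>i<n. y i ^ \<epsilon> i)))"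
  using assms(1)
proof (induction rule: bddf.induct)
  case zero
  then show ?case using bddf.zero by simp
next
  case (add_mon f \<delta> b)
  have "bddf n (D + D') (\<lambda>y. f y * (c * (\<Prod>i<n. y i ^ \<epsilon> i)) + (b * c) * (\<Prod>i<n. y i ^ (\<delta> i + \<epsilon> i)))"
    by (rule bddf.add_mon[OF add_mon.IH]) (use add_mon.hyps(2) assms(2) in \<open>auto intro: add_mono\<close>)
  then show ?case by (simp add: power_add prod.distrib algebra_simps)
qed

lemma bddf_mult:
  assumes "bddf n D' g" "bddf n D f"
  shows "bddf n (D + D') (\<lambda>y. f y * g y)"
  using assms(1)
proof (induction rule: bddf.induct)
  case zero
  then show ?case using bddf.zero by simp
next
  case (add_mon g \<delta> b)
  have "bddf n (D + D') (\<lambda>y. f y * g y + f y * (b * (\<Prod>i<n. y i ^ \<delta> i)))"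
    by (rule bddf_add[OF bddf_mult_mon[OF assms(2)] add_mon.IH]) (use add_mon.hyps in auto)
  then show ?case by (simp add: algebra_simps)
qed

lemma bddf_one: "bddf n D (\<lambda>y. 1)"
  using bddf_mon[of n "\<lambda>_. 0" D 1] by simp

lemma bddf_power: "bddf n D f \<Longrightarrow> bddf n (k * D) (\<lambda>y. f y ^ k)"
proof (induction k)
  case (Suc k)
  then show ?case using bddf_mult[of n "k * D" "\<lambda>y. f y ^ k" D f] by simp
qed (simp add: bddf_one)

lemma bddf_prod:
  assumes "finite I" "\<And>i. i \<in> I \<Longrightarrow> bddf n D (f i)"
  shows "bddf n (card I * D) (\<lambda>y. \<Prod>i\<in>I. f i y)"
  using assms
proof (induction I rule: finite_induct)
  case (insert i I)
  then show ?case using bddf_mult[of n "card I * D" "\<lambda>y. \<Prod>i\<in>I. f i y" D "f i"] by simp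
qed (simp add: bddf_one)

lemma bddf_polyfun:
  fixes f :: "(nat \<Rightarrow> 'a::field) \<Rightarrow> 'a"
  assumes "polyfun (coords {..<n}) f"
  shows "\<exists>D. bddf n D f"
  using assms
proof (induction rule: polyfun.induct)
  case (const c)
  show ?case using bddf_mon[of n "\<lambda>_. 0" 0 c] by auto
next
  case (gen g)
  then obtain k where k: "k < n" "g = (\<lambda>x. x k)" by (auto simp: coords_def)
  have eq: "(\<lambda>y::nat \<Rightarrow> 'a. 1 * (\<Prod>i<n. y i ^ (if i = k then 1 else 0))) = g"
    using k by (intro ext) (simp add: if_distrib prod.delta cong: if_cong)
  have "bddf n 1 (\<lambda>y::nat \<Rightarrow> 'a. 1 * (\<Prod>i<n. y i ^ (if i = k then 1 else 0)))" by (rule bddf_mon) auto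
  then show ?case unfolding eq by blast
next
  case (add f g)
  then obtain D D' where "bddf n D f" "bddf n D' g" by blast
  then show ?case using bddf_add[of n "D + D'" g f] bddf_mono le_add1 le_add2 by blast
next
  case (mult f g)
  then show ?case using bddf_mult by blast
qed

lemma bddf_coeffs:
  assumes "bddf n D f"
  shows "\<exists>c. \<forall>y. f y = (\<Sum>\<epsilon>\<in>PiE {..<n} (\<lambda>_. {..D}). c \<epsilon> * (\<Prod>i<n. y i ^ \<epsilon> i))"
  using assms
proof (induction rule: bddf.induct)
  case zero
  show ?case by (intro exI[of _ "\<lambda>_. 0"]) simp
next
  case (add_mon f \<delta> b)
  then obtain c where c: "\<forall>y. f y = (\<Sum>\<epsilon>\<in>PiE {..<n} (\<lambda>_. {..D}). c \<epsilon> * (\<Prod>i<n. y i ^ \<epsilon> i))" by blast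
  let ?\<delta> = "restrict \<delta> {..<n}"
  let ?E = "PiE {..<n} (\<lambda>_. {..D})"
  have mem: "?\<delta> \<in> ?E" using add_mon.hyps by auto
  have fin: "finite ?E" by (intro finite_PiE) auto
  have "f y + b * (\<Prod>i<n. y i ^ \<delta> i) = (\<Sum>\<epsilon>\<in>?E. (c \<epsilon> + (if \<epsilon> = ?\<delta> then b else 0)) * (\<Prod>i<n. y i ^ \<epsilon> i))" for y
  proof -
    have "(\<Sum>\<epsilon>\<in>?E. (if \<epsilon> = ?\<delta> then b else 0) * (\<Prod>i<n. y i ^ \<epsilon> i)) = (\<Sum>\<epsilon>\<in>?E. if \<epsilon> = ?\<delta> then b * (\<Prod>i<n. y i ^ ?\<delta> i) else 0)"
      by (intro sum.cong) auto
    also have "\<dots> = b * (\<Prod>i<n. y i ^ \<delta> i)" using mem fin by simp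
    finally show ?thesis using c by (simp add: distrib_right sum.distrib)
  qed
  then show ?case by (intro exI[of _ "\<lambda>\<epsilon>. c \<epsilon> + (if \<epsilon> = ?\<delta> then b else 0)"] allI)
qed

text \<open>A count of dimensions: the monomials in the \<open>G i\<close> with exponents at most
  \<open>s\<close> number \<open>(s + 1) ^ N\<close> with \<open>N > n\<close>, while they lie in a
  space spanned by about \<open>s ^ n\<close> monomials in the variables, up to a constant
  factor.\<close>

lemma algebraic_dependence:
  fixes G :: "'v \<Rightarrow> (nat \<Rightarrow> 'a::field) \<Rightarrow> 'a"
  assumes "finite I" "card I > n" "\<And>i. i \<in> I \<Longrightarrow> polyfun (coords {..<n}) (G i)"
  shows "\<exists>P. P \<noteq> 0 \<and> mp_over I P \<and> (\<forall>y. mp_eval (\<lambda>i. G i y) P = 0)"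
proof -
  obtain D0 where D0: "\<And>i. i \<in> I \<Longrightarrow> bddf n (D0 i) (G i)" using bddf_polyfun[OF assms(3)] by metis
  define D where "D = (\<Sum>i\<in>I. D0 i) + 1"
  have D: "bddf n D (G i)" if "i \<in> I" for i
    using bddf_mono[OF D0[OF that]] member_le_sum[of i I D0] assms(1) that by (simp add: D_def)
  define N where "N = card I"
  \<comment> \<open>With this value \<open>(D' + 1) ^ n\<close> is at most
    \<open>s * (s + 1) ^ n\<close>, just below \<open>(s + 1) ^ Suc n\<close>.\<close>
  define s where "s = (N * D) ^ n"
  define D' where "D' = N * (s * D)"
  define E where "E = PiE {..<n} (\<lambda>_. {..D'})"
  define J where "J = PiE I (\<lambda>_. {..s})"
  have fin: "finite E" "finite J" unfolding E_def J_def using assms(1) by (auto intro!: finite_PiE)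
  have cE: "card E = (D' + 1) ^ n" by (simp add: E_def card_PiE)
  have cJ: "card J = (s + 1) ^ N" using assms(1) by (simp add: J_def card_PiE N_def)
  have "card E < card J"
  proof -
    have "N * D \<ge> 1" using assms(2) by (simp add: N_def D_def)
    then have "D' + 1 \<le> N * D * (s + 1)" by (simp add: D'_def algebra_simps)
    then have "(D' + 1) ^ n \<le> (N * D * (s + 1)) ^ n" by (rule power_mono) simp
    also have "\<dots> = s * (s + 1) ^ n" by (simp only: power_mult_distrib[of "N * D"] s_def)
    also have "\<dots> < (s + 1) * (s + 1) ^ n" by simp
    also have "\<dots> = (s + 1) ^ Suc n" by simp
    also have "\<dots> \<le> (s + 1) ^ N" using assms(2) by (intro power_increasing) (auto simp: N_def)
    finally show ?thesis by (simp add: cE cJ)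
  qed
  have bd: "bddf n D' (\<lambda>y. \<Prod>i\<in>I. G i y ^ b i)" if "b \<in> J" for b
    unfolding D'_def N_def
  proof (rule bddf_prod[OF assms(1)])
    fix i assume i: "i \<in> I"
    then have "b i \<le> s" using that by (auto simp: J_def)
    then show "bddf n (s * D) (\<lambda>y. G i y ^ b i)" using bddf_mono[OF bddf_power[OF D[OF i]]] by simp
  qed
  have "\<forall>b\<in>J. \<exists>c. \<forall>y. (\<Prod>i\<in>I. G i y ^ b i) = (\<Sum>\<epsilon>\<in>E. c \<epsilon> * (\<Prod>i<n. y i ^ \<epsilon> i))"
    using bddf_coeffs[OF bd] unfolding E_def by blast
  then obtain c where c: "\<And>b y. b \<in> J \<Longrightarrow> (\<Prod>i\<in>I. G i y ^ b i) = (\<Sum>\<epsilon>\<in>E. c b \<epsilon> * (\<Prod>i<n. y i ^ \<epsilon> i))"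
    by metis
  from homogeneous_system_nontrivial[OF fin \<open>card E < card J\<close>, of "\<lambda>\<epsilon> b. c b \<epsilon>"] obtain x where
    x: "\<exists>b\<in>J. x b \<noteq> 0" "\<forall>\<epsilon>\<in>E. (\<Sum>b\<in>J. c b \<epsilon> * x b) = 0" by blast
  define pm where "pm b = (\<Sum>i\<in>I. sgl i (b i :: nat))" for b
  have pm: "lkp (pm b) i = (if i \<in> I then b i else 0)" for b i
    unfolding pm_def using assms(1) by (rule lookup_sum_single)
  have kpm: "pmkeys (pm b) \<subseteq> I" for b by (auto simp: in_keys_iff pm split: if_splits)
  have inj: "inj_on pm J"
  proof (rule inj_onI)
    fix b b' assume bb: "b \<in> J" "b' \<in> J" "pm b = pm b'"
    show "b = b'"
    proof (rule PiE_ext[OF bb(1,2)[unfolded J_def]])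
      fix i assume "i \<in> I"
      then show "b i = b' i" using pm[of b i] pm[of b' i] bb(3) by simp
    qed
  qed
  define P where "P = (\<Sum>b\<in>J. sgl (pm b) (x b))"
  have lP: "lkp P (pm b0) = x b0" if "b0 \<in> J" for b0
  proof -
    have "lkp P (pm b0) = (\<Sum>b\<in>J. if b = b0 then x b0 else 0)"
      unfolding P_def lookup_sum
      by (intro sum.cong refl) (use inj that in \<open>auto simp: lookup_single when_def inj_on_def\<close>)
    also have "\<dots> = x b0" using that fin by simp
    finally show ?thesis .
  qed
  have "P \<noteq> 0" using x(1) lP by force
  moreover have "mp_over I P"
    unfolding mp_over_def
  proof
    fix m assume "m \<in> pmkeys P"
    then obtain b where "m = pm b"
      using keys_sum[of "\<lambda>b. sgl (pm b) (x b)" J] unfolding P_def by (auto split: if_splits)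
    then show "pmkeys m \<subseteq> I" using kpm by blast
  qed
  moreover have "mp_eval (\<lambda>i. G i y) P = 0" for y
  proof -
    have "mp_eval (\<lambda>i. G i y) P = (\<Sum>b\<in>J. x b * (\<Prod>i\<in>I. G i y ^ b i))"
      unfolding P_def mp_eval_sum mp_eval_single mon_superset[OF assms(1) kpm] by (simp add: pm)
    also have "\<dots> = (\<Sum>b\<in>J. \<Sum>\<epsilon>\<in>E. c b \<epsilon> * x b * (\<Prod>i<n. y i ^ \<epsilon> i))"
      by (intro sum.cong refl) (simp add: c sum_distrib_left mult_ac)
    also have "\<dots> = (\<Sum>\<epsilon>\<in>E. (\<Sum>b\<in>J. c b \<epsilon> * x b) * (\<Prod>i<n. y i ^ \<epsilon> i))"
      by (subst sum.swap) (simp add: sum_distrib_right)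
    also have "\<dots> = 0" using x(2) by simp
    finally show ?thesis .
  qed
  ultimately show ?thesis by blast
qed

definition alg_indep :: "'v set \<Rightarrow> ('v \<Rightarrow> 'y \<Rightarrow> 'a::field) \<Rightarrow> 'y set \<Rightarrow> bool" where
  "alg_indep I G Y \<longleftrightarrow> (\<forall>P. mp_over I P \<and> (\<forall>y\<in>Y. mp_eval (\<lambda>i. G i y) P = 0) \<longrightarrow> P = 0)"

lemma alg_indep_mono: "alg_indep I G Y \<Longrightarrow> Y \<subseteq> Y' \<Longrightarrow> alg_indep I G Y'"
  unfolding alg_indep_def by blast

definition acone :: "nat \<Rightarrow> 'a::field poly poly set set \<Rightarrow> (nat \<Rightarrow> 'a) set" where
  "acone d Z = {form_coord d f | f. f \<in> binary_forms d \<and> (f = 0 \<or> proj_class f \<in> Z)}"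

lemma cone_mono: "Z \<subseteq> Z' \<Longrightarrow> acone d Z \<subseteq> acone d Z'"
  unfolding acone_def by blast

lemma cone_scale: 
  assumes "z \<in> acone d Z"
  shows "(\<lambda>i. c * z i) \<in> acone d Z"
proof -
  obtain f where f: "z = form_coord d f" "f \<in> binary_forms d" "f = 0 \<or> proj_class f \<in> Z" using assms unfolding acone_def by blast
  have "form_scale c f = 0 \<or> proj_class (form_scale c f) \<in> Z"
    using f(3) proj_class_scale[of c f] by (cases "c = 0") auto
  then show ?thesis unfolding acone_def f(1) form_coord_scale[symmetric] using form_scale_binary[OF f(2)] by blast
qed

lemma zero_in_cone: "(\<lambda>_. 0) \<in> acone d Z"
  unfolding acone_def by (intro CollectI exI[of _ 0]) (auto simp: form_coord_def binary_forms_zero)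

lemma cone_locus:
  assumes "z \<in> acone (\<Sum>i<M. e i) (locus M e)"
  shows "\<exists>c x. nonzero_pairs M x \<and> z = coeff (smult c (lprod M e x))"
proof -
  let ?d = "\<Sum>i<M. e i"
  obtain f where f: "z = form_coord ?d f" "f = 0 \<or> proj_class f \<in> locus M e" using assms unfolding acone_def by blast
  show ?thesis
  proof (cases "f = 0")
    case True
    have "nonzero_pairs M (\<lambda>_. 1::'a)" by (simp add: nonzero_pairs_def)
    moreover have "z = coeff (smult 0 (lprod M e (\<lambda>_. 1)))" using True f(1) by (auto simp: form_coord_def)
    ultimately show ?thesis by blast
  next
    case False
    then obtain x where x: "nonzero_pairs M x" "proj_class f = proj_class (hmg ?d (lprod M e x))"
      using f(2) unfolding locus_def by blast
    from proj_class_eqD[OF x(2)] obtain c where "f = form_scale c (hmg ?d (lprod M e x))" by blast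
    then have "z = coeff (smult c (lprod M e x))"
      unfolding f(1) by (simp add: form_coord_scale form_coord_hmg[OF degree_lprod] fun_eq_iff)
    then show ?thesis using x(1) by blast
  qed
qed

text \<open>The cone is dominated by the \<open>M + 1\<close> parameters of \<open>c \<Prod>(u + y\<^sub>i v)\<^bsup>e\<^sub>i\<^esup>\<close>.\<close>

lemma alg_indep_cone_locus:
  fixes G :: "'v \<Rightarrow> (nat \<Rightarrow> 'a::field_char_0) \<Rightarrow> 'a"
  assumes "finite I" "\<And>i. i \<in> I \<Longrightarrow> polyfun (coords UNIV) (G i)"
    and "alg_indep I G (acone (\<Sum>i<M. e i) (locus M e))"
  shows "card I \<le> M + 1"
proof (rule ccontr)
  assume "\<not> ?thesis"
  then have card: "card I > M + 1" by simp
  define \<phi> where "\<phi> y = coeff ([:y M:] * (\<Prod>i<M. [:1, y i:] ^ e i))" for y :: "nat \<Rightarrow> 'a"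
  have phi: "polyfun (coords {..<M+1}) (\<lambda>y. \<phi> y j)" for j
    unfolding \<phi>_def
  proof (intro polyfun_coeff_mult polyfun_coeff_prod polyfun_coeff_power polyfun_coeff_linear polyfun.const polyfun_coord)
    show "polyfun (coords {..<M+1}) (\<lambda>y::nat \<Rightarrow> 'a. coeff [:y M:] i)" for i
      using polyfun_coeff_linear[OF polyfun_coord polyfun.const, of M "{..<M+1}" 0 i] by simp
  qed auto
  have G: "polyfun (coords {..<M+1}) (\<lambda>y. G i (\<phi> y))" if "i \<in> I" for i
    by (rule polyfun_compose_coords[OF assms(2)[OF that]]) (rule phi)
  obtain P where
    P: "P \<noteq> 0" "mp_over I P" "\<forall>y. mp_eval (\<lambda>i. G i (\<phi> y)) P = 0"
    using algebraic_dependence[where G="\<lambda>i y. G i (\<phi> y)", OF assms(1) card G] by blast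
  have "mp_eval (\<lambda>i. G i z) P = 0" if z: "z \<in> acone (\<Sum>i<M. e i) (locus M e)" for z
  proof -
    obtain c x where x: "nonzero_pairs M x" "z = coeff (smult c (lprod M e x))" using cone_locus[OF z] by blast
    \<comment> \<open>All linear forms of \<open>w\<close> equal \<open>u\<close>. A general point
      between \<open>x\<close> and \<open>w\<close> therefore has nonzero
      \<open>u\<close>-coefficients; dividing by them puts it in the image of
      \<open>\<phi>\<close>.\<close>
    define w where "w k = (if even k then 1 else 0 :: 'a)" for k :: nat
    define h where "h t = mp_eval (\<lambda>i. G i (coeff (smult c (lprod M e (lineseg x w t))))) P" for t
    have "curvefun h" unfolding h_def
    proof (rule mp_eval_curve[OF P(2)], rule polyfun_compose_coords[OF assms(2)])
      show "curvefun (\<lambda>t. coeff (smult c (lprod M e (lineseg x w t))) i)" for i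
        unfolding coeff_smult by (intro polyfun.mult polyfun.const polyfun_lprod) 
          (auto simp: lineseg_def intro!: polyfun_intros)
    qed
    moreover have "\<forall>\<^sub>F t in cofinite. h t = 0"
    proof -
      have "\<forall>\<^sub>F t in cofinite. (\<Prod>i<M. lineseg x w t (2*i)) \<noteq> 0"
        by (rule curvefun_generic[where ?t0.0=1]) (auto simp: lineseg_def w_def intro!: polyfun_intros)
      then show ?thesis
      proof eventually_elim
        case (elim t)
        let ?u = "lineseg x w t"
        have nz: "?u (2*i) \<noteq> 0" if "i < M" for i using elim that by auto
        define y where "y = (\<lambda>i. ?u (2*i+1) / ?u (2*i))(M := c * (\<Prod>i<M. ?u (2*i) ^ e i))"
        have "lprod M e ?u = (\<Prod>i<M. smult (?u (2*i) ^ e i) ([:1, y i:] ^ e i))"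
          unfolding lprod_def
        proof (intro prod.cong refl)
          fix i assume i: "i \<in> {..<M}"
          then have "[:?u (2*i), ?u (2*i+1):] = smult (?u (2*i)) [:1, y i:]" using nz by (simp add: y_def)
          then show "[:?u (2*i), ?u (2*i+1):] ^ e i = smult (?u (2*i) ^ e i) ([:1, y i:] ^ e i)"
            by (simp only: smult_power)
        qed
        also have "\<dots> = smult (\<Prod>i<M. ?u (2*i) ^ e i) (\<Prod>i<M. [:1, y i:] ^ e i)" by (rule prod_smult)
        finally have "coeff (smult c (lprod M e ?u)) = \<phi> y" by (simp add: \<phi>_def y_def)
        then show ?case using P(3) by (simp add: h_def)
      qed
    qed
    ultimately have "h 0 = 0" by (rule curvefun_eq_0)
    then show ?thesis by (simp add: h_def x(2))
  qed
  then show False using assms(3) P(1,2) unfolding alg_indep_def by blast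
qed

section \<open>Dimension of the loci\<close>

definition zvanish :: "nat \<Rightarrow> (nat, 'a::field) mpolynomial \<Rightarrow> 'a poly poly set set" where
  "zvanish d F = topspace (zariski d) - zbasic d F"

lemma closedin_zvanish: "F \<in> homogeneous_polys d \<Longrightarrow> closedin (zariski d) (zvanish d F)"
  unfolding zvanish_def by (intro closedin_diff closedin_topspace) 
    (auto simp: zariski_alt intro: topology_generated_by_Basis)

lemma zvanish_iff:
  assumes "F \<in> homogeneous_polys d" "f \<in> binary_forms d - {0}"
  shows "proj_class f \<in> zvanish d F \<longleftrightarrow> mp_eval (form_coord d f) F = 0"
  unfolding zvanish_def using zbasic_iff[OF assms] assms(2) by (auto simp: topspace_zariski)

lemma irreducible_closed_rep:
  assumes "irreducible_closed (zariski d) Z" "c \<in> Z"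
  shows "\<exists>f. f \<in> binary_forms d - {0} \<and> c = proj_class f"
proof -
  have "Z \<subseteq> topspace (zariski d)" using assms(1) closedin_subset unfolding irreducible_closed_def by blast
  then show ?thesis using assms(2) topspace_zariski by blast
qed

lemma irreducible_closed_point:
  assumes "irreducible_closed (zariski d) Z"
  shows "\<exists>f. f \<in> binary_forms d - {0} \<and> proj_class f \<in> Z"
proof -
  obtain c where "c \<in> Z" using assms unfolding irreducible_closed_def by blast
  then show ?thesis using irreducible_closed_rep[OF assms] by blast
qed

lemma mp_hom_at_zero: "mp_hom k F \<Longrightarrow> mp_eval (form_coord d 0) F = 0 ^ k * mp_eval x F"
  using mp_hom_scale[of k F 0 x] by (simp add: form_coord_def[abs_def])

text \<open>The coordinate ring of the cone over an irreducible set has no zero divisors.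
  Irreducibility only speaks of homogeneous equations, so \<open>H\<close> is treated through its
  components.\<close>

lemma irreducible_cone_mult:
  fixes Z :: "'a::field_char_0 poly poly set set"
  assumes irr: "irreducible_closed (zariski d) Z" and F: "F \<in> homogeneous_polys d" 
    and H: "polyfun (coords {..d}) H"
    and FH: "\<And>z. z \<in> acone d Z \<Longrightarrow> mp_eval z F * H z = 0"
    and z0: "z0 \<in> acone d Z" "mp_eval z0 F \<noteq> 0"
    and z: "z \<in> acone d Z"
  shows "H z = 0"
proof -
  obtain k where k: "mp_hom k F" using F homogeneous_polys_iff by blast
  obtain H' where H': "mp_over {..d} H'" "\<forall>x. mp_eval x H' = H x" using polyfun_imp_mp[OF H] by blast
  have h: "hcomp e H' \<in> homogeneous_polys d" for e using H'(1) hcomp_hom homogeneous_polys_iff by blast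
  obtain f1 where f1: "f1 \<in> binary_forms d - {0}" "proj_class f1 \<in> Z" 
    using irreducible_closed_point[OF irr] by blast
  have notF: "\<not> Z \<subseteq> zvanish d F"
  proof
    assume sub: "Z \<subseteq> zvanish d F"
    obtain f0 where f0: "z0 = form_coord d f0" "f0 \<in> binary_forms d" "f0 = 0 \<or> proj_class f0 \<in> Z"
      using z0(1) unfolding acone_def by blast
    show False
    proof (cases "f0 = 0")
      case True
      then have "mp_eval z0 F = 0 ^ k * mp_eval (form_coord d f1) F" using mp_hom_at_zero[OF k] f0(1) by simp
      moreover have "mp_eval (form_coord d f1) F = 0" using sub f1 zvanish_iff[OF F f1(1)] by blast
      ultimately show False using z0(2) by simp
    next
      case False
      then show False using f0 sub z0(2) zvanish_iff[OF F, of f0] by blast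
    qed
  qed
  have sub: "Z \<subseteq> zvanish d (hcomp e H')" for e
  proof -
    have "Z \<subseteq> zvanish d F \<union> zvanish d (hcomp e H')"
    proof
      fix c assume c: "c \<in> Z"
      then obtain f where f: "f \<in> binary_forms d - {0}" "c = proj_class f" using irreducible_closed_rep[OF irr] by blast
      let ?z = "form_coord d f"
      have zc: "?z \<in> acone d Z" using f c unfolding acone_def by blast
      show "c \<in> zvanish d F \<union> zvanish d (hcomp e H')"
      proof (cases "mp_eval ?z F = 0")
        case True
        then show ?thesis using zvanish_iff[OF F f(1)] f(2) by blast
      next
        case False
        have "mp_eval (\<lambda>i. b * ?z i) H' = 0" if "b \<noteq> 0" for b
        proof -
          have "mp_eval (\<lambda>i. b * ?z i) F \<noteq> 0" using mp_hom_scale[OF k, of b ?z] False that by simp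
          then show ?thesis using FH[OF cone_scale[OF zc, of b]] H'(2) by simp
        qed
        from hcomp_vanishes[OF this] show ?thesis using zvanish_iff[OF h f(1)] f(2) by blast
      qed
    qed
    then show ?thesis using irr notF closedin_zvanish[OF F] closedin_zvanish[OF h] unfolding irreducible_closed_def by blast
  qed
  have "mp_eval z (hcomp e H') = 0" for e
  proof -
    obtain f where f: "z = form_coord d f" "f \<in> binary_forms d" "f = 0 \<or> proj_class f \<in> Z"
      using z unfolding acone_def by blast
    show ?thesis
    proof (cases "f = 0")
      case True
      then have "mp_eval z (hcomp e H') = 0 ^ e * mp_eval (form_coord d f1) (hcomp e H')" 
        using mp_hom_at_zero[OF hcomp_hom(1)[of e H']] f(1) by simp
      moreover have "mp_eval (form_coord d f1) (hcomp e H') = 0" using sub f1 zvanish_iff[OF h f1(1)] by blast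
      ultimately show ?thesis by simp
    next
      case False
      then show ?thesis using f sub zvanish_iff[OF h, of f] by blast
    qed
  qed
  then show ?thesis using hcomp_eval_nonzero[of z H'] H'(2) by auto
qed

lemma mp_eval_cong:
  assumes "mp_over I F" "\<And>i. i \<in> I \<Longrightarrow> x i = y i"
  shows "mp_eval x F = mp_eval y F"
proof -
  have "monval x m = monval y m" if "m \<in> pmkeys F" for m
  proof -
    have "pmkeys m \<subseteq> I" using assms(1) that by (auto simp: mp_over_def)
    then show ?thesis unfolding monval_def using assms(2) by (intro prod.cong refl) auto
  qed
  then show ?thesis unfolding mp_eval_mon by (intro sum.cong refl) simp
qed

text \<open>Division with remainder by the variable \<open>n\<close>. The last clause says that
  \<open>P1\<close> has smaller degree in it, on which the later induction runs.\<close>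

lemma mp_split_variable:
  fixes P :: "(nat, 'a::field) mpolynomial"
  assumes "mp_over {..<Suc n} P"
  shows "\<exists>P0 P1. P = P0 + sgl (sgl n 1) 1 * P1 \<and> mp_over {..<n} P0 \<and> mp_over {..<Suc n} P1 \<and>
    (\<forall>m\<in>pmkeys P1. m + sgl n 1 \<in> pmkeys P)"
proof -
  let ?A = "{m \<in> pmkeys P. lkp m n = 0}" and ?B = "{m \<in> pmkeys P. lkp m n > 0}"
  define P0 where "P0 = (\<Sum>m\<in>?A. sgl m (lkp P m))"
  define P1 where "P1 = (\<Sum>m\<in>?B. sgl (m - sgl n 1) (lkp P m))"
  have bk: "(m - sgl n 1) + sgl n 1 = m" if "lkp m n > 0" for m :: "nat \<Rightarrow>\<^sub>0 nat" 
    using diff_single_eq_iff[OF that, of "m - sgl n 1"] by simp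
  have "P = (\<Sum>m\<in>?A \<union> ?B. sgl m (lkp P m))"
    by (subst mp_expand) (intro sum.cong, auto)
  also have "\<dots> = P0 + (\<Sum>m\<in>?B. sgl m (lkp P m))"
    unfolding P0_def by (rule sum.union_disjoint) auto
  also have "(\<Sum>m\<in>?B. sgl m (lkp P m)) = sgl (sgl n 1) 1 * P1"
    unfolding P1_def sum_distrib_left mult_single
    by (intro sum.cong refl) (use bk in \<open>auto simp: add.commute\<close>)
  finally have "P = P0 + sgl (sgl n 1) 1 * P1" .
  moreover have "mp_over {..<n} P0" unfolding mp_over_def
  proof
    fix m assume "m \<in> pmkeys P0"
    then have m: "m \<in> ?A" using keys_sum[of "\<lambda>m. sgl m (lkp P m)" ?A] unfolding P0_def by (auto split: if_splits)
    then have "pmkeys m \<subseteq> {..<Suc n}" "n \<notin> pmkeys m" using assms by (auto simp: mp_over_def in_keys_iff)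
    then show "pmkeys m \<subseteq> {..<n}" by (auto simp: less_Suc_eq)
  qed
  moreover have k1: "m + sgl n 1 \<in> pmkeys P" if m: "m \<in> pmkeys P1" for m
  proof -
    obtain m' where "m' \<in> ?B" "m = m' - sgl n 1" 
      using m keys_sum[of "\<lambda>m. sgl (m - sgl n 1) (lkp P m)" ?B] unfolding P1_def by (auto split: if_splits)
    then show ?thesis using bk[of m'] by simp
  qed
  moreover have "mp_over {..<Suc n} P1" unfolding mp_over_def
  proof (intro ballI subsetI)
    fix m i assume "m \<in> pmkeys P1" "i \<in> pmkeys m"
    moreover from this have "i \<in> pmkeys (m + sgl n 1)" by (auto simp: in_keys_iff lookup_add)
    ultimately show "i \<in> {..<Suc n}" using k1 assms unfolding mp_over_def by blast
  qed
  ultimately show ?thesis by blast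
qed

text \<open>In a relation of minimal degree in the new function \<open>F\<close>, restriction to \<open>Y\<close> kills the part free of
  \<open>F\<close>; the rest is divisible by \<open>F\<close>, which cancels because \<open>Z\<close> is irreducible.\<close>

lemma alg_indep_extend:
  fixes Z :: "'a::field_char_0 poly poly set set"
  assumes ind: "alg_indep {..<n} G Y" and Y: "Y \<subseteq> acone d Z" 
    and irr: "irreducible_closed (zariski d) Z" and F: "F \<in> homogeneous_polys d" 
    and F0: "\<And>z. z \<in> Y \<Longrightarrow> mp_eval z F = 0"
    and z0: "z0 \<in> acone d Z" "mp_eval z0 F \<noteq> 0"
    and G: "\<And>i. i < n \<Longrightarrow> polyfun (coords {..d}) (G i)"
  shows "alg_indep {..<Suc n} (G(n := \<lambda>z. mp_eval z F)) (acone d Z)"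
proof -
  let ?G = "\<lambda>z i. (G(n := \<lambda>z. mp_eval z F)) i z"
  have G': "polyfun (coords {..d}) (\<lambda>z. ?G z i)" if "i < Suc n" for i
  proof (cases "i = n")
    case True
    have "mp_over {..d} F" using F homogeneous_polys_iff by blast
    then show ?thesis using True polyfun_mp_eval by simp
  qed (use that G in auto)
  have claim: "P = 0" if "mp_over {..<Suc n} P" "\<forall>m\<in>pmkeys P. lkp m n < k" "\<forall>z\<in>acone d Z. mp_eval (?G z) P = 0" for P k
    using that
  proof (induction k arbitrary: P)
    case 0
    then have "pmkeys P = {}" by auto
    then show ?case by (metis in_keys_iff lookup_zero poly_mapping_eqI empty_iff)
  next
    case (Suc k)
    obtain P0 P1 where P: "P = P0 + sgl (sgl n 1) 1 * P1" "mp_over {..<n} P0" "mp_over {..<Suc n} P1"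
      "\<forall>m\<in>pmkeys P1. m + sgl n 1 \<in> pmkeys P" using mp_split_variable[OF Suc.prems(1)] by blast
    have ev: "mp_eval (?G z) P = mp_eval (\<lambda>i. G i z) P0 + mp_eval z F * mp_eval (?G z) P1" for z
    proof -
      have "mp_eval (?G z) P0 = mp_eval (\<lambda>i. G i z) P0" by (rule mp_eval_cong[OF P(2)]) auto
      then show ?thesis by (simp add: P(1) mp_eval_add mp_eval_mult mp_eval_single monval_def)
    qed
    have "mp_eval (\<lambda>i. G i z) P0 = 0" if "z \<in> Y" for z
      using ev[of z] Suc.prems(3) Y F0[OF that] that by auto
    then have "P0 = 0" using ind P(2) unfolding alg_indep_def by blast
    then have FH: "mp_eval z F * mp_eval (?G z) P1 = 0" if "z \<in> acone d Z" for z 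
      using ev[of z] Suc.prems(3) that by simp
    have "polyfun (coords {..d}) (\<lambda>z. mp_eval (?G z) P1)"
      by (rule polyfun_compose_coords[OF polyfun_mp_eval[OF P(3)]]) (use G' in auto)
    from irreducible_cone_mult[OF irr F this FH z0] have "\<forall>z\<in>acone d Z. mp_eval (?G z) P1 = 0" by blast
    moreover have "\<forall>m\<in>pmkeys P1. lkp m n < k"
    proof
      fix m assume "m \<in> pmkeys P1"
      then have "lkp (m + sgl n 1) n < Suc k" using P(4) Suc.prems(2) by blast
      then show "lkp m n < k" by (simp add: lookup_add)
    qed
    ultimately have "P1 = 0" using Suc.IH[OF P(3)] by blast
    then show ?case using P(1) \<open>P0 = 0\<close> by simp
  qed
  show ?thesis unfolding alg_indep_def
  proof (intro allI impI)
    fix P assume P: "mp_over {..<Suc n} P \<and> (\<forall>y\<in>acone d Z. mp_eval (?G y) P = 0)"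
    have "\<forall>m\<in>pmkeys P. lkp m n < Suc (\<Sum>m\<in>pmkeys P. lkp m n)"
      by (auto simp: less_Suc_eq_le intro: member_le_sum)
    then show "P = 0" using claim P by blast
  qed
qed

text \<open>Each strict inclusion supplies a homogeneous polynomial that vanishes on the smaller set
  but not on the larger, and it extends the independent family. The step from the vertex of the cone
  to \<open>Z 0\<close> accounts for the extra function.\<close>

lemma chain_alg_indep:
  fixes Z :: "nat \<Rightarrow> 'a::field_char_0 poly poly set set"
  assumes "\<And>i. i \<le> N \<Longrightarrow> irreducible_closed (zariski d) (Z i)" "\<And>i. i < N \<Longrightarrow> Z i \<subset> Z (Suc i)"
  shows "\<exists>G. (\<forall>i<Suc N. polyfun (coords {..d}) (G i)) \<and> alg_indep {..<Suc N} G (acone d (Z N))"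
  using assms
proof (induction N)
  case 0
  then have irr: "irreducible_closed (zariski d) (Z 0)" by simp
  then obtain f where f: "f \<in> binary_forms d - {0}" "proj_class f \<in> Z 0"
    using irreducible_closed_point[OF irr] by blast
  then have "deh f \<noteq> 0" using deh_eq_0_iff by blast
  then obtain j where j: "coeff (deh f) j \<noteq> 0" by (metis leading_coeff_0_iff)
  then have jd: "j \<le> d" using degree_deh f by (meson DiffD1 le_degree le_trans)
  let ?F = "sgl (sgl j 1) (1::'a)"
  have F: "?F \<in> homogeneous_polys d" using jd by (auto simp: homogeneous_polys_iff mp_over_def mp_hom_def)
  have ev: "mp_eval z ?F = z j" for z by (simp add: mp_eval_single monval_def)
  \<comment> \<open>The chain of cones starts at the vertex, on which the empty family is
    independent: only constants are relations.\<close>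
  have ind: "alg_indep {..<0::nat} (\<lambda>_ _. 0 :: 'a) {\<lambda>_::nat. 0::'a}"
    unfolding alg_indep_def
  proof (intro allI impI)
    fix P :: "(nat, 'a) mpolynomial"
    assume P: "mp_over {..<0} P \<and> (\<forall>y\<in>{\<lambda>_::nat. 0::'a}. mp_eval (\<lambda>i. (\<lambda>_ _. 0 :: 'a) i y) P = 0)"
    then have "pmkeys P \<subseteq> {0}" by (auto simp: mp_over_def)
    then have "mp_eval (\<lambda>i. 0) P = lkp P 0" by (subst mp_eval_superset[of "{0}"]) (auto simp: monval_def)
    then have "lkp P 0 = 0" using P by simp
    then have "pmkeys P = {}" using \<open>pmkeys P \<subseteq> {0}\<close> in_keys_iff[of 0 P] by blast
    then show "P = 0" by simp
  qed
  have "alg_indep {..<Suc 0} ((\<lambda>_ _. 0)(0 := \<lambda>z. mp_eval z ?F)) (acone d (Z 0))"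
  proof (rule alg_indep_extend[OF ind _ irr F, where ?z0.0="form_coord d f"])
    show "{\<lambda>_. 0} \<subseteq> acone d (Z 0)" using zero_in_cone by blast
    show "form_coord d f \<in> acone d (Z 0)" using f unfolding acone_def by blast
    show "mp_eval (form_coord d f) ?F \<noteq> 0" unfolding ev using j f by (simp add: form_coord_deh)
  qed (use ev in auto)
  moreover have "polyfun (coords {..d}) (((\<lambda>_ _. 0)(0 := \<lambda>z. mp_eval z ?F)) i)" if "i < Suc 0" for i
  proof -
    have "mp_over {..d} ?F" using F homogeneous_polys_iff by blast
    then show ?thesis using that polyfun_mp_eval by simp
  qed
  ultimately show ?case by blast
next
  case (Suc N)
  then obtain G where G: "\<forall>i<Suc N. polyfun (coords {..d}) (G i)" "alg_indep {..<Suc N} G (acone d (Z N))"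
    by (meson le_SucI less_SucI)
  have irr: "irreducible_closed (zariski d) (Z (Suc N))" "irreducible_closed (zariski d) (Z N)" using Suc.prems by auto
  have ss: "Z N \<subset> Z (Suc N)" using Suc.prems(2) by simp
  then obtain c where c: "c \<in> Z (Suc N)" "c \<notin> Z N" by blast
  then obtain f where f: "f \<in> binary_forms d - {0}" "c = proj_class f" using irreducible_closed_rep[OF irr(1)] by blast
  have "closedin (zariski d) (Z N)" using irr(2) unfolding irreducible_closed_def by blast
  then have op: "openin (zariski d) (topspace (zariski d) - Z N)" by blast
  have "proj_class f \<in> topspace (zariski d) - Z N" using f c(2) topspace_zariski by blast
  from openin_zariskiD[OF op f(1) this] obtain F where F: "F \<in> homogeneous_polys d" "mp_eval (form_coord d f) F \<noteq> 0"
    "\<forall>f'\<in>binary_forms d - {0}. mp_eval (form_coord d f') F \<noteq> 0 \<longrightarrow> proj_class f' \<in> topspace (zariski d) - Z N" by blast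
  obtain k where k: "mp_hom k F" using F(1) homogeneous_polys_iff by blast
  have F0: "mp_eval z F = 0" if z: "z \<in> acone d (Z N)" for z
  proof -
    obtain g where g: "z = form_coord d g" "g \<in> binary_forms d" "g = 0 \<or> proj_class g \<in> Z N" using z unfolding acone_def by blast
    obtain f1 where f1: "f1 \<in> binary_forms d - {0}" "proj_class f1 \<in> Z N"
      using irreducible_closed_point[OF irr(2)] by blast
    show ?thesis
    proof (cases "g = 0")
      case True
      then have "mp_eval z F = 0 ^ k * mp_eval (form_coord d f1) F" using mp_hom_at_zero[OF k] g(1) by simp
      moreover have "mp_eval (form_coord d f1) F = 0" using F(3) f1 by blast
      ultimately show ?thesis by simp
    next
      case False
      then show ?thesis using g F(3) by blast
    qed
  qed
  have "form_coord d f \<in> acone d (Z (Suc N))" using f c unfolding acone_def by blast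
  from alg_indep_extend[OF G(2) cone_mono irr(1) F(1) F0 this F(2)] G(1) ss
  have "alg_indep {..<Suc (Suc N)} (G(Suc N := \<lambda>z. mp_eval z F)) (acone d (Z (Suc N)))" by blast
  moreover have "polyfun (coords {..d}) ((G(Suc N := \<lambda>z. mp_eval z F)) i)" if "i < Suc (Suc N)" for i
  proof (cases "i = Suc N")
    case True
    have "mp_over {..d} F" using F(1) homogeneous_polys_iff by blast
    then show ?thesis using True polyfun_mp_eval by simp
  qed (use that G(1) in auto)
  ultimately show ?case by blast
qed

lemma chain_in_locus_length:
  fixes Z :: "nat \<Rightarrow> 'a::field_char_0 poly poly set set"
  assumes "\<And>i. i \<le> N \<Longrightarrow> irreducible_closed (zariski (\<Sum>i<M. e i)) (Z i)" "\<And>i. i < N \<Longrightarrow> Z i \<subset> Z (Suc i)"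
    and "Z N \<subseteq> locus M e"
  shows "N \<le> M"
proof -
  let ?d = "\<Sum>i<M. e i"
  obtain G where G: "\<forall>i<Suc N. polyfun (coords {..?d}) (G i)" "alg_indep {..<Suc N} G (acone ?d (Z N))"
    using chain_alg_indep[where Z=Z and N=N, OF assms(1) assms(2)] by blast
  have "alg_indep {..<Suc N} G (acone ?d (locus M e))" using alg_indep_mono[OF G(2) cone_mono[OF assms(3)]] .
  then have "card {..<Suc N} \<le> M + 1"
  proof (rule alg_indep_cone_locus[rotated 2])
    fix i assume "i \<in> {..<Suc N}"
    then have "polyfun (coords {..?d}) (G i)" using G(1) by simp
    then show "polyfun (coords UNIV) (G i)" by (rule polyfun_mono) (auto simp: coords_def)
  qed simp
  then show ?thesis by simp
qed

section \<open>General parameters and a maximal chain of irreducible sets\<close>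

lemma lprod_nonzero_imp_pairs:
  assumes "\<And>i. i < M \<Longrightarrow> e i \<ge> 1" "lprod M e x \<noteq> 0"
  shows "nonzero_pairs M x"
proof (rule ccontr)
  assume "\<not> nonzero_pairs M x"
  then obtain i where i: "i < M" "x (2*i) = 0" "x (2*i+1) = 0" by (auto simp: nonzero_pairs_def)
  then have "[:x (2*i), x (2*i+1):] ^ e i = 0" using assms(1)[of i] by (simp add: power_0_left)
  then have "lprod M e x = 0" unfolding lprod_def using i(1) by auto
  then show False using assms(2) by simp
qed

text \<open>All pairs are nonzero as soon as some coefficient of the product of the linear forms is,
  and that coefficient is a polynomial in \<open>t\<close>.\<close>

lemma generic_nonzero_pairs:
  fixes x y :: "nat \<Rightarrow> 'a::field_char_0"
  assumes "nonzero_pairs M x"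
  shows "\<forall>\<^sub>F t in cofinite. nonzero_pairs M (lineseg x y t)"
proof -
  have "lprod M (\<lambda>_. 1) x \<noteq> 0" by (rule lprod_nonzero[OF assms])
  then obtain j where "coeff (lprod M (\<lambda>_. 1) (lineseg x y 0)) j \<noteq> 0" by (metis leading_coeff_0_iff lineseg_simps(1))
  moreover have "curvefun (\<lambda>t. coeff (lprod M (\<lambda>_. 1) (lineseg x y t)) j)"
    by (rule polyfun_lprod) (auto simp: lineseg_def intro!: polyfun_intros)
  ultimately have "\<forall>\<^sub>F t in cofinite. coeff (lprod M (\<lambda>_. 1) (lineseg x y t)) j \<noteq> 0"
    by (rule curvefun_generic[where ?t0.0=0, rotated])
  then show ?thesis
  proof eventually_elim
    case (elim t)
    then have "lprod M (\<lambda>_. 1) (lineseg x y t) \<noteq> 0" by auto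
    then show ?case by (rule lprod_nonzero_imp_pairs[rotated]) simp
  qed
qed

lemma curvefun_lprod_lineseg: "curvefun (\<lambda>t. coeff (lprod M e (lineseg x y t)) j)"
  by (rule polyfun_lprod) (auto simp: lineseg_def intro!: polyfun_intros)

lemma generic_in_open:
  fixes x y :: "nat \<Rightarrow> 'a::field_char_0" and M :: nat and e :: "nat \<Rightarrow> nat"
  defines "d \<equiv> (\<Sum>i<M. e i)"
  assumes "openin (zariski d) T" "nonzero_pairs M (lineseg x y t0)" "proj_class (hmg d (lprod M e (lineseg x y t0))) \<in> T"
    "\<forall>\<^sub>F t in cofinite. nonzero_pairs M (lineseg x y t)"
  shows "\<forall>\<^sub>F t in cofinite. proj_class (hmg d (lprod M e (lineseg x y t))) \<in> T"
proof -
  have dp: "degree (lprod M e z) \<le> d" for z :: "nat \<Rightarrow> 'a" unfolding d_def by (rule degree_lprod)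
  have ne: "hmg d (lprod M e z) \<in> binary_forms d - {0}" if "nonzero_pairs M z" for z :: "nat \<Rightarrow> 'a"
    using lprod_nonzero[OF that] hmg_eq_0_iff[OF dp] by auto
  obtain F where F: "F \<in> homogeneous_polys d" "mp_eval (form_coord d (hmg d (lprod M e (lineseg x y t0)))) F \<noteq> 0"
    "\<forall>f'\<in>binary_forms d - {0}. mp_eval (form_coord d f') F \<noteq> 0 \<longrightarrow> proj_class f' \<in> T"
    using openin_zariskiD[OF assms(2) ne[OF assms(3)] assms(4)] by blast
  have "mp_over {..d} F" using F(1) homogeneous_polys_iff by blast
  then have "curvefun (\<lambda>t. mp_eval (form_coord d (hmg d (lprod M e (lineseg x y t)))) F)"
    unfolding form_coord_hmg[OF dp] by (rule mp_eval_curve) (rule curvefun_lprod_lineseg)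
  from curvefun_generic[of _ t0, OF this F(2)] assms(5) show ?thesis
    by eventually_elim (use F(3) ne in blast)
qed

text \<open>The linear forms from index \<open>i\<close> on are frozen at \<open>v\<close>, a
  condition preserved by lines of parameters. A line between a point outside \<open>B\<close> and
  one outside \<open>C\<close> would have a general point outside both.\<close>

lemma irreducible_closure_param:
  fixes M i :: nat and e :: "nat \<Rightarrow> nat"
  defines "d \<equiv> (\<Sum>i<M. e i)"
  defines "A \<equiv> {proj_class (hmg d (lprod M e x)) | x :: nat \<Rightarrow> 'a::field_char_0. nonzero_pairs M x \<and> 
    (\<forall>j<M. i \<le> j \<longrightarrow> x (2*j) = 0 \<and> x (2*j+1) = 1)}"
  shows "irreducible_closed (zariski d) (zariski d closure_of A)"
proof -
  have sub: "A \<subseteq> topspace (zariski d)"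
    using locus_subset_topspace[of M e] unfolding A_def locus_def topspace_zariski d_def by blast
  have Acl: "A \<subseteq> zariski d closure_of A" by (rule closure_of_subset[OF sub])
  have "proj_class (hmg d (lprod M e (\<lambda>k. if even k then 0 else 1))) \<in> A"
    unfolding A_def by (intro CollectI exI[of _ "\<lambda>k. if even k then 0 else 1"]) (auto simp: nonzero_pairs_def)
  then have ne: "zariski d closure_of A \<noteq> {}" using Acl by blast
  have "zariski d closure_of A \<subseteq> B \<or> zariski d closure_of A \<subseteq> C"
    if cl: "closedin (zariski d) B" "closedin (zariski d) C" and BC: "zariski d closure_of A \<subseteq> B \<union> C" for B C
  proof (rule ccontr)
    assume "\<not> ?thesis"
    then have "\<not> A \<subseteq> B" "\<not> A \<subseteq> C" using closure_of_minimal cl by blast+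
    then obtain x y where x: "nonzero_pairs M x" "\<forall>j<M. i \<le> j \<longrightarrow> x (2*j) = 0 \<and> x (2*j+1) = 1" 
        "proj_class (hmg d (lprod M e x)) \<notin> B"
      and y: "nonzero_pairs M y" "\<forall>j<M. i \<le> j \<longrightarrow> y (2*j) = 0 \<and> y (2*j+1) = 1" 
        "proj_class (hmg d (lprod M e y)) \<notin> C"
      unfolding A_def by blast
    have xA: "proj_class (hmg d (lprod M e x)) \<in> topspace (zariski d) - B" 
      using sub x unfolding A_def by blast
    have yA: "proj_class (hmg d (lprod M e y)) \<in> topspace (zariski d) - C" 
      using sub y unfolding A_def by blast
    have nz: "\<forall>\<^sub>F t in cofinite. nonzero_pairs M (lineseg x y t)" by (rule generic_nonzero_pairs[OF x(1)])
    have oB: "openin (zariski d) (topspace (zariski d) - B)" and oC: "openin (zariski d) (topspace (zariski d) - C)" 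
      using cl by auto
    have 1: "\<forall>\<^sub>F t in cofinite. proj_class (hmg d (lprod M e (lineseg x y t))) \<in> topspace (zariski d) - B"
      unfolding d_def by (rule generic_in_open[where ?t0.0=0]) (use oB xA x nz in \<open>auto simp: d_def\<close>)
    have 2: "\<forall>\<^sub>F t in cofinite. proj_class (hmg d (lprod M e (lineseg x y t))) \<in> topspace (zariski d) - C"
      unfolding d_def by (rule generic_in_open[where ?t0.0=1]) (use oC yA y nz in \<open>auto simp: d_def\<close>)
    from nz 1 2 have "\<forall>\<^sub>F t::'a in cofinite. False"
    proof eventually_elim
      case (elim t)
      have "\<forall>j<M. i \<le> j \<longrightarrow> lineseg x y t (2*j) = 0 \<and> lineseg x y t (2*j+1) = 1"
        using x(2) y(2) by (auto simp: lineseg_def)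
      then have "proj_class (hmg d (lprod M e (lineseg x y t))) \<in> A" unfolding A_def using elim(1) by blast
      then show False using Acl BC elim(2,3) by blast
    qed
    then show False using cofinite_ex by blast
  qed
  then show ?thesis unfolding irreducible_closed_def using ne by (auto simp: closedin_closure_of)
qed

text \<open>The upper bound is \<open>chain_in_locus_length\<close>. For the lower one, the linear
  forms are released one after another from the value \<open>v\<close>, which gives a chain with
  \<open>M\<close> strict steps.\<close>

lemma krull_dim_locus:
  fixes M :: nat and e :: "nat \<Rightarrow> nat"
  defines "d \<equiv> (\<Sum>i<M. e i)"
  assumes e: "\<And>i. i < M \<Longrightarrow> e i \<ge> 1"
  shows "krull_dim (zariski d) (locus M e :: 'a::{alg_closed_field, field_char_0} poly poly set set) = enat M"
proof (rule antisym)
  show "krull_dim (zariski d) (locus M e :: 'a poly poly set set) \<le> enat M"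
    unfolding krull_dim_def
  proof (rule Sup_least)
    fix n assume "n \<in> {enat n | n. \<exists>Z :: nat \<Rightarrow> 'a poly poly set set.
       (\<forall>i\<le>n. irreducible_closed (zariski d) (Z i) \<and> Z i \<subseteq> locus M e) \<and> (\<forall>i<n. Z i \<subset> Z (Suc i))}"
    then obtain N Z where "n = enat N" "\<forall>i\<le>N. irreducible_closed (zariski d) (Z i) \<and> Z i \<subseteq> (locus M e :: 'a poly poly set set)"
      "\<forall>i<N. Z i \<subset> Z (Suc i)" by blast
    then show "n \<le> enat M" using chain_in_locus_length[where N=N and M=M and e=e and Z=Z] unfolding d_def by auto
  qed
next
  define A where "A i = {proj_class (hmg d (lprod M e x)) | x :: nat \<Rightarrow> 'a. nonzero_pairs M x \<and> 
    (\<forall>j<M. i \<le> j \<longrightarrow> x (2*j) = 0 \<and> x (2*j+1) = 1)}" for i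
  define Z where "Z i = zariski d closure_of A i" for i
  have irr: "irreducible_closed (zariski d) (Z i)" for i
    unfolding Z_def A_def d_def by (rule irreducible_closure_param)
  have AX: "A i \<subseteq> locus M e" for i unfolding A_def locus_def d_def by blast
  have top: "A i \<subseteq> topspace (zariski d)" for i
    using AX[of i] locus_subset_topspace[of M e] topspace_zariski unfolding d_def by blast
  have ZX: "Z i \<subseteq> locus M e" for i
    unfolding Z_def using closure_of_minimal[OF AX] closedin_locus unfolding d_def by blast
  have strict: "Z i \<subset> Z (Suc i)" if i: "i < M" for i
  proof
    show "Z i \<subseteq> Z (Suc i)" unfolding Z_def by (rule closure_of_mono) (auto simp: A_def)
    \<comment> \<open>Members of \<open>A i\<close> are divisible by \<open>v\<close> to the power
      \<open>e i + b\<close>, so their coefficient at \<open>b\<close> vanishes; on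
      \<open>A (Suc i)\<close> it need not.\<close>
    define b where "b = (\<Sum>j\<in>{Suc i..<M}. e j)"
    have bd: "b \<le> d" unfolding b_def d_def by (rule sum_mono2) auto
    let ?F = "sgl (sgl b 1) (1::'a)"
    have F: "?F \<in> homogeneous_polys d" using bd by (auto simp: homogeneous_polys_iff mp_over_def mp_hom_def)
    have ev: "mp_eval z ?F = z b" for z by (simp add: mp_eval_single monval_def)
    have dp: "degree (lprod M e z) \<le> d" for z :: "nat \<Rightarrow> 'a" unfolding d_def by (rule degree_lprod)
    have ne: "hmg d (lprod M e z) \<in> binary_forms d - {0}" if "nonzero_pairs M z" for z :: "nat \<Rightarrow> 'a"
      using lprod_nonzero[OF that] hmg_eq_0_iff[OF dp] by auto
    have vpart: "lprod M e x = (\<Prod>j<k. [:x (2*j), x (2*j+1):] ^ e j) * monom 1 (\<Sum>j\<in>{k..<M}. e j)" 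
      if "\<forall>j<M. k \<le> j \<longrightarrow> x (2*j) = 0 \<and> x (2*j+1) = 1" "k \<le> M" for k and x :: "nat \<Rightarrow> 'a"
    proof -
      have "lprod M e x = (\<Prod>j\<in>{..<k} \<union> {k..<M}. [:x (2*j), x (2*j+1):] ^ e j)"
        unfolding lprod_def using that(2) by (intro prod.cong) auto
      also have "\<dots> = (\<Prod>j<k. [:x (2*j), x (2*j+1):] ^ e j) * (\<Prod>j\<in>{k..<M}. [:x (2*j), x (2*j+1):] ^ e j)"
        by (rule prod.union_disjoint) auto
      also have "(\<Prod>j\<in>{k..<M}. [:x (2*j), x (2*j+1):] ^ e j) = (\<Prod>j\<in>{k..<M}. [:0, 1:] ^ e j)"
        using that(1) by (intro prod.cong refl) simp
      also have "\<dots> = [:0, 1:] ^ (\<Sum>j\<in>{k..<M}. e j)" by (rule power_sum[symmetric])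
      also have "\<dots> = monom 1 (\<Sum>j\<in>{k..<M}. e j)" by (simp add: monom_altdef)
      finally show ?thesis .
    qed
    have "A i \<subseteq> zvanish d ?F"
    proof
      fix c assume "c \<in> A i"
      then obtain x where x: "nonzero_pairs M x" "\<forall>j<M. i \<le> j \<longrightarrow> x (2*j) = 0 \<and> x (2*j+1) = 1" 
        "c = proj_class (hmg d (lprod M e x))" unfolding A_def by blast
      have "{i..<M} = insert i {Suc i..<M}" using i by auto
      then have "(\<Sum>j\<in>{i..<M}. e j) = e i + b" by (simp add: b_def)
      then have "coeff (lprod M e x) b = 0" unfolding vpart[OF x(2) less_imp_le[OF i]]
        using e[OF i] by (simp add: mult.commute[of _ "monom 1 _"] coeff_monom_mult)
      then show "c \<in> zvanish d ?F" unfolding x(3) zvanish_iff[OF F ne[OF x(1)]] ev form_coord_hmg[OF dp] .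
    qed
    then have sub: "Z i \<subseteq> zvanish d ?F" unfolding Z_def by (rule closure_of_minimal) (rule closedin_zvanish[OF F])
    \<comment> \<open>The linear forms up to index \<open>i\<close> are \<open>u\<close>, the later
      ones \<open>v\<close>; their product is a monomial with \<open>v\<close>-exponent exactly
      \<open>b\<close>.\<close>
    define x where "x k = (if (k div 2 \<le> i) = even k then 1 else 0 :: 'a)" for k
    have xx: "x (2*j) = (if j \<le> i then 1 else 0)" "x (2*j+1) = (if j \<le> i then 0 else 1)" 
      "x (Suc (2*j)) = (if j \<le> i then 0 else 1)" for j by (auto simp: x_def)
    have nzx: "nonzero_pairs M x" by (auto simp: nonzero_pairs_def xx)
    have "lprod M e x = (\<Prod>j<Suc i. [:x (2*j), x (2*j+1):] ^ e j) * monom 1 b"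
      unfolding b_def by (rule vpart) (use i in \<open>auto simp: xx\<close>)
    also have "(\<Prod>j<Suc i. [:x (2*j), x (2*j+1):] ^ e j) = 1"
      unfolding xx by (intro prod.neutral) (auto simp flip: one_pCons)
    finally have "proj_class (hmg d (lprod M e x)) \<notin> zvanish d ?F"
      unfolding zvanish_iff[OF F ne[OF nzx]] ev form_coord_hmg[OF dp] by simp
    moreover have "proj_class (hmg d (lprod M e x)) \<in> A (Suc i)"
      unfolding A_def using nzx by (intro CollectI exI[of _ x]) (auto simp: xx)
    then have "proj_class (hmg d (lprod M e x)) \<in> Z (Suc i)" unfolding Z_def using closure_of_subset[OF top] by blast
    ultimately show "Z i \<noteq> Z (Suc i)" using sub by blast
  qed
  show "enat M \<le> krull_dim (zariski d) (locus M e :: 'a poly poly set set)"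
    unfolding krull_dim_def using irr ZX strict by (intro Sup_upper) blast
qed

section \<open>Tangent spaces of the loci\<close>

lemma tangent_space_subspace:
  "h \<in> tangent_space d X f \<Longrightarrow> h' \<in> tangent_space d X f \<Longrightarrow> h + h' \<in> tangent_space d X f"
  "h \<in> tangent_space d X f \<Longrightarrow> form_scale c h \<in> tangent_space d X f"
  "0 \<in> tangent_space d X f"
proof -
  show "h \<in> tangent_space d X f \<Longrightarrow> h' \<in> tangent_space d X f \<Longrightarrow> h + h' \<in> tangent_space d X f"
    unfolding tangent_space_def
    by (auto simp: form_coord_def distrib_left sum.distrib) (auto simp: binary_forms_def, (metis add_0)+)
  show "h \<in> tangent_space d X f \<Longrightarrow> form_scale c h \<in> tangent_space d X f"
    unfolding tangent_space_def 
    by (auto simp: form_coord_scale form_scale_binary mult.left_commute[of _ c] sum_distrib_left[symmetric])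
  show "0 \<in> tangent_space d X f"
    unfolding tangent_space_def by (auto simp: form_coord_def binary_forms_zero)
qed

lemma vanishing_polysD:
  assumes "F \<in> vanishing_polys d X"
  shows "mp_over {..d} F" "\<exists>k. mp_hom k F"
proof -
  have "F \<in> homogeneous_polys d" using assms unfolding vanishing_polys_def by simp
  then show "mp_over {..d} F" "\<exists>k. mp_hom k F" by (simp_all add: homogeneous_polys_iff)
qed

lemma tangent_space_scale_point:
  assumes "c \<noteq> 0"
  shows "tangent_space d X (form_scale c f) = tangent_space d X f"
proof -
  have "(\<Sum>i\<le>d. mp_eval (form_coord d (form_scale c f)) (mp_partial i F) * form_coord d h i) = 0 \<longleftrightarrow>
    (\<Sum>i\<le>d. mp_eval (form_coord d f) (mp_partial i F) * form_coord d h i) = 0" if F: "F \<in> vanishing_polys d X" for F h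
  proof -
    obtain k where k: "mp_hom k F" using vanishing_polysD(2)[OF F] by blast
    have "(\<Sum>i\<le>d. mp_eval (form_coord d (form_scale c f)) (mp_partial i F) * form_coord d h i) = 
      c ^ (k - 1) * (\<Sum>i\<le>d. mp_eval (form_coord d f) (mp_partial i F) * form_coord d h i)"
      unfolding form_coord_scale mp_hom_scale[OF mp_partial_hom[OF k]] by (simp add: sum_distrib_left mult.assoc)
    then show ?thesis using assms by simp
  qed
  then show ?thesis unfolding tangent_space_def by blast
qed

text \<open>Parameters with a zero pair are reached along a line from the all-ones parameter, so the
  curves used for tangent vectors may pass through any parameter.\<close>

lemma vanishing_polys_lprod:
  fixes x :: "nat \<Rightarrow> 'a::field_char_0"
  assumes "F \<in> vanishing_polys (\<Sum>i<M. e i) (locus M e)"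
  shows "mp_eval (coeff (lprod M e x)) F = 0"
proof -
  let ?d = "\<Sum>i<M. e i"
  have F: "mp_over {..?d} F" by (rule vanishing_polysD(1)[OF assms])
  have nz: "mp_eval (coeff (lprod M e y)) F = 0" if "nonzero_pairs M y" for y
  proof -
    have "hmg ?d (lprod M e y) \<in> binary_forms ?d - {0}" 
      using lprod_nonzero[OF that, of e] hmg_eq_0_iff[OF degree_lprod[of M e y]] by auto
    moreover have "proj_class (hmg ?d (lprod M e y)) \<in> locus M e" unfolding locus_def using that by blast
    ultimately have "mp_eval (form_coord ?d (hmg ?d (lprod M e y))) F = 0" using assms unfolding vanishing_polys_def by blast
    then show ?thesis by (simp add: form_coord_hmg[OF degree_lprod])
  qed
  define w where "w k = (1::'a)" for k :: nat
  have w: "nonzero_pairs M w" by (simp add: nonzero_pairs_def w_def)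
  have "curvefun (\<lambda>t. mp_eval (coeff (lprod M e (lineseg w x t))) F)"
    by (rule mp_eval_curve[OF F]) (rule curvefun_lprod_lineseg)
  moreover have "\<forall>\<^sub>F t in cofinite. mp_eval (coeff (lprod M e (lineseg w x t))) F = 0"
    using generic_nonzero_pairs[OF w, of x] by eventually_elim (rule nz)
  ultimately have "mp_eval (coeff (lprod M e (lineseg w x 1))) F = 0"
    by (rule curvefun_eq_0)
  then show ?thesis by simp
qed

text \<open>A first-order Taylor expansion whose remainder depends polynomially on \<open>t\<close>;
  only the linear term survives differentiation at 0.\<close>

lemma power_perturbation:
  fixes l s :: "'a::field poly"
  shows "\<exists>C. (\<forall>k. curvefun (\<lambda>t. coeff (C t) k)) \<and> 
    (\<forall>t. (l + smult t s) ^ n = l ^ n + smult t (of_nat n * l ^ (n - 1) * s) + smult (t ^ 2) (C t))"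
proof (induction n)
  case 0
  show ?case by (intro exI[of _ "\<lambda>_. 0"]) (auto intro: polyfun.const)
next
  case (Suc n)
  then obtain C where C: "\<forall>k. curvefun (\<lambda>t. coeff (C t) k)"
    "\<forall>t. (l + smult t s) ^ n = l ^ n + smult t (of_nat n * l ^ (n - 1) * s) + smult (t ^ 2) (C t)" by blast
  define C' where "C' t = l * C t + of_nat n * l ^ (n - 1) * s * s + smult t (s * C t)" for t
  have "curvefun (\<lambda>t. coeff (C' t) k)" for k
    unfolding C'_def coeff_add coeff_smult
    by (intro polyfun.add polyfun.mult polyfun_coeff_mult polyfun.const polyfun_id) (use C(1) in auto)
  moreover have "(l + smult t s) ^ Suc n = l ^ Suc n + smult t (of_nat (Suc n) * l ^ (Suc n - 1) * s) + smult (t ^ 2) (C' t)" for t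
  proof -
    have n: "of_nat n * l ^ n * s = l * (of_nat n * l ^ (n - 1) * s)" by (cases n) (simp_all add: mult_ac)
    have "(l + smult t s) ^ Suc n = (l + smult t s) * (l ^ n + smult t (of_nat n * l ^ (n - 1) * s) + smult (t ^ 2) (C t))"
      using C(2) by simp
    also have "\<dots> = l ^ Suc n + smult t (l * (of_nat n * l ^ (n - 1) * s) + l ^ n * s) + smult (t ^ 2) (C' t)"
      by (simp add: C'_def algebra_simps smult_add_right power2_eq_square)
    also have "l * (of_nat n * l ^ (n - 1) * s) + l ^ n * s = of_nat (Suc n) * l ^ (Suc n - 1) * s"
      unfolding n[symmetric] by (simp add: algebra_simps)
    finally show ?thesis .
  qed
  ultimately show ?case by blast
qed

text \<open>Moving the \<open>i\<close>-th linear form in the direction \<open>s\<close> has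
  velocity \<open>e i\<close> times the displayed product, and \<open>e i\<close> is invertible in
  characteristic zero.\<close>

lemma tangent_direction:
  fixes x :: "nat \<Rightarrow> 'a::field_char_0"
  assumes e: "\<And>i. i < M \<Longrightarrow> e i \<ge> 1" and i: "i < M" and s: "degree s \<le> 1"
    and F: "F \<in> vanishing_polys (\<Sum>i<M. e i) (locus M e)"
  shows "(\<Sum>k\<le>(\<Sum>i<M. e i). mp_eval (coeff (lprod M e x)) (mp_partial k F) * 
    coeff (lprod M (\<lambda>i. e i - 1) x * (s * (\<Prod>j\<in>{..<M}-{i}. [:x (2*j), x (2*j+1):]))) k) = 0"
proof -
  let ?d = "\<Sum>i<M. e i"
  let ?l = "\<lambda>j. [:x (2*j), x (2*j+1):]"
  define R where "R = (\<Prod>j\<in>{..<M}-{i}. ?l j ^ e j)"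
  obtain C where C: "\<forall>k. curvefun (\<lambda>t. coeff (C t) k)" 
    "\<forall>t. (?l i + smult t s) ^ e i = ?l i ^ e i + smult t (of_nat (e i) * ?l i ^ (e i - 1) * s) + smult (t ^ 2) (C t)"
    using power_perturbation by blast
  define y where "y t = x(2*i := x (2*i) + t * coeff s 0, 2*i+1 := x (2*i+1) + t * coeff s 1)" for t
  have s2: "s = [:coeff s 0, coeff s 1:]"
  proof (rule poly_eqI)
    fix k show "coeff s k = coeff [:coeff s 0, coeff s 1:] k"
      using s by (cases k; cases "k - 1") (auto simp: coeff_pCons coeff_eq_0 split: nat.splits)
  qed
  have ly: "lprod M e (y t) = (?l i + smult t s) ^ e i * R" for t
  proof -
    have "lprod M e (y t) = [:y t (2*i), y t (2*i+1):] ^ e i * (\<Prod>j\<in>{..<M}-{i}. [:y t (2*j), y t (2*j+1):] ^ e j)"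
      unfolding lprod_def by (rule prod.remove) (use i in auto)
    also have "(\<Prod>j\<in>{..<M}-{i}. [:y t (2*j), y t (2*j+1):] ^ e j) = R" unfolding R_def
    proof (intro prod.cong refl)
      fix j assume "j \<in> {..<M} - {i}"
      then have "2*j \<noteq> 2*i" "2*j \<noteq> 2*i+1" "2*j+1 \<noteq> 2*i" "2*j+1 \<noteq> 2*i+1" by auto
      then show "[:y t (2*j), y t (2*j+1):] ^ e j = ?l j ^ e j" by (simp add: y_def)
    qed
    also have "[:y t (2*i), y t (2*i+1):] = ?l i + smult t s" by (subst s2) (simp add: y_def)
    finally show ?thesis .
  qed
  define D where "D = of_nat (e i) * ?l i ^ (e i - 1) * s * R"
  have l0: "lprod M e x = ?l i ^ e i * R" unfolding lprod_def R_def by (rule prod.remove) (use i in auto)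
  have expand: "coeff (lprod M e (y t)) k = coeff (lprod M e x) k + t * coeff D k + t ^ 2 * coeff (C t * R) k" for t k
    unfolding ly C(2)[rule_format] l0 D_def by (simp add: distrib_right)
  have "curvefun (\<lambda>t. coeff (C t * R) k)" for k
    by (rule polyfun_coeff_mult) (use C(1) in \<open>auto intro: polyfun.const\<close>)
  then have "\<exists>p. \<forall>t. coeff (C t * R) k = poly p t" for k using curvefun_poly by metis
  then obtain c where c: "\<And>k t. coeff (C t * R) k = poly (c k) t" by metis
  define \<gamma> where "\<gamma> k = [:coeff (lprod M e x) k, coeff D k:] + monom 1 2 * c k" for k
  have g: "poly (\<gamma> k) t = coeff (lprod M e (y t)) k" for k t
    unfolding expand c by (simp add: \<gamma>_def poly_monom)
  have g0: "poly (\<gamma> k) 0 = coeff (lprod M e x) k" "poly (pderiv (\<gamma> k)) 0 = coeff D k" for k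
    by (simp_all add: \<gamma>_def pderiv_add pderiv_mult pderiv_pCons pderiv_monom poly_monom)
  have over: "mp_over {..?d} F" by (rule vanishing_polysD(1)[OF F])
  have "mp_eval (\<lambda>k. poly (\<gamma> k) t) F = 0" for t
    unfolding g by (rule vanishing_polys_lprod[OF F])
  from curve_derivative_vanishes[OF _ over this, of 0]
  have "(\<Sum>k\<le>?d. mp_eval (coeff (lprod M e x)) (mp_partial k F) * coeff D k) = 0" unfolding g0 by simp
  also have "D = smult (of_nat (e i)) (lprod M (\<lambda>i. e i - 1) x * (s * (\<Prod>j\<in>{..<M}-{i}. ?l j)))"
  proof -
    have "lprod M (\<lambda>i. e i - 1) x = ?l i ^ (e i - 1) * (\<Prod>j\<in>{..<M}-{i}. ?l j ^ (e j - 1))"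
      unfolding lprod_def by (rule prod.remove) (use i in auto)
    moreover have "R = (\<Prod>j\<in>{..<M}-{i}. ?l j ^ (e j - 1)) * (\<Prod>j\<in>{..<M}-{i}. ?l j)"
      unfolding R_def prod.distrib[symmetric]
    proof (intro prod.cong refl)
      fix j assume "j \<in> {..<M} - {i}"
      then have "e j = Suc (e j - 1)" using e[of j] by simp
      then show "?l j ^ e j = ?l j ^ (e j - 1) * ?l j" by (metis power_Suc2)
    qed
    ultimately show ?thesis unfolding D_def of_nat_poly by (simp add: mult_ac)
  qed
  finally have "of_nat (e i) * (\<Sum>k\<le>?d. mp_eval (coeff (lprod M e x)) (mp_partial k F) * 
    coeff (lprod M (\<lambda>i. e i - 1) x * (s * (\<Prod>j\<in>{..<M}-{i}. ?l j))) k) = 0"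
    by (simp add: sum_distrib_left mult_ac)
  moreover have "of_nat (e i) \<noteq> (0::'a)" using e[OF i] by simp
  ultimately show ?thesis by simp
qed

text \<open>Nonzero exactly when all roots are finite (first factor) and pairwise distinct (second
  factor).\<close>

definition distinct_roots :: "nat \<Rightarrow> (nat \<Rightarrow> 'a) \<Rightarrow> 'a::comm_ring_1" where
  "distinct_roots M x = (\<Prod>i<M. x (2*i+1)) * (\<Prod>i<M. \<Prod>j<i. x (2*i) * x (2*j+1) - x (2*j) * x (2*i+1))"

lemma polyfun_distinct_roots: "polyfun (coords UNIV) (distinct_roots M)"
  unfolding distinct_roots_def[abs_def] by (intro polyfun_intros polyfun_coord) auto

text \<open>The witness consists of the linear forms \<open>i u + v\<close>, pairwise
  nonproportional in characteristic zero.\<close>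

lemma distinct_roots_nonzero: 
  "distinct_roots M (\<lambda>k. if even k then of_nat (k div 2) else (1::'a::field_char_0)) \<noteq> 0"
  unfolding distinct_roots_def by (auto simp: prod_zero_iff)

text \<open>By interpolation at the roots, the products omitting one factor span the polynomials of
  degree below \<open>M\<close>; one linear cofactor takes care of degree \<open>M\<close>.\<close>

lemma lagrange_decomposition:
  fixes x :: "nat \<Rightarrow> 'a::field"
  assumes good: "distinct_roots M x \<noteq> 0" and q: "degree q \<le> M" and M: "M \<ge> 1"
  shows "\<exists>s. (\<forall>i<M. degree (s i) \<le> 1) \<and> q = (\<Sum>i<M. s i * (\<Prod>j\<in>{..<M}-{i}. [:x (2*j), x (2*j+1):]))"
proof -
  let ?l = "\<lambda>j. [:x (2*j), x (2*j+1):]"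
  define P where "P i = (\<Prod>j\<in>{..<M}-{i}. ?l j)" for i
  define \<rho> where "\<rho> i = - x (2*i) / x (2*i+1)" for i
  have b: "x (2*i+1) \<noteq> 0" if "i < M" for i using good that unfolding distinct_roots_def by auto
  have lt: "\<rho> i \<noteq> \<rho> j" if "j < i" "i < M" for i j
  proof
    assume "\<rho> i = \<rho> j"
    then have "x (2*i) * x (2*j+1) - x (2*j) * x (2*i+1) = 0" using b[of i] b[of j] that
      by (simp add: \<rho>_def field_simps)
    then have "(\<Prod>i<M. \<Prod>j<i. x (2*i) * x (2*j+1) - x (2*j) * x (2*i+1)) = 0" using that by auto
    then show False using good unfolding distinct_roots_def by simp
  qed
  then have ne: "\<rho> i \<noteq> \<rho> j" if "i \<noteq> j" "i < M" "j < M" for i j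
    using that by (metis linorder_neqE_nat)
  have lr: "poly (?l j) (\<rho> i) = 0 \<longleftrightarrow> i = j" if "i < M" "j < M" for i j
  proof -
    have "poly (?l j) (\<rho> i) = x (2*j+1) * (\<rho> i - \<rho> j)" using b[OF that(2)] by (simp add: \<rho>_def field_simps)
    then show ?thesis using b[OF that(2)] ne[of i j] that by auto
  qed
  have P0: "poly (P i) (\<rho> j) = 0 \<longleftrightarrow> i \<noteq> j" if "i < M" "j < M" for i j
    unfolding P_def poly_prod using that lr by auto
  have dl: "degree (?l j) = 1" if "j < M" for j using b[OF that] by simp
  have dP: "degree (P i) \<le> M - 1" if "i < M" for i
  proof -
    have "degree (P i) = (\<Sum>j\<in>{..<M}-{i}. degree (?l j))" unfolding P_def
      by (rule degree_prod_eq_sum_degree) (use b in auto)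
    also have "\<dots> = M - 1" using dl that by simp
    finally show ?thesis by simp
  qed
  define L where "L = (\<Prod>j<M. ?l j)"
  have dL: "degree L = M" 
  proof -
    have "degree L = (\<Sum>j<M. degree (?l j))" unfolding L_def by (rule degree_prod_eq_sum_degree) (use b in auto)
    then show ?thesis using dl by simp
  qed
  then have cL: "coeff L M \<noteq> 0" using M by (metis degree_0 leading_coeff_0_iff not_one_le_zero)
  define c where "c = coeff q M / coeff L M"
  define q1 where "q1 = q - smult c L"
  have "coeff q1 M = 0" using cL by (simp add: q1_def c_def)
  moreover have "degree q1 \<le> M" unfolding q1_def using q dL by (intro degree_diff_le) (auto intro: order.trans[OF degree_smult_le])
  ultimately have dq1: "degree q1 \<le> M - 1" using M
    by (metis One_nat_def Suc_pred degree_0 leading_coeff_0_iff le_SucE less_eq_Suc_le zero_le)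
  define a where "a i = poly q1 (\<rho> i) / poly (P i) (\<rho> i)" for i
  define r where "r = q1 - (\<Sum>i<M. smult (a i) (P i))"
  have "r = 0"
  proof (rule ccontr)
    assume "r \<noteq> 0"
    have "poly r (\<rho> j) = 0" if "j < M" for j
    proof -
      have "(\<Sum>i<M. a i * poly (P i) (\<rho> j)) = (\<Sum>i<M. if i = j then poly q1 (\<rho> j) else 0)"
        by (intro sum.cong refl) (use that P0 in \<open>auto simp: a_def\<close>)
      then show ?thesis using that by (simp add: r_def poly_sum)
    qed
    then have "\<rho> ` {..<M} \<subseteq> {z. poly r z = 0}" by auto
    then have "card (\<rho> ` {..<M}) \<le> card {z. poly r z = 0}" by (rule card_mono[OF poly_roots_finite[OF \<open>r \<noteq> 0\<close>]])
    also have "card (\<rho> ` {..<M}) = M" using ne by (subst card_image) (auto simp: inj_on_def)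
    also have "card {z. poly r z = 0} \<le> degree r" using \<open>r \<noteq> 0\<close> by (rule card_poly_roots_bound)
    also have "degree r \<le> M - 1" unfolding r_def using dq1 dP
      by (intro degree_diff_le degree_sum_le) (auto intro: order.trans[OF degree_smult_le])
    finally show False using M by simp
  qed
  then have q1: "q1 = (\<Sum>i<M. smult (a i) (P i))" by (simp add: r_def)
  \<comment> \<open>The full product \<open>L\<close> is the linear form \<open>?l 0\<close> times
    the product omitting index 0, so the top term \<open>smult c L\<close> goes into
    \<open>s 0\<close>.\<close>
  define s where "s i = [:a i:] + (if i = 0 then smult c (?l 0) else 0)" for i
  have L0: "L = ?l 0 * P 0" unfolding L_def P_def by (rule prod.remove) (use M in auto)
  have "(\<Sum>i<M. s i * P i) = (\<Sum>i<M. smult (a i) (P i) + (if i = 0 then smult c L else 0))"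
  proof (intro sum.cong refl)
    fix i
    have "[:a i:] * P i = smult (a i) (P i)" "smult c (?l 0) * P 0 = smult c L" by (simp, simp only: mult_smult_left L0)
    then show "s i * P i = smult (a i) (P i) + (if i = 0 then smult c L else 0)"
      by (cases "i = 0") (simp_all only: s_def distrib_right if_True if_False add_0_right simp_thms)
  qed
  also have "\<dots> = q1 + smult c L" using M by (simp add: sum.distrib q1)
  also have "\<dots> = q" by (simp add: q1_def)
  finally have "q = (\<Sum>i<M. s i * P i)" by simp
  moreover have "degree (s i) \<le> 1" for i
    unfolding s_def by (intro degree_add_le) (auto intro: order.trans[OF degree_smult_le])
  ultimately show ?thesis unfolding P_def by (intro exI[of _ s] conjI allI impI)
qed

lemma tangent_contains:
  fixes x :: "nat \<Rightarrow> 'a::field_char_0" and M :: nat and e :: "nat \<Rightarrow> nat"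
  defines "d \<equiv> (\<Sum>i<M. e i)"
  assumes e: "\<And>i. i < M \<Longrightarrow> e i \<ge> 1" and M: "M \<ge> 1" and q: "degree q \<le> M" 
    and F: "F \<in> vanishing_polys d (locus M e)"
  shows "(\<Sum>k\<le>d. mp_eval (coeff (lprod M e x)) (mp_partial k F) * coeff (lprod M (\<lambda>i. e i - 1) x * q) k) = 0"
proof -
  define \<psi> where "\<psi> x = (\<Sum>k\<le>d. mp_eval (coeff (lprod M e x)) (mp_partial k F) * coeff (lprod M (\<lambda>i. e i - 1) x * q) k)" for x
  have good: "\<psi> x = 0" if g: "distinct_roots M x \<noteq> 0" for x
  proof -
    let ?P = "\<lambda>i. \<Prod>j\<in>{..<M}-{i}. [:x (2*j), x (2*j+1):]"
    obtain s where s: "\<forall>i<M. degree (s i) \<le> 1" "q = (\<Sum>i<M. s i * ?P i)" 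
      using lagrange_decomposition[OF g q M] by blast
    have "\<psi> x = (\<Sum>k\<le>d. \<Sum>i<M. mp_eval (coeff (lprod M e x)) (mp_partial k F) * coeff (lprod M (\<lambda>i. e i - 1) x * (s i * ?P i)) k)"
      unfolding \<psi>_def s(2) by (simp add: sum_distrib_left coeff_sum)
    also have "\<dots> = (\<Sum>i<M. \<Sum>k\<le>d. mp_eval (coeff (lprod M e x)) (mp_partial k F) * coeff (lprod M (\<lambda>i. e i - 1) x * (s i * ?P i)) k)"
      by (rule sum.swap)
    also have "\<dots> = 0"
      unfolding d_def by (rule sum.neutral) (use tangent_direction[OF e _ _ F[unfolded d_def]] s(1) in auto)
    finally show ?thesis .
  qed
  have over: "mp_over {..d} (mp_partial k F)" for k 
    by (rule mp_partial_over[OF vanishing_polysD(1)[OF F]])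
  define w where "w k = (if even k then of_nat (k div 2) else (1::'a))" for k
  have "curvefun (\<lambda>t. \<psi> (lineseg x w t))" unfolding \<psi>_def
    by (intro polyfun_sum polyfun.mult mp_eval_curve[OF over] curvefun_lprod_lineseg polyfun_coeff_mult polyfun.const)
  moreover have "\<forall>\<^sub>F t in cofinite. \<psi> (lineseg x w t) = 0"
  proof -
    have "\<forall>\<^sub>F t in cofinite. distinct_roots M (lineseg x w t) \<noteq> 0"
    proof (rule curvefun_generic[where ?t0.0=1])
      show "curvefun (\<lambda>t. distinct_roots M (lineseg x w t))" by (rule curvefun_lineseg[OF polyfun_distinct_roots])
      show "distinct_roots M (lineseg x w 1) \<noteq> 0" unfolding lineseg_simps w_def[abs_def] by (rule distinct_roots_nonzero)
    qed
    then show ?thesis by eventually_elim (rule good)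
  qed
  ultimately have "\<psi> (lineseg x w 0) = 0" by (rule curvefun_eq_0)
  then show ?thesis by (simp add: \<psi>_def)
qed

lemma degree_radical:
  assumes "\<And>i. i < M \<Longrightarrow> e i \<ge> (1::nat)"
  shows "(\<Sum>i<M. e i - 1) + M = (\<Sum>i<M. e i)"
proof -
  have "(\<Sum>i<M. e i) = (\<Sum>i<M. (e i - 1) + 1)"
  proof (intro sum.cong refl)
    fix i assume "i \<in> {..<M}"
    then show "e i = (e i - 1) + 1" using assms[of i] by simp
  qed
  also have "\<dots> = (\<Sum>i<M. e i - 1) + M" by (simp only: sum.distrib) simp
  finally show ?thesis by simp
qed

lemma tangent_space_contains:
  fixes x :: "nat \<Rightarrow> 'a::field_char_0" and M :: nat and e :: "nat \<Rightarrow> nat"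
  defines "d \<equiv> (\<Sum>i<M. e i)"
  assumes e: "\<And>i. i < M \<Longrightarrow> e i \<ge> 1" and M: "M \<ge> 1" and q: "degree q \<le> M"
  shows "hmg d (lprod M (\<lambda>i. e i - 1) x * q) \<in> tangent_space d (locus M e) (hmg d (lprod M e x))"
proof -
  have "degree (lprod M (\<lambda>i. e i - 1) x * q) \<le> (\<Sum>i<M. e i - 1) + M"
    using degree_mult_le[of "lprod M (\<lambda>i. e i - 1) x" q] degree_lprod[of M "\<lambda>i. e i - 1" x] q by linarith
  also have "\<dots> = d" unfolding d_def using e by (rule degree_radical)
  finally have dq: "degree (lprod M (\<lambda>i. e i - 1) x * q) \<le> d" .
  have de: "degree (lprod M e x) \<le> d" unfolding d_def by (rule degree_lprod)
  have main: "(\<Sum>k\<le>d. mp_eval (coeff (lprod M e x)) (mp_partial k F) * coeff (lprod M (\<lambda>i. e i - 1) x * q) k) = 0"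
    if F: "F \<in> vanishing_polys d (locus M e)" for F
    unfolding d_def by (rule tangent_contains[OF e M q F[unfolded d_def]])
  show ?thesis unfolding tangent_space_def
    by (intro CollectI conjI ballI hmg_binary) (simp only: form_coord_hmg[OF dq] form_coord_hmg[OF de] main)
qed

text \<open>\<open>B\<close> indexes a transcendence basis among the coordinates, and \<open>P j\<close> is a relation of minimal degree
  between it and coordinate \<open>j\<close>. Its partial derivative has smaller degree, so it does not vanish
  identically on the locus.\<close>

lemma generic_equations:
  fixes M :: nat and e :: "nat \<Rightarrow> nat"
  defines "d \<equiv> (\<Sum>i<M. e i)"
  defines "X \<equiv> (locus M e :: 'a::field_char_0 poly poly set set)"
  shows "\<exists>B P q. B \<subseteq> {..d} \<and> card B \<le> M + 1 \<and> polyfun (coords UNIV) q \<and> (\<exists>x::nat \<Rightarrow> 'a. q x \<noteq> 0) \<and>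
    (\<forall>j\<in>{..d}-B. P j \<in> vanishing_polys d X \<and> mp_over (insert j B) (P j) \<and> 
      (\<forall>x. q x \<noteq> 0 \<longrightarrow> mp_eval (coeff (lprod M e x)) (mp_partial j (P j)) \<noteq> 0))"
proof -
  define y where "y i z = z i" for i :: nat and z :: "nat \<Rightarrow> 'a"
  let ?C = "acone d X"
  let ?ok = "\<lambda>B. B \<subseteq> {..d} \<and> alg_indep B y ?C"
  have "?ok {}" unfolding alg_indep_def
  proof (intro conjI allI impI)
    fix Q :: "(nat, 'a) mpolynomial"
    assume Q: "mp_over {} Q \<and> (\<forall>z\<in>?C. mp_eval (\<lambda>i. y i z) Q = 0)"
    then have "pmkeys Q \<subseteq> {0}" by (auto simp: mp_over_def)
    then have "mp_eval z Q = lkp Q 0" for z by (subst mp_eval_superset[of "{0}"]) (auto simp: monval_def)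
    then have "lkp Q 0 = 0" using Q zero_in_cone by metis
    then have "pmkeys Q = {}" using \<open>pmkeys Q \<subseteq> {0}\<close> in_keys_iff[of 0 Q] by blast
    then show "Q = 0" by simp
  qed auto
  moreover have "\<forall>B. ?ok B \<longrightarrow> card B < d + 2"
  proof (intro allI impI)
    fix B assume "?ok B"
    then have "card B \<le> card {..d}" by (intro card_mono) auto
    then show "card B < d + 2" by simp
  qed
  ultimately have "\<exists>B. ?ok B \<and> (\<forall>B'. ?ok B' \<longrightarrow> card B' \<le> card B)"
    by (rule ex_has_greatest_nat[where P="?ok" and f=card and b="d+2" and k="{}"])
  then obtain B where B: "B \<subseteq> {..d}" "alg_indep B y ?C" "\<And>B'. ?ok B' \<Longrightarrow> card B' \<le> card B" by blast
  have finB: "finite B" using B(1) finite_subset by blast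
  have "card B \<le> M + 1"
    by (rule alg_indep_cone_locus[OF finB _ B(2)[unfolded d_def X_def]]) (auto simp: y_def[abs_def] intro: polyfun_coord)
  have "\<exists>Q. Q \<in> vanishing_polys d X \<and> mp_over (insert j B) Q \<and> 
    (\<exists>x. mp_eval (coeff (lprod M e x)) (mp_partial j Q) \<noteq> 0)" if j: "j \<in> {..d} - B" for j
  proof -
    let ?I = "insert j B"
    let ?van = "\<lambda>Q. \<forall>z\<in>?C. mp_eval z Q = 0"
    have "card ?I > card B" using j finB by simp
    then have "\<not> ?ok ?I" using B(3) by (meson not_le)
    then have "\<not> alg_indep ?I y ?C" using j B(1) by auto
    then obtain Q where Q: "mp_over ?I Q" "?van Q" "Q \<noteq> 0" unfolding alg_indep_def y_def by auto
    obtain k0 where k0: "hcomp k0 Q \<noteq> 0" using hcomp_nonzero[OF Q(3)] by blast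
    have "?van (hcomp k0 Q)"
    proof
      fix z assume z: "z \<in> ?C"
      show "mp_eval z (hcomp k0 Q) = 0" by (rule hcomp_vanishes) (use Q(2) cone_scale[OF z] in blast)
    qed
    then have ex: "\<exists>k Q. Q \<noteq> 0 \<and> mp_hom k Q \<and> mp_over ?I Q \<and> ?van Q" using k0 hcomp_hom Q(1) by blast
    define k where "k = (LEAST k. \<exists>Q. Q \<noteq> 0 \<and> mp_hom k Q \<and> mp_over ?I Q \<and> ?van Q)"
    obtain P where P: "P \<noteq> 0" "mp_hom k P" "mp_over ?I P" "?van P"
      using LeastI_ex[OF ex] unfolding k_def[symmetric] by blast
    have notB: "\<not> mp_over B P"
      using B(2) P unfolding alg_indep_def y_def by auto
    have k1: "k \<ge> 1"
    proof (rule ccontr)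
      assume "\<not> k \<ge> 1"
      then have "k = 0" by simp
      have "pmkeys m = {}" if "m \<in> pmkeys P" for m
        using P(2) that unfolding mp_hom_def tdeg_def \<open>k = 0\<close> by (fastforce simp: in_keys_iff)
      then have "mp_over B P" unfolding mp_over_def by blast
      then show False using notB by blast
    qed
    let ?D = "mp_partial j P"
    have D: "?D \<noteq> 0" "mp_hom (k - 1) ?D" "mp_over ?I ?D"
      using mp_partial_nonzero[OF notB P(3)] mp_partial_hom[OF P(2)] mp_partial_over[OF P(3)] by auto
    have "\<not> ?van ?D"
    proof
      assume "?van ?D"
      with D have "\<exists>Q. Q \<noteq> 0 \<and> mp_hom (k - 1) Q \<and> mp_over ?I Q \<and> ?van Q" by (intro exI[of _ ?D] conjI)
      then have "(LEAST k. \<exists>Q. Q \<noteq> 0 \<and> mp_hom k Q \<and> mp_over ?I Q \<and> ?van Q) \<le> k - 1" by (rule Least_le)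
      then have "k \<le> k - 1" by (simp only: k_def[symmetric])
      then show False using k1 by simp
    qed
    then obtain z where z: "z \<in> ?C" "mp_eval z ?D \<noteq> 0" by blast
    obtain c x where x: "nonzero_pairs M x" "z = coeff (smult c (lprod M e x))" 
      using cone_locus[OF z(1)[unfolded d_def X_def]] by blast
    have "mp_eval z ?D = c ^ (k - 1) * mp_eval (coeff (lprod M e x)) ?D"
      unfolding x(2) using mp_hom_scale[OF D(2), of c "coeff (lprod M e x)"] by (simp add: coeff_smult[abs_def])
    then have nz: "mp_eval (coeff (lprod M e x)) ?D \<noteq> 0" using z(2) by auto
    have "mp_over {..d} P" using P(3) j B(1) unfolding mp_over_def by blast
    then have "P \<in> vanishing_polys d X" unfolding vanishing_polys_def homogeneous_polys_iff
      using P(2,4) unfolding acone_def by blast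
    then show ?thesis using P(3) nz by blast
  qed
  then obtain P where P: "\<And>j. j \<in> {..d} - B \<Longrightarrow> P j \<in> vanishing_polys d X \<and> mp_over (insert j B) (P j) \<and> 
    (\<exists>x. mp_eval (coeff (lprod M e x)) (mp_partial j (P j)) \<noteq> 0)" by metis
  define q where "q x = (\<Prod>j\<in>{..d}-B. mp_eval (coeff (lprod M e x)) (mp_partial j (P j)))" for x
  have pf: "polyfun (coords UNIV) (\<lambda>x. mp_eval (coeff (lprod M e x)) (mp_partial j (P j)))" if "j \<in> {..d} - B" for j
  proof (rule polyfun_compose_coords[OF polyfun_mp_eval])
    show "mp_over (insert j B) (mp_partial j (P j))" by (rule mp_partial_over) (use P[OF that] in simp)
    show "polyfun (coords UNIV) (\<lambda>x::nat \<Rightarrow> 'a. coeff (lprod M e x) i)" for i by (intro polyfun_lprod polyfun_coord) auto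
  qed
  have "\<exists>x. q x \<noteq> 0" unfolding q_def by (rule polyfun_prod_nonzero[OF _ pf]) (use P in auto)
  moreover have "polyfun (coords UNIV) q" unfolding q_def[abs_def] by (intro polyfun_prod pf)
  moreover have "mp_eval (coeff (lprod M e x)) (mp_partial j (P j)) \<noteq> 0" if "q x \<noteq> 0" "j \<in> {..d} - B" for x j
    using that unfolding q_def by simp
  ultimately show ?thesis using B(1) \<open>card B \<le> M + 1\<close> P by (intro exI[of _ B] exI[of _ P] exI[of _ q]) blast
qed

section \<open>The tangent space at a general point\<close>

lemma forms_dim_image:
  fixes R :: "'a::field poly"
  assumes "R \<noteq> 0" "degree R + M \<le> d"
  shows "forms.dim {hmg d (R * q) | q. degree q \<le> M} = M + 1"
proof -
  let ?b = "\<lambda>j. hmg d (R * monom 1 j)"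
  have comb: "(\<Sum>j\<le>M. form_scale (u j) (?b j)) = hmg d (R * (\<Sum>j\<le>M. monom (u j) j))" for u
  proof -
    have "hmg d (\<Sum>j\<in>A. f j) = (\<Sum>j\<in>A. hmg d (f j))" for f :: "nat \<Rightarrow> 'a poly" and A
      by (induction A rule: infinite_finite_induct) (auto simp: hmg_add)
    then show ?thesis unfolding hmg_scale sum_distrib_left
      by (simp add: smult_monom flip: mult_smult_right)
  qed
  have dR: "degree (R * q) \<le> d" if "degree q \<le> M" for q
    using degree_mult_le[of R q] that assms(2) by linarith
  have zero: "u j = 0" if "(\<Sum>j\<le>M. form_scale (u j) (?b j)) = 0" "j \<le> M" for u j
  proof -
    let ?q = "\<Sum>j\<le>M. monom (u j) j"
    have cq: "coeff ?q i = (if i \<le> M then u i else 0)" for i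
      unfolding coeff_sum coeff_monom by (subst sum.delta) auto
    have "degree ?q \<le> M" by (rule degree_le) (auto simp: cq)
    then have "R * ?q = 0" using that(1) hmg_eq_0_iff[OF dR] unfolding comb by blast
    then have "?q = 0" using assms(1) by simp
    then show ?thesis using cq[of j] that(2) by simp
  qed
  have inj: "inj_on ?b {..M}"
  proof (rule inj_onI, rule ccontr)
    fix i j assume ij: "i \<in> {..M}" "j \<in> {..M}" "?b i = ?b j" "i \<noteq> j"
    let ?u = "\<lambda>k. if k = i then 1 else if k = j then -1 else (0::'a)"
    have "(\<Sum>k\<le>M. form_scale (?u k) (?b k)) = (\<Sum>k\<le>M. (if k = i then ?b i else 0) - (if k = j then ?b j else 0))"
      by (intro sum.cong refl) (use ij(4) in \<open>auto simp flip: one_pCons\<close>)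
    also have "\<dots> = 0" using ij by (simp add: sum_subtractf)
    finally have "?u i = 0" using zero[of ?u i] ij(1) by blast
    then show False by simp
  qed
  show ?thesis
  proof (rule forms.dim_unique[where B="?b ` {..M}"])
    show "?b ` {..M} \<subseteq> {hmg d (R * q) | q. degree q \<le> M}" by (auto simp: degree_monom_eq)
    show "{hmg d (R * q) | q. degree q \<le> M} \<subseteq> forms.span (?b ` {..M})"
    proof
      fix h assume "h \<in> {hmg d (R * q) | q. degree q \<le> M}"
      then obtain q where q: "h = hmg d (R * q)" "degree q \<le> M" by blast
      have "q = (\<Sum>j\<le>M. monom (coeff q j) j)" using poly_as_sum_of_monoms'[OF q(2)] by simp
      then have "h = (\<Sum>j\<le>M. form_scale (coeff q j) (?b j))" unfolding comb q(1) by simp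
      then show "h \<in> forms.span (?b ` {..M})" 
        by (simp only:) (intro forms.span_sum forms.span_scale forms.span_base imageI)
    qed
    show "forms.independent (?b ` {..M})"
    proof (rule forms.independent_if_scalars_zero)
      fix u v assume u: "(\<Sum>v\<in>?b ` {..M}. form_scale (u v) v) = 0" and v: "v \<in> ?b ` {..M}"
      from u have "(\<Sum>j\<le>M. form_scale (u (?b j)) (?b j)) = 0" by (simp add: sum.reindex[OF inj])
      then show "u v = 0" using zero[of "\<lambda>j. u (?b j)"] v by auto
    qed simp
    show "card (?b ` {..M}) = M + 1" using inj by (simp add: card_image)
  qed
qed

text \<open>Where the derivatives of the relations \<open>P j\<close> are nonzero, a tangent vector
  is determined by its coordinates in \<open>B\<close>, so the dimension is at most
  \<open>M + 1\<close>. The multiples of \<open>lprod M (\<lambda>i. e i - 1) x\<close> already fill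
  that dimension.\<close>

lemma generic_smooth:
  fixes M :: nat and e :: "nat \<Rightarrow> nat"
  defines "d \<equiv> (\<Sum>i<M. e i)"
  defines "X \<equiv> (locus M e :: 'a::{alg_closed_field, field_char_0} poly poly set set)"
  assumes e: "\<And>i. i < M \<Longrightarrow> e i \<ge> 1" and M: "M \<ge> 1"
  shows "\<exists>q. polyfun (coords UNIV) q \<and> (\<exists>x::nat \<Rightarrow> 'a. q x \<noteq> 0) \<and> 
    (\<forall>x. nonzero_pairs M x \<and> q x \<noteq> 0 \<longrightarrow> smooth_point d X (hmg d (lprod M e x)) \<and>
      tangent_space d X (hmg d (lprod M e x)) = {hmg d (lprod M (\<lambda>i. e i - 1) x * q) | q. degree q \<le> M})"
proof -
  obtain B P q where BP: "B \<subseteq> {..d} \<and> card B \<le> M + 1 \<and> polyfun (coords UNIV) q \<and> (\<exists>x::nat \<Rightarrow> 'a. q x \<noteq> 0) \<and>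
    (\<forall>j\<in>{..d}-B. P j \<in> vanishing_polys d X \<and> mp_over (insert j B) (P j) \<and> 
      (\<forall>x. q x \<noteq> 0 \<longrightarrow> mp_eval (coeff (lprod M e x)) (mp_partial j (P j)) \<noteq> 0))"
    using generic_equations[where M=M and e=e and 'a='a] unfolding d_def[symmetric] X_def[symmetric] by (elim exE) (rule that)
  then have B: "B \<subseteq> {..d}" "card B \<le> M + 1" "polyfun (coords UNIV) q" "\<exists>x. q x \<noteq> 0" by simp_all
  have P: "P j \<in> vanishing_polys d X" "mp_over (insert j B) (P j)"
      "q x \<noteq> 0 \<Longrightarrow> mp_eval (coeff (lprod M e x)) (mp_partial j (P j)) \<noteq> 0" if "j \<in> {..d} - B" for x j
    using BP that by blast+
  have "smooth_point d X (hmg d (lprod M e x)) \<and>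
      tangent_space d X (hmg d (lprod M e x)) = {hmg d (lprod M (\<lambda>i. e i - 1) x * q) | q. degree q \<le> M}"
    if x: "nonzero_pairs M x" "q x \<noteq> 0" for x
  proof -
    let ?R = "lprod M (\<lambda>i. e i - 1) x" and ?f = "hmg d (lprod M e x)"
    let ?T = "tangent_space d X ?f"
    have R0: "?R \<noteq> 0" using lprod_nonzero[OF x(1)] .
    have "(\<Sum>i<M. e i - 1) + M = d" unfolding d_def by (rule degree_radical[OF e])
    then have dR: "degree ?R + M \<le> d" using degree_lprod[of M "\<lambda>i. e i - 1" x] by linarith
    have dRq: "degree (?R * r) \<le> d" if "degree r \<le> M" for r using degree_mult_le[of ?R r] that dR by linarith
    have fc: "form_coord d ?f = coeff (lprod M e x)" unfolding d_def by (rule form_coord_hmg[OF degree_lprod])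
    have T1: "hmg d (?R * r) \<in> ?T" if "degree r \<le> M" for r
      unfolding d_def X_def by (rule tangent_space_contains[OF e M that])
    have inj: "h = 0" if h: "h \<in> ?T" "\<And>i. i \<in> B \<Longrightarrow> form_coord d h i = 0" for h
    proof -
      have hb: "h \<in> binary_forms d" using h(1) unfolding tangent_space_def by blast
      have "form_coord d h j = 0" for j
      proof (cases "j \<in> {..d} - B")
        case True
        have "(\<Sum>i\<le>d. mp_eval (coeff (lprod M e x)) (mp_partial i (P j)) * form_coord d h i) = 0"
          using h(1) P(1)[OF True] unfolding tangent_space_def fc by blast
        also have "(\<Sum>i\<le>d. mp_eval (coeff (lprod M e x)) (mp_partial i (P j)) * form_coord d h i) = 
          (\<Sum>i\<in>{j}. mp_eval (coeff (lprod M e x)) (mp_partial i (P j)) * form_coord d h i)"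
        proof (rule sum.mono_neutral_right)
          show "\<forall>i\<in>{..d} - {j}. mp_eval (coeff (lprod M e x)) (mp_partial i (P j)) * form_coord d h i = 0"
            using h(2) mp_partial_zero[OF P(2)[OF True]] by (metis DiffD2 insertE mp_eval_zero mult_eq_0_iff insertI1)
        qed (use True in auto)
        finally show ?thesis using P(3)[OF True x(2)] by simp
      next
        case False
        then show ?thesis using h(2) form_coord_beyond[OF hb] by (cases "j \<le> d") auto
      qed
      then have "deh h = 0" using form_coord_deh[OF hb] by (metis leading_coeff_0_iff)
      then show ?thesis using deh_eq_0_iff[OF hb] by blast
    qed
    have T2: "\<exists>r. degree r \<le> M \<and> h = hmg d (?R * r)" if h: "h \<in> ?T" for h
    proof -
      have hb: "h \<in> binary_forms d" using h unfolding tangent_space_def by blast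
      have finB: "finite B" using B(1) finite_subset by blast
      \<comment> \<open>The \<open>M + 1\<close> known tangent vectors together with
        \<open>h\<close> are one too many for the coordinates in \<open>B\<close>, hence dependent
        there and, by \<open>inj\<close>, dependent altogether.\<close>
      have "card B < card {..M+1}" using B(2) by simp
      from homogeneous_system_nontrivial[OF finB _ this, 
          of "\<lambda>i j. if j \<le> M then coeff (?R * monom 1 j) i else form_coord d h i"] obtain u where
        u: "\<exists>j\<in>{..M+1}. u j \<noteq> 0" "\<forall>i\<in>B. (\<Sum>j\<le>M+1. (if j \<le> M then coeff (?R * monom 1 j) i else form_coord d h i) * u j) = 0"
        by auto
      define r where "r = (\<Sum>j\<le>M. monom (u j) j)"
      have cr: "coeff r i = (if i \<le> M then u i else 0)" for i
        unfolding r_def coeff_sum coeff_monom by (subst sum.delta) auto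
      have dr: "degree r \<le> M" by (rule degree_le) (auto simp: cr)
      define w where "w = hmg d (?R * r) + form_scale (u (M+1)) h"
      have wT: "w \<in> ?T" unfolding w_def by (intro tangent_space_subspace T1 dr h)
      have rs: "coeff (?R * r) i = (\<Sum>j\<le>M. coeff (?R * monom 1 j) i * u j)" for i
      proof -
        have "r = (\<Sum>j\<le>M. smult (u j) (monom 1 j))" by (simp add: r_def smult_monom)
        then show ?thesis by (simp add: sum_distrib_left coeff_sum mult.commute)
      qed
      have "form_coord d w i = 0" if "i \<in> B" for i
      proof -
        have "form_coord d w i = coeff (?R * r) i + u (M+1) * form_coord d h i"
          using form_coord_hmg[OF dRq[OF dr]] by (simp add: w_def form_coord_def fun_eq_iff)
        also have "\<dots> = (\<Sum>j\<le>M+1. (if j \<le> M then coeff (?R * monom 1 j) i else form_coord d h i) * u j)"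
          unfolding rs by (simp add: mult.commute)
        finally show ?thesis using u(2) that by simp
      qed
      then have "w = 0" by (rule inj[OF wT])
      then have "deh w = 0" by simp
      then have eq: "?R * r + smult (u (M+1)) (deh h) = 0" 
        unfolding w_def deh_add deh_scale deh_hmg[OF dRq[OF dr]] .
      have "u (M+1) \<noteq> 0"
      proof
        assume 0: "u (M+1) = 0"
        then have "r = 0" using eq R0 by simp
        then have "u j = 0" if "j \<le> M" for j using cr[of j] that by simp
        then show False using u(1) 0 by (auto simp: le_Suc_eq)
      qed
      define r' where "r' = smult (- inverse (u (M+1))) r"
      have "deh h = ?R * r'"
      proof -
        have "smult (u (M+1)) (deh h) = - (?R * r)" using eq by (simp add: add_eq_0_iff)
        then have "smult (inverse (u (M+1))) (smult (u (M+1)) (deh h)) = smult (inverse (u (M+1))) (- (?R * r))" by simp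
        then show ?thesis using \<open>u (M+1) \<noteq> 0\<close> by (simp add: r'_def)
      qed
      moreover have "degree r' \<le> M" unfolding r'_def using dr degree_smult_le order.trans by blast
      ultimately show ?thesis using hmg_deh[OF hb] by (intro exI[of _ r']) auto
    qed
    have T: "?T = {hmg d (?R * q) | q. degree q \<le> M}" using T1 T2 by blast
    have "forms.dim ?T = M + 1" unfolding T by (rule forms_dim_image[OF R0 dR])
    moreover have "krull_dim (zariski d) X = enat M" unfolding d_def X_def by (rule krull_dim_locus[OF e])
    moreover have "?f \<in> binary_forms d - {0}" 
      using lprod_nonzero[OF x(1), of e] hmg_eq_0_iff[OF degree_lprod[of M e x]] by (auto simp: d_def)
    moreover have "proj_class ?f \<in> X" unfolding X_def locus_def d_def using x(1) by blast
    ultimately have "smooth_point d X ?f" unfolding smooth_point_def by (simp add: one_enat_def)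
    then show ?thesis using T by blast
  qed
  then show ?thesis using B(3,4) by (intro exI[of _ q]) blast
qed

section \<open>Deforming apolar forms\<close>

text \<open>The annihilator of \<open>h 0\<close> is cut out by a banded system with an invertible triangular minor, whose
  columns start at the degree of \<open>h 0\<close>. Cramer's rule solves for these columns with \<open>t\<close> varying.\<close>

lemma apolar_deformation:
  fixes a :: "nat \<Rightarrow> 'a::field" and h :: "'a \<Rightarrow> 'a poly"
  assumes h: "\<And>k. curvefun (\<lambda>t. coeff (h t) k)" "\<And>t. degree (h t) \<le> n" "h 0 \<noteq> 0"
    and a: "apolar a d n (h 0)"
  shows "\<exists>A c. c \<noteq> 0 \<and> (\<forall>j. curvefun (\<lambda>t. A t j)) \<and> (\<forall>j. A 0 j = c * a j) \<and> (\<forall>t. apolar (A t) d n (h t))"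
proof -
  \<comment> \<open>The number of annihilation equations; it is 0 for \<open>n > d\<close>, where
    there is nothing to satisfy.\<close>
  define N where "N = d + 1 - n"
  define i0 where "i0 = degree (h 0)"
  define Q where "Q t i i' = (if i \<le> i' + i0 then coeff (h t) (i' + i0 - i) else 0)" for t i i'
  define b where "b t i = (\<Sum>j\<le>n. coeff (h t) j * a (i + j))" for t i
  define v where "v t i' = (\<Sum>k<N. adj N (Q t) i' k * b t k)" for t i'
  \<comment> \<open>The old solution leaves the residuals \<open>b t\<close>. Applying the adjugate
    to them corrects the columns from \<open>i0\<close> on, and multiplying by the determinant
    avoids denominators. At \<open>t = 0\<close> the residuals vanish, so a multiple of
    \<open>a\<close> remains.\<close>
  define A where "A t j = dt N (Q t) * a j - (if i0 \<le> j \<and> j < i0 + N then v t (j - i0) else 0)" for t j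
  have Q: "curvefun (\<lambda>t. Q t i i')" for i i' unfolding Q_def by (intro polyfun_if h polyfun.const)
  have "curvefun (\<lambda>t. b t i)" for i unfolding b_def by (intro polyfun_sum polyfun.mult h polyfun.const)
  then have v: "curvefun (\<lambda>t. v t i)" for i unfolding v_def by (intro polyfun_sum polyfun.mult polyfun_adj Q)
  have "curvefun (\<lambda>t. A t j)" for j unfolding A_def
    by (intro polyfun_diff polyfun.mult polyfun_dt Q polyfun_if v polyfun.const)
  moreover have "apolar (A t) d n (h t)" for t
    unfolding apolar_iff
  proof (intro conjI allI impI)
    fix i assume i: "i + n \<le> d"
    then have iN: "i < N" by (simp add: N_def)
    have "(\<Sum>j\<le>n. coeff (h t) j * (if i0 \<le> i + j \<and> i + j < i0 + N then v t (i + j - i0) else 0)) = 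
      (\<Sum>j\<in>{j. j \<le> n \<and> i0 \<le> i + j \<and> i + j < i0 + N}. coeff (h t) j * v t (i + j - i0))"
      by (intro sum.mono_neutral_cong_right) auto
    also have "\<dots> = (\<Sum>i'\<in>{i'. i' < N \<and> i \<le> i' + i0 \<and> i' + i0 - i \<le> n}. Q t i i' * v t i')"
      by (rule sum.reindex_bij_witness[of _ "\<lambda>i'. i' + i0 - i" "\<lambda>j. i + j - i0"]) (auto simp: Q_def)
    also have "\<dots> = (\<Sum>i'<N. Q t i i' * v t i')"
    proof (rule sum.mono_neutral_left)
      show "\<forall>i'\<in>{..<N} - {i'. i' < N \<and> i \<le> i' + i0 \<and> i' + i0 - i \<le> n}. Q t i i' * v t i' = 0"
      proof
        fix i' assume "i' \<in> {..<N} - {i'. i' < N \<and> i \<le> i' + i0 \<and> i' + i0 - i \<le> n}"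
        then have "\<not> i \<le> i' + i0 \<or> degree (h t) < i' + i0 - i" using h(2)[of t] by auto
        then show "Q t i i' * v t i' = 0" by (auto simp: Q_def coeff_eq_0)
      qed
    qed auto
    also have "\<dots> = (\<Sum>i'<N. \<Sum>k<N. Q t i i' * adj N (Q t) i' k * b t k)"
      by (simp add: v_def sum_distrib_left mult.assoc)
    also have "\<dots> = (\<Sum>k<N. (\<Sum>i'<N. Q t i i' * adj N (Q t) i' k) * b t k)"
      by (subst sum.swap) (simp add: sum_distrib_right)
    also have "\<dots> = (\<Sum>k<N. if k = i then dt N (Q t) * b t i else 0)"
      by (intro sum.cong refl) (use iN in \<open>auto simp: adj_right\<close>)
    also have "\<dots> = dt N (Q t) * b t i" using iN by simp
    finally have v: "(\<Sum>j\<le>n. coeff (h t) j * (if i0 \<le> i + j \<and> i + j < i0 + N then v t (i + j - i0) else 0)) = dt N (Q t) * b t i" .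
    have "(\<Sum>j\<le>n. coeff (h t) j * A t (i + j)) = (\<Sum>j\<le>n. dt N (Q t) * (coeff (h t) j * a (i + j)) - 
       coeff (h t) j * (if i0 \<le> i + j \<and> i + j < i0 + N then v t (i + j - i0) else 0))"
      by (intro sum.cong refl) (simp add: A_def right_diff_distrib)
    also have "\<dots> = dt N (Q t) * b t i - dt N (Q t) * b t i"
      unfolding sum_subtractf v by (simp add: b_def sum_distrib_left)
    finally show "(\<Sum>j\<le>n. coeff (h t) j * A t (i + j)) = 0" by simp
  qed (rule h(2))
  \<comment> \<open>\<open>Q 0\<close> is lower triangular with the leading coefficient of
    \<open>h 0\<close> on the diagonal; the first nonzero entry of a kernel vector gives the
    contradiction.\<close>
  moreover have "dt N (Q 0) \<noteq> 0"
  proof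
    assume "dt N (Q 0) = 0"
    then obtain w where w: "\<exists>j<N. w j \<noteq> 0" "\<forall>i<N. (\<Sum>j<N. Q 0 i j * w j) = 0" unfolding dt_eq_0_iff by blast
    define j where "j = (LEAST j. j < N \<and> w j \<noteq> 0)"
    have j: "j < N" "w j \<noteq> 0" using LeastI_ex[OF w(1)] unfolding j_def by auto
    have less: "w k = 0" if "k < j" for k using not_less_Least[of k "\<lambda>j. j < N \<and> w j \<noteq> 0"] that j(1) unfolding j_def by auto
    have "(\<Sum>k<N. Q 0 j k * w k) = (\<Sum>k\<in>{j}. Q 0 j k * w k)"
    proof (rule sum.mono_neutral_right)
      show "\<forall>k\<in>{..<N} - {j}. Q 0 j k * w k = 0"
      proof
        fix k assume k: "k \<in> {..<N} - {j}"
        show "Q 0 j k * w k = 0"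
        proof (cases "k < j")
          case False
          then have "degree (h 0) < k + i0 - j" using k by (auto simp: i0_def)
          then show ?thesis by (simp add: Q_def coeff_eq_0)
        qed (simp add: less)
      qed
    qed (use j in auto)
    then have "Q 0 j j * w j = 0" using w(2) j(1) by simp
    then show False using j(2) h(3) by (simp add: Q_def i0_def)
  qed
  moreover have "A 0 j = dt N (Q 0) * a j" for j
  proof -
    have "b 0 k = 0" if "k < N" for k
      using a that unfolding apolar_iff b_def N_def by simp
    then show ?thesis by (simp add: A_def v_def)
  qed
  ultimately show ?thesis by (intro exI[of _ A] exI[of _ "dt N (Q 0)"]) blast
qed

definition form_of_seq :: "nat \<Rightarrow> (nat \<Rightarrow> 'a) \<Rightarrow> 'a::field_char_0 poly poly" where
  "form_of_seq d a = hmg d (\<Sum>j\<le>d. monom (a j / (fact j * fact (d - j))) j)"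

lemma form_of_seq_binary [simp]: "form_of_seq d a \<in> binary_forms d"
  by (simp add: form_of_seq_def)

lemma form_coord_form_of_seq: "j \<le> d \<Longrightarrow> form_coord d (form_of_seq d a) j = a j / (fact j * fact (d - j))"
proof -
  assume j: "j \<le> d"
  let ?p = "\<Sum>j\<le>d. monom (a j / (fact j * fact (d - j))) j"
  have c: "coeff ?p i = (if i \<le> d then a i / (fact i * fact (d - i)) else 0)" for i
    unfolding coeff_sum coeff_monom by (subst sum.delta) auto
  have "degree ?p \<le> d" by (rule degree_le) (simp only: c, simp)
  from form_coord_hmg[OF this] show ?thesis unfolding form_of_seq_def using c[of j] j by simp
qed

lemma dual_seq_form_of_seq: "j \<le> d \<Longrightarrow> dual_seq d (form_of_seq d a) j = a j"
  by (simp add: dual_seq_def form_coord_form_of_seq)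

lemma form_coord_eqI:
  assumes "f \<in> binary_forms d" "g \<in> binary_forms d" "\<And>j. j \<le> d \<Longrightarrow> form_coord d f j = form_coord d g j"
  shows "f = g"
proof (rule deh_eqI[OF assms(1,2)], rule poly_eqI)
  fix j
  show "coeff (deh f) j = coeff (deh g) j"
    using assms(3)[of j] form_coord_beyond[OF assms(1), of j] form_coord_beyond[OF assms(2), of j]
    unfolding form_coord_deh[OF assms(1)] form_coord_deh[OF assms(2)] by (cases "j \<le> d") auto
qed

lemma form_of_seq_dual_seq: "g \<in> binary_forms d \<Longrightarrow> form_of_seq d (dual_seq d g) = g"
  by (rule form_coord_eqI) (auto simp: form_coord_form_of_seq dual_seq_def)

lemma form_of_seq_scale: "form_of_seq d (\<lambda>j. c * a j) = form_scale c (form_of_seq d a)"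
proof (rule form_coord_eqI)
  show "form_scale c (form_of_seq d a) \<in> binary_forms d" by (rule form_scale_binary) simp
qed (auto simp: form_coord_form_of_seq form_coord_scale)

lemma apolar_cong: "(\<And>j. j \<le> d \<Longrightarrow> a j = b j) \<Longrightarrow> apolar a d n h \<longleftrightarrow> apolar b d n h"
  unfolding apolar_def ap_def by simp

lemma curvefun_form_of_seq:
  fixes A :: "'a \<Rightarrow> nat \<Rightarrow> 'a::field_char_0"
  assumes "\<And>j. curvefun (\<lambda>t. A t j)" "j \<le> d"
  shows "curvefun (\<lambda>t. form_coord d (form_of_seq d (A t)) j)"
proof -
  have "curvefun (\<lambda>t. A t j * inverse (fact j * fact (d - j)))" by (intro polyfun.mult polyfun.const assms)
  then show ?thesis using assms(2) by (simp add: form_coord_form_of_seq divide_inverse)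
qed

section \<open>The differential pairing\<close>

lemma coeff_partial_u_iter: "coeff ((partial_u ^^ i) f) k = (pderiv ^^ i) (coeff f k)"
proof (induction i arbitrary: f)
  case (Suc i)
  have "coeff ((partial_u ^^ Suc i) f) k = pderiv (coeff ((partial_u ^^ i) f) k)"
    by (simp add: partial_u_def coeff_map_poly)
  then show ?case using Suc by simp
qed simp

lemma partial_power:
  fixes g :: "'a::field_char_0 poly poly"
  assumes "g \<in> binary_forms d" "i + j = d"
  shows "(partial_u ^^ i) ((partial_v ^^ j) g) = [:[:dual_seq d g j:]:]"
proof (rule poly_eqI, rule poly_eqI)
  fix k l
  have "coeff (coeff ((partial_u ^^ i) ((partial_v ^^ j) g)) k) l = 
    of_nat (pochhammer (Suc l) i) * of_nat (pochhammer (Suc k) j) * coeff (coeff g (k + j)) (l + i)"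
    unfolding coeff_partial_u_iter partial_v_def coeff_higher_pderiv
    unfolding pochhammer_of_nat by (simp add: of_nat_poly)
  also have "\<dots> = coeff (coeff [:[:dual_seq d g j:]:] k) l"
  proof (cases "k = 0 \<and> l = 0")
    case True
    have "pochhammer (Suc 0) n = (fact n :: nat)" for n using pochhammer_fact[of n, where 'a=nat] by simp
    then show ?thesis using True assms(2) by (simp add: dual_seq_def form_coord_def flip: assms(2))
  next
    case False
    then have "coeff (coeff g (k + j)) (l + i) = 0" using assms unfolding binary_forms_def by fastforce
    then show ?thesis using False by (auto simp: coeff_pCons split: nat.splits)
  qed
  finally show "coeff (coeff ((partial_u ^^ i) ((partial_v ^^ j) g)) k) l = coeff (coeff [:[:dual_seq d g j:]:] k) l" .
qed

lemma diff_action_eq: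
  fixes g :: "'a::field_char_0 poly poly"
  assumes h: "h \<in> binary_forms d" and g: "g \<in> binary_forms d"
  shows "diff_action h g = [:[:ap (dual_seq d g) d (deh h):]:]"
proof -
  define X where "X j = [:[:form_coord d h j * dual_seq d g j:]:]" for j
  have T: "form_scale (coeff (coeff h j) i) ((partial_u ^^ i) ((partial_v ^^ j) g)) = (if i + j = d then X j else 0)" for i j
  proof (cases "i + j = d")
    case True
    then have "coeff (coeff h j) i = form_coord d h j" by (auto simp: form_coord_def)
    then show ?thesis using True by (simp add: partial_power[OF g True] X_def)
  next
    case False
    then have "coeff (coeff h j) i = 0" using h unfolding binary_forms_def by auto
    then show ?thesis using False by simp
  qed
  have inner: "(\<Sum>i\<le>degree (coeff h j). if i + j = d then X j else 0) = (if j \<le> d then X j else 0)" for j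
  proof (cases "j \<le> d \<and> d - j \<le> degree (coeff h j)")
    case True
    have "(\<Sum>i\<le>degree (coeff h j). if i + j = d then X j else 0) = (\<Sum>i\<le>degree (coeff h j). if i = d - j then X j else 0)"
      by (intro sum.cong refl) (use True in auto)
    then show ?thesis using True by simp
  next
    case False
    then have "X j = 0" if "j \<le> d" using that by (simp add: X_def form_coord_def coeff_eq_0)
    then show ?thesis by (auto intro!: sum.neutral)
  qed
  have "diff_action h g = (\<Sum>j\<le>degree h. if j \<le> d then X j else 0)"
    unfolding diff_action_def T inner ..
  also have "\<dots> = (\<Sum>j\<in>{..degree h} \<union> {..d}. if j \<le> d then X j else 0)"
    by (intro sum.mono_neutral_left) (auto simp: X_def form_coord_def coeff_eq_0)
  also have "\<dots> = (\<Sum>j\<le>d. X j)" by (intro sum.mono_neutral_cong_right) auto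
  also have "\<dots> = [:[:\<Sum>j\<le>d. form_coord d h j * dual_seq d g j:]:]"
  proof -
    have "(\<Sum>j\<in>S. X j) = [:[:\<Sum>j\<in>S. form_coord d h j * dual_seq d g j:]:]" for S
      by (induction S rule: infinite_finite_induct) (auto simp: X_def)
    then show ?thesis .
  qed
  finally show ?thesis unfolding ap_def form_coord_deh[OF h] .
qed

section \<open>Dual varieties of multiple root loci\<close>

text \<open>The tangent space contains all multiples of
  \<open>lprod M (\<lambda>i. e i - 1) x\<close> by polynomials of degree at most \<open>M\<close>,
  and \<open>M\<close> is exactly the degree left over by \<open>degree_radical\<close>.
  Orthogonality to them is therefore annihilation.\<close>

lemma conormal_in_apolar_locus:
  fixes M :: nat and e :: "nat \<Rightarrow> nat"
  defines "d \<equiv> (\<Sum>i<M. e i)"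
  defines "X \<equiv> (locus M e :: 'a::{alg_closed_field, field_char_0} poly poly set set)"
  assumes e: "\<And>i. i < M \<Longrightarrow> e i \<ge> 1" and M: "M \<ge> 1"
    and f: "smooth_point d X f" and g: "g \<in> binary_forms d - {0}" "\<forall>h\<in>tangent_space d X f. diff_action h g = 0"
  shows "proj_class g \<in> apolar_locus d M (\<lambda>i. e i - 1)"
proof -
  have "proj_class f \<in> X" using f unfolding smooth_point_def by blast
  then obtain x where x: "nonzero_pairs M x" "proj_class f = proj_class (hmg d (lprod M e x))"
    unfolding X_def locus_def d_def by blast
  from proj_class_eqD[OF x(2)] obtain c where c: "c \<noteq> 0" "f = form_scale c (hmg d (lprod M e x))" by blast
  have T: "tangent_space d X f = tangent_space d X (hmg d (lprod M e x))"
    unfolding c(2) by (rule tangent_space_scale_point[OF c(1)])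
  let ?R = "lprod M (\<lambda>i. e i - 1) x"
  have rad: "(\<Sum>i<M. e i - 1) + M = d" unfolding d_def by (rule degree_radical[OF e])
  have "apolar (dual_seq d g) d (\<Sum>i<M. e i - 1) ?R"
    unfolding apolar_def
  proof (intro conjI allI impI)
    show "degree ?R \<le> (\<Sum>i<M. e i - 1)" by (rule degree_lprod)
    fix q :: "'a poly" assume "degree q + (\<Sum>i<M. e i - 1) \<le> d"
    then have q: "degree q \<le> M" using rad by linarith
    have dq: "degree (?R * q) \<le> d" using degree_mult_le[of ?R q] degree_lprod[of M "\<lambda>i. e i - 1" x] q rad by linarith
    have "hmg d (?R * q) \<in> tangent_space d X f"
      unfolding T unfolding d_def X_def by (rule tangent_space_contains[OF e M q])
    then have "diff_action (hmg d (?R * q)) g = 0" using g(2) by blast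
    moreover have "diff_action (hmg d (?R * q)) g = [:[:ap (dual_seq d g) d (?R * q):]:]"
      using diff_action_eq[of "hmg d (?R * q)" d g] g(1) unfolding deh_hmg[OF dq] by simp
    ultimately show "ap (dual_seq d g) d (?R * q) = 0" by simp
  qed
  then show ?thesis unfolding apolar_locus_iff[OF g(1)] using x(1) by blast
qed

lemma apolar_locus_deform:
  fixes x y :: "nat \<Rightarrow> 'a::field_char_0"
  assumes g: "g \<in> binary_forms d - {0}" and x: "nonzero_pairs M x" 
    and a: "apolar (dual_seq d g) d (\<Sum>i<M. r i) (lprod M r x)"
  shows "\<exists>A c. c \<noteq> 0 \<and> (\<forall>j. curvefun (\<lambda>t. A t j)) \<and> form_of_seq d (A 0) = form_scale c g \<and> 
    (\<forall>t. apolar (A t) d (\<Sum>i<M. r i) (lprod M r (lineseg x y t)))"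
proof -
  have "\<exists>A c. c \<noteq> 0 \<and> (\<forall>j. curvefun (\<lambda>t. A t j)) \<and> (\<forall>j. A 0 j = c * dual_seq d g j) \<and> 
    (\<forall>t. apolar (A t) d (\<Sum>i<M. r i) (lprod M r (lineseg x y t)))"
  proof (rule apolar_deformation)
    show "curvefun (\<lambda>t. coeff (lprod M r (lineseg x y t)) k)" for k by (rule curvefun_lprod_lineseg)
    show "degree (lprod M r (lineseg x y t)) \<le> (\<Sum>i<M. r i)" for t by (rule degree_lprod)
    show "lprod M r (lineseg x y 0) \<noteq> 0" using lprod_nonzero[OF x] by simp
    show "apolar (dual_seq d g) d (\<Sum>i<M. r i) (lprod M r (lineseg x y 0))" using a by simp
  qed
  then obtain A c where A: "c \<noteq> 0" "\<forall>j. curvefun (\<lambda>t. A t j)" "\<forall>j. A 0 j = c * dual_seq d g j"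
    "\<forall>t. apolar (A t) d (\<Sum>i<M. r i) (lprod M r (lineseg x y t))" by blast
  have "A 0 = (\<lambda>j. c * dual_seq d g j)" using A(3) by auto
  then have "form_of_seq d (A 0) = form_scale c g" using g by (simp add: form_of_seq_scale form_of_seq_dual_seq)
  then show ?thesis using A by blast
qed

theorem dual_variety_locus:
  fixes M :: nat and e :: "nat \<Rightarrow> nat"
  defines "d \<equiv> (\<Sum>i<M. e i)"
  assumes e: "\<And>i. i < M \<Longrightarrow> e i \<ge> 1" and M: "M \<ge> 1"
  shows "dual_variety d (locus M e :: 'a::{alg_closed_field, field_char_0} poly poly set set) = 
    apolar_locus d M (\<lambda>i. e i - 1)"
proof -
  let ?X = "locus M e :: 'a poly poly set set"
  let ?r = "\<lambda>i. e i - 1"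
  define C where "C = {(proj_class f, proj_class g) | f g. smooth_point d ?X f \<and> g \<in> binary_forms d - {0} \<and>
    (\<forall>h \<in> tangent_space d ?X f. diff_action h g = 0)}"
  have dual: "dual_variety d ?X = snd ` (zariski_prod d closure_of C)"
    unfolding dual_variety_def conormal_variety_def C_def ..
  show ?thesis
  proof (intro equalityI)
    have "snd ` C \<subseteq> apolar_locus d M ?r"
    proof
      fix c assume "c \<in> snd ` C"
      then obtain f g where "c = proj_class g" "smooth_point d ?X f" "g \<in> binary_forms d - {0}"
        "\<forall>h \<in> tangent_space d ?X f. diff_action h g = 0" unfolding C_def by auto
      then show "c \<in> apolar_locus d M ?r" using conormal_in_apolar_locus[of M e f g] e M unfolding d_def by blast
    qed
    then have "zariski d closure_of (snd ` C) \<subseteq> apolar_locus d M ?r"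
      by (rule closure_of_minimal) (rule closedin_apolar_locus)
    then show "dual_variety d ?X \<subseteq> apolar_locus d M ?r"
      unfolding dual using snd_closure_subset by blast
  next
    show "apolar_locus d M ?r \<subseteq> dual_variety d ?X"
    proof
      fix c assume "c \<in> (apolar_locus d M ?r :: 'a poly poly set set)"
      then obtain g x where g: "c = proj_class g" "g \<in> binary_forms d - {0}" "nonzero_pairs M x"
        "apolar (dual_seq d g) d (\<Sum>i<M. ?r i) (lprod M ?r x)" unfolding apolar_locus_def by blast
      obtain q where q: "polyfun (coords UNIV) q" "\<exists>y::nat \<Rightarrow> 'a. q y \<noteq> 0" 
        "\<And>x. nonzero_pairs M x \<Longrightarrow> q x \<noteq> 0 \<Longrightarrow> smooth_point d ?X (hmg d (lprod M e x)) \<and>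
          tangent_space d ?X (hmg d (lprod M e x)) = {hmg d (lprod M ?r x * q) | q. degree q \<le> M}"
        using generic_smooth[where M=M and e=e and 'a='a] e M unfolding d_def by blast
      obtain y where y: "q y \<noteq> 0" using q(2) by blast
      obtain A k where A: "k \<noteq> 0" "\<forall>j. curvefun (\<lambda>t. A t j)" "form_of_seq d (A 0) = form_scale k g"
        "\<forall>t. apolar (A t) d (\<Sum>i<M. ?r i) (lprod M ?r (lineseg x y t))" 
        using apolar_locus_deform[OF g(2,3,4), of y] by blast
      have dp: "degree (lprod M e z) \<le> d" for z :: "nat \<Rightarrow> 'a" unfolding d_def by (rule degree_lprod)
      let ?\<gamma> = "\<lambda>t. hmg d (lprod M e (lineseg x y t))" and ?\<delta> = "\<lambda>t. form_of_seq d (A t)"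
      have g0: "?\<gamma> 0 \<noteq> 0" using lprod_nonzero[OF g(3), of e] hmg_eq_0_iff[OF dp] by simp
      have d0: "?\<delta> 0 \<noteq> 0" using A(1,3) g(2) by simp
      have gc: "curvefun (\<lambda>t. form_coord d (?\<gamma> t) j)" for j
        unfolding form_coord_hmg[OF dp] by (rule curvefun_lprod_lineseg)
      have dc: "curvefun (\<lambda>t. form_coord d (?\<delta> t) j)" if "j \<le> d" for j
        by (rule curvefun_form_of_seq) (use A(2) that in auto)
      have ev1: "\<forall>\<^sub>F t in cofinite. nonzero_pairs M (lineseg x y t)" by (rule generic_nonzero_pairs[OF g(3)])
      have ev2: "\<forall>\<^sub>F t in cofinite. q (lineseg x y t) \<noteq> 0"
        by (rule curvefun_generic[where ?t0.0=1, OF curvefun_lineseg[OF q(1)]]) (use y in simp)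
      have ev3: "\<forall>\<^sub>F t in cofinite. ?\<delta> t \<noteq> 0"
        by (rule form_curve_nonzero[where d=d and ?t0.0=0]) (use dc d0 in auto)
      \<comment> \<open>At general parameters the tangent space is no larger than these multiples,
        so an annihilated form is conormal.\<close>
      from ev1 ev2 ev3 have "\<forall>\<^sub>F t in cofinite. (proj_class (?\<gamma> t), proj_class (?\<delta> t)) \<in> C"
      proof eventually_elim
        case (elim t)
        note sm = q(3)[OF elim(1,2)]
        have "diff_action h (?\<delta> t) = 0" if h: "h \<in> tangent_space d ?X (?\<gamma> t)" for h
        proof -
          obtain s where s: "h = hmg d (lprod M ?r (lineseg x y t) * s)" "degree s \<le> M" using h sm by blast
          have rad: "(\<Sum>i<M. ?r i) + M = d" unfolding d_def by (rule degree_radical[OF e])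
          have ds: "degree (lprod M ?r (lineseg x y t) * s) \<le> d"
            using degree_mult_le[of "lprod M ?r (lineseg x y t)" s] degree_lprod[of M ?r "lineseg x y t"] s(2) rad by linarith
          have "apolar (dual_seq d (?\<delta> t)) d (\<Sum>i<M. ?r i) (lprod M ?r (lineseg x y t))"
            using A(4) apolar_cong[of d "dual_seq d (?\<delta> t)" "A t"] dual_seq_form_of_seq by blast
          then have "ap (dual_seq d (?\<delta> t)) d (lprod M ?r (lineseg x y t) * s) = 0"
            using s(2) rad unfolding apolar_def by simp
          then have "ap (dual_seq d (?\<delta> t)) d (deh h) = 0" unfolding s(1) deh_hmg[OF ds] .
          moreover have "diff_action h (?\<delta> t) = [:[:ap (dual_seq d (?\<delta> t)) d (deh h):]:]"
            by (rule diff_action_eq) (simp_all add: s(1))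
          ultimately show ?thesis by simp
        qed
        then have "\<forall>h\<in>tangent_space d ?X (?\<gamma> t). diff_action h (?\<delta> t) = 0" by blast
        moreover have "?\<delta> t \<in> binary_forms d - {0}" using elim(3) by simp
        ultimately show ?case unfolding C_def using sm by blast
      qed
      from zariski_prod_curve_closure[where ?t0.0=0 and \<gamma>="?\<gamma>" and \<delta>="?\<delta>", OF _ gc g0 _ dc d0 this]
      have "(proj_class (?\<gamma> 0), proj_class (?\<delta> 0)) \<in> zariski_prod d closure_of C" by simp
      then have "proj_class (?\<delta> 0) \<in> dual_variety d ?X" unfolding dual by force
      then show "c \<in> dual_variety d ?X" unfolding A(3) proj_class_scale[OF A(1)] g(1) .
    qed
  qed
qed

section \<open>Waring rank strata\<close>

text \<open>The sequence of a \<open>d\<close>-th power of a linear form is \<open>fact d\<close>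
  times the pure products of its coefficients, because the factorials cancel the binomial;
  \<open>c\<close> is a \<open>d\<close>-th root of that constant.\<close>

lemma sum_of_powers_iff_psum:
  fixes f :: "'a::{alg_closed_field, field_char_0} poly poly"
  assumes f: "f \<in> binary_forms d" and d: "d > 0"
  shows "sum_of_powers d r f \<longleftrightarrow> psum d r (dual_seq d f)"
proof -
  obtain c :: 'a where c: "c ^ d = fact d" using nth_root_exists[OF d] by blast
  then have c0: "c \<noteq> 0" using d by (auto simp: zero_power)
  have lin: "form_coord d ((hmg 1 [:a, b:]) ^ d) j = of_nat (d choose j) * b ^ j * a ^ (d - j)" if "j \<le> d" for a b :: 'a and j
  proof -
    have "hmg 1 [:a, b:] ^ d \<in> binary_forms d" using binary_forms_power[of "hmg 1 [:a, b:]" 1 d] by simp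
    then show ?thesis using that by (simp add: form_coord_deh deh_power deh_hmg coeff_linear_poly_power)
  qed
  have fc: "fact j * fact (d - j) * (of_nat (d choose j) * (b ^ j * a ^ (d - j))) = (c * a) ^ (d - j) * (c * b) ^ j" 
    if "j \<le> d" for a b j
  proof -
    have "(c * a) ^ (d - j) * (c * b) ^ j = c ^ (d - j) * c ^ j * (b ^ j * a ^ (d - j))"
      by (simp add: power_mult_distrib mult_ac)
    also have "c ^ (d - j) * c ^ j = fact d" using that c by (simp flip: power_add)
    also have "fact d = fact j * fact (d - j) * of_nat (d choose j)"
      using binomial_fact_lemma[OF that] by (metis of_nat_fact of_nat_mult)
    finally show ?thesis by (simp add: mult_ac)
  qed
  show ?thesis
  proof
    assume "sum_of_powers d r f"
    then obtain l where l: "\<forall>i<r. l i \<in> binary_forms 1" "f = (\<Sum>i<r. l i ^ d)" unfolding sum_of_powers_def by blast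
    define a where "a i = coeff (deh (l i)) 0" for i
    define b where "b i = coeff (deh (l i)) 1" for i
    have li: "l i = hmg 1 [:a i, b i:]" if "i < r" for i
    proof (rule deh_eqI[where d=1])
      have "degree (deh (l i)) \<le> 1" using l(1) that degree_deh by blast
      then have "deh (l i) = [:a i, b i:]"
        by (intro poly_eqI) (auto simp: a_def b_def coeff_pCons coeff_eq_0 split: nat.splits)
      then show "deh (l i) = deh (hmg 1 [:a i, b i:])" by (simp add: deh_hmg)
    qed (use l(1) that in auto)
    have "dual_seq d f j = (\<Sum>i<r. (c * a i) ^ (d - j) * (c * b i) ^ j)" if j: "j \<le> d" for j
    proof -
      have "form_coord d f j = (\<Sum>i<r. form_coord d (hmg 1 [:a i, b i:] ^ d) j)"
        unfolding l(2) form_coord_def coeff_sum using li by simp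
      then have "dual_seq d f j = (\<Sum>i<r. fact j * fact (d - j) * (of_nat (d choose j) * (b i ^ j * a i ^ (d - j))))"
        unfolding dual_seq_def lin[OF j] by (simp add: sum_distrib_left mult.assoc)
      then show ?thesis using fc[OF j] by simp
    qed
    then show "psum d r (dual_seq d f)" unfolding psum_def by (intro exI[of _ "\<lambda>i. c * a i"] exI[of _ "\<lambda>i. c * b i"]) auto
  next
    assume "psum d r (dual_seq d f)"
    then obtain a b where ab: "\<forall>j\<le>d. dual_seq d f j = (\<Sum>i<r. a i ^ (d - j) * b i ^ j)" unfolding psum_def by blast
    define l where "l i = hmg 1 [:a i / c, b i / c:]" for i
    have lb: "(\<Sum>i<r. l i ^ d) \<in> binary_forms d"
      by (intro binary_forms_sum) (use binary_forms_power[of "l _" 1 d] in \<open>simp add: l_def\<close>)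
    have "f = (\<Sum>i<r. l i ^ d)"
    proof (rule form_coord_eqI[OF f lb])
      fix j assume j: "j \<le> d"
      have "fact j * fact (d - j) * form_coord d (\<Sum>i<r. l i ^ d) j = 
        (\<Sum>i<r. fact j * fact (d - j) * (of_nat (d choose j) * ((b i / c) ^ j * (a i / c) ^ (d - j))))"
        unfolding sum_distrib_left[symmetric] mult.assoc[symmetric, of "of_nat _"] lin[OF j, symmetric] l_def
        by (simp add: form_coord_def coeff_sum)
      also have "\<dots> = (\<Sum>i<r. a i ^ (d - j) * b i ^ j)"
        unfolding fc[OF j] using c0 by simp
      also have "\<dots> = fact j * fact (d - j) * form_coord d f j" using ab j unfolding dual_seq_def by simp
      finally show "form_coord d f j = form_coord d (\<Sum>i<r. l i ^ d) j" by simp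
    qed
    then show "sum_of_powers d r f" unfolding sum_of_powers_def by (intro exI[of _ l]) (auto simp: l_def)
  qed
qed

lemma waring_rank_iff:
  fixes f :: "'a::{alg_closed_field, field_char_0} poly poly"
  assumes "f \<in> binary_forms d" "d > 0"
  shows "has_waring_rank d f r \<longleftrightarrow> psum d r (dual_seq d f) \<and> (\<forall>s<r. \<not> psum d s (dual_seq d f))"
  unfolding has_waring_rank_def sum_of_powers_iff_psum[OF assms] ..

text \<open>A missing degree is filled with factors \<open>[:1, 0:]\<close>, the dehomogenization of
  \<open>u\<close>, which stand for roots at infinity.\<close>

lemma linear_factorization:
  fixes m :: "'a::alg_closed_field poly"
  assumes "m \<noteq> 0" "degree m \<le> k"
  shows "\<exists>c \<alpha> \<beta>. c \<noteq> 0 \<and> (\<forall>i<k. (\<alpha> i, \<beta> i) \<noteq> (0, 0)) \<and> m = smult c (\<Prod>i<k. [:\<alpha> i, \<beta> i:])"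
  using assms
proof (induction k arbitrary: m)
  case 0
  then obtain c where "m = [:c:]" by (metis degree_eq_zeroE le_zero_eq)
  then show ?case using 0 by (intro exI[of _ c]) auto
next
  case (Suc k)
  have "\<exists>a b m'. (a, b) \<noteq> (0, 0) \<and> m' \<noteq> 0 \<and> degree m' \<le> k \<and> m = [:a, b:] * m'"
  proof (cases "degree m \<le> k")
    case True
    then show ?thesis using Suc.prems(1) by (intro exI[of _ 1] exI[of _ 0] exI[of _ m]) (auto simp flip: one_pCons)
  next
    case False
    then obtain z where "poly m z = 0" using alg_closed_imp_poly_has_root[of m] by auto
    then obtain m' where m': "m = [:-z, 1:] * m'" by (auto simp: poly_eq_0_iff_dvd)
    then have "m' \<noteq> 0" using Suc.prems(1) by auto
    then have "degree m = Suc (degree m')" unfolding m' by (subst degree_mult_eq) auto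
    then show ?thesis using Suc.prems(2) m' \<open>m' \<noteq> 0\<close> by (intro exI[of _ "-z"] exI[of _ 1] exI[of _ m']) auto
  qed
  then obtain a b m' where m': "(a, b) \<noteq> (0, 0)" "m' \<noteq> 0" "degree m' \<le> k" "m = [:a, b:] * m'" by blast
  obtain c \<alpha> \<beta> where ih: "c \<noteq> 0" "\<forall>i<k. (\<alpha> i, \<beta> i) \<noteq> (0, 0)" "m' = smult c (\<Prod>i<k. [:\<alpha> i, \<beta> i:])"
    using Suc.IH[OF m'(2,3)] by blast
  have "m = smult c (\<Prod>i<Suc k. [:(\<alpha>(k := a)) i, (\<beta>(k := b)) i:])"
    unfolding m'(4) ih(3) by (simp add: mult.commute)
  moreover have "\<forall>i<Suc k. ((\<alpha>(k := a)) i, (\<beta>(k := b)) i) \<noteq> (0, 0)" using ih(2) m'(1) by (auto simp: less_Suc_eq)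
  ultimately show ?case using ih(1) by blast
qed

text \<open>The form \<open>g\<close> may have annihilators of degree below \<open>k + 2\<close>,
  and then the rank bounds do not apply to it. It is moved linearly towards a sequence with
  invertible Hankel matrix that \<open>h\<close> also annihilates; general members then have rank
  exactly \<open>d + 2 - (k + 2)\<close>.\<close>

lemma double_root_in_waring_closure:
  fixes g :: "'a::{alg_closed_field, field_char_0} poly poly"
  assumes g: "g \<in> binary_forms d - {0}" and h: "apolar (dual_seq d g) d (k + 2) h" "degree h = k + 2"
    and z: "[:-z, 1:] ^ 2 dvd h" and k: "2 * k + 3 \<le> d"
  shows "proj_class g \<in> zariski d closure_of (waring_stratum d (d - k))"
proof -
  let ?n = "k + 2"
  have d: "d > 0" using k by simp
  obtain b where b: "apolar b d ?n h" "dt ?n (\<lambda>i j. b (i + j)) \<noteq> 0" using hankel_exists[OF h(2)] by auto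
  define A where "A t j = (1 - t) * dual_seq d g j + t * b j" for t j
  have A: "curvefun (\<lambda>t. A t j)" for j unfolding A_def by (intro polyfun_intros)
  have apA: "apolar (A t) d ?n h" for t unfolding apolar_iff
  proof (intro conjI allI impI)
    fix e assume "e + ?n \<le> d"
    then have 1: "(\<Sum>j\<le>?n. coeff h j * dual_seq d g (e + j)) = 0" "(\<Sum>j\<le>?n. coeff h j * b (e + j)) = 0"
      using h(1) b(1) unfolding apolar_iff by blast+
    have "(\<Sum>j\<le>?n. coeff h j * A t (e + j)) = 
      (1 - t) * (\<Sum>j\<le>?n. coeff h j * dual_seq d g (e + j)) + t * (\<Sum>j\<le>?n. coeff h j * b (e + j))"
      unfolding A_def sum_distrib_left sum.distrib[symmetric] by (intro sum.cong refl) (simp only: algebra_simps)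
    then show "(\<Sum>j\<le>?n. coeff h j * A t (e + j)) = 0" unfolding 1 by simp
  qed (use h(2) in simp)
  let ?\<delta> = "\<lambda>t. form_of_seq d (A t)"
  have "A 0 = dual_seq d g" by (auto simp: A_def)
  then have d0: "?\<delta> 0 = g" using form_of_seq_dual_seq g by auto
  have dc: "curvefun (\<lambda>t. form_coord d (?\<delta> t) j)" if "j \<le> d" for j
    by (rule curvefun_form_of_seq[OF A that])
  have "curvefun (\<lambda>t. dt ?n (\<lambda>i j. A t (i + j)))" by (intro polyfun_dt A)
  moreover have "dt ?n (\<lambda>i j. A 1 (i + j)) \<noteq> 0" using b(2) by (simp add: A_def)
  ultimately have ev1: "\<forall>\<^sub>F t in cofinite. dt ?n (\<lambda>i j. A t (i + j)) \<noteq> 0"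
    by (rule curvefun_generic[where ?t0.0=1])
  have ev2: "\<forall>\<^sub>F t in cofinite. ?\<delta> t \<noteq> 0"
    by (rule form_curve_nonzero[where d=d and ?t0.0=0]) (use dc d0 g in auto)
  from ev1 ev2 have "\<forall>\<^sub>F t in cofinite. proj_class (?\<delta> t) \<in> waring_stratum d (d - k)"
  proof eventually_elim
    case (elim t)
    have na: "no_apolar (A t) d (?n - 1)" by (rule hankel_imp_no_apolar[OF elim(1)]) (use k in auto)
    have h0: "h \<noteq> 0" using h(2) by auto
    have "psum d (d + 2 - ?n) (A t)" by (rule psum_complementary[OF na apA h0]) (use k in auto)
    then have 1: "psum d (d - k) (A t)" by simp
    have 2: "\<not> psum d s (A t)" if "s < d - k" for s
    proof
      assume "psum d s (A t)"
      from psum_lower_bound[OF na apA h(2) _ z this] that show False by simp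
    qed
    have cong: "psum d s (dual_seq d (?\<delta> t)) = psum d s (A t)" for s
      by (rule psum_cong) (rule dual_seq_form_of_seq)
    have "has_waring_rank d (?\<delta> t) (d - k)"
      unfolding waring_rank_iff[OF form_of_seq_binary d] cong using 1 2 by blast
    then show ?case unfolding waring_stratum_def using elim(2) by auto
  qed
  from zariski_curve_closure[where ?t0.0=0 and \<gamma>="?\<delta>", OF _ dc _ this] d0 g show ?thesis by simp
qed

lemma lprod_double_shape:
  assumes "r 0 = 2" "\<And>i. 1 \<le> i \<Longrightarrow> i \<le> k \<Longrightarrow> r i = 1" "\<And>i. k < i \<Longrightarrow> i < M \<Longrightarrow> r i = 0" "k < M"
  shows "lprod M r x = [:x 0, x 1:] ^ 2 * (\<Prod>i<k. [:x (2 * Suc i), x (2 * Suc i + 1):])"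
    and "(\<Sum>i<M. r i) = k + 2"
proof -
  have split: "{..<M} = insert 0 (Suc ` {..<k} \<union> {k<..<M})"
  proof (intro equalityI subsetI)
    fix i assume "i \<in> {..<M}"
    then show "i \<in> insert 0 (Suc ` {..<k} \<union> {k<..<M})" by (cases i) (auto simp: image_iff)
  qed (use assms(4) in auto)
  have "lprod M r x = [:x 0, x 1:] ^ 2 * (\<Prod>i\<in>Suc ` {..<k} \<union> {k<..<M}. [:x (2*i), x (2*i+1):] ^ r i)"
    unfolding lprod_def split by (subst prod.insert) (auto simp: assms(1))
  also have "(\<Prod>i\<in>Suc ` {..<k} \<union> {k<..<M}. [:x (2*i), x (2*i+1):] ^ r i) = 
    (\<Prod>i\<in>Suc ` {..<k}. [:x (2*i), x (2*i+1):] ^ r i) * (\<Prod>i\<in>{k<..<M}. [:x (2*i), x (2*i+1):] ^ r i)"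
    by (rule prod.union_disjoint) auto
  also have "(\<Prod>i\<in>{k<..<M}. [:x (2*i), x (2*i+1):] ^ r i) = 1"
    by (intro prod.neutral) (use assms(3) in auto)
  also have "(\<Prod>i\<in>Suc ` {..<k}. [:x (2*i), x (2*i+1):] ^ r i) = (\<Prod>i<k. [:x (2 * Suc i), x (2 * Suc i + 1):])"
    by (subst prod.reindex) (use assms(2) in \<open>auto intro!: prod.cong\<close>)
  finally show "lprod M r x = [:x 0, x 1:] ^ 2 * (\<Prod>i<k. [:x (2 * Suc i), x (2 * Suc i + 1):])" by simp
  have "(\<Sum>i<M. r i) = 2 + (\<Sum>i\<in>Suc ` {..<k} \<union> {k<..<M}. r i)"
    unfolding split by (subst sum.insert) (auto simp: assms(1))
  also have "(\<Sum>i\<in>Suc ` {..<k} \<union> {k<..<M}. r i) = (\<Sum>i\<in>Suc ` {..<k}. r i) + (\<Sum>i\<in>{k<..<M}. r i)"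
    by (rule sum.union_disjoint) auto
  also have "(\<Sum>i\<in>{k<..<M}. r i) = 0" by (intro sum.neutral) (use assms(3) in auto)
  also have "(\<Sum>i\<in>Suc ` {..<k}. r i) = (\<Sum>i\<in>Suc ` {..<k}. 1)" by (intro sum.cong refl) (use assms(2) in auto)
  also have "\<dots> = k" by (simp add: card_image)
  finally show "(\<Sum>i<M. r i) = k + 2" by simp
qed

text \<open>The inclusion from right to left takes limits twice: a first deformation removes the
  roots at infinity from the annihilator, so that \<open>double_root_in_waring_closure\<close>
  applies, and the closure of the closure adds nothing.\<close>

lemma closure_waring_stratum:
  fixes M k d :: nat
  assumes r: "r 0 = 2" "\<And>i. 1 \<le> i \<Longrightarrow> i \<le> k \<Longrightarrow> r i = 1" "\<And>i. k < i \<Longrightarrow> i < M \<Longrightarrow> r i = 0" "k < M"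
    and k: "2 * k + 3 \<le> d" "d div 2 + 2 \<le> d - k"
  shows "zariski d closure_of (waring_stratum d (d - k) :: 'a::{alg_closed_field, field_char_0} poly poly set set) = apolar_locus d M r"
proof -
  have shape: "lprod M r x = [:x 0, x 1:] ^ 2 * (\<Prod>i<k. [:x (2 * Suc i), x (2 * Suc i + 1):])"
    "(\<Sum>i<M. r i) = k + 2" for x :: "nat \<Rightarrow> 'a"
    using lprod_double_shape[of r k M] r by blast+
  show ?thesis
  proof (intro equalityI)
    have d: "d > 0" using k by simp
    have "(waring_stratum d (d - k) :: 'a poly poly set set) \<subseteq> apolar_locus d M r"
    proof
      fix c assume "c \<in> (waring_stratum d (d - k) :: 'a poly poly set set)"
      then obtain f where f: "c = proj_class f" "f \<in> binary_forms d - {0}" "has_waring_rank d f (d - k)"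
        unfolding waring_stratum_def by blast
      have fb: "f \<in> binary_forms d" using f(2) by simp
      have rk: "psum d (d - k) (dual_seq d f)" "\<And>s. s < d - k \<Longrightarrow> \<not> psum d s (dual_seq d f)"
        using f(3) unfolding waring_rank_iff[OF fb d] by blast+
      obtain l m where lm: "l \<noteq> 0" "m \<noteq> 0" "degree l \<le> 1" "degree m \<le> k" "apolar (dual_seq d f) d (k + 2) (l ^ 2 * m)"
        using exact_rank_imp_double_root[OF rk k(2) d] by blast
      obtain b \<alpha> \<beta> where m: "b \<noteq> 0" "\<forall>i<k. (\<alpha> i, \<beta> i) \<noteq> (0, 0)" "m = smult b (\<Prod>i<k. [:\<alpha> i, \<beta> i:])"
        using linear_factorization[OF lm(2,4)] by blast
      have l: "l = [:coeff l 0, coeff l 1:]"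
        using lm(3) by (intro poly_eqI) (auto simp: coeff_pCons coeff_eq_0 split: nat.splits)
      \<comment> \<open>Pair 0 holds the squared form, pairs 1 to \<open>k\<close> the factors of
        \<open>m\<close>. The remaining pairs have exponent 0 and only have to be nonzero.\<close>
      define x where "x j = (if j < 2 then coeff l j else if j < 2 * k + 2 then
        (if even j then \<alpha> (j div 2 - 1) else \<beta> (j div 2 - 1)) else 1)" for j
      have x0: "x 0 = coeff l 0" "x 1 = coeff l 1" by (auto simp: x_def)
      have xs: "x (2 * Suc i) = \<alpha> i" "x (2 * Suc i + 1) = \<beta> i" if "i < k" for i using that by (auto simp: x_def)
      have "nonzero_pairs M x" unfolding nonzero_pairs_def
      proof (intro allI impI)
        fix i assume "i < M"
        consider "i = 0" | i' where "i = Suc i'" "i' < k" | "i > k" by (cases i; cases "i \<le> k") auto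
        then show "(x (2*i), x (2*i+1)) \<noteq> (0, 0)"
        proof cases
          case 1
          then show ?thesis using lm(1) l x0 by auto
        next
          case 2
          then show ?thesis using m(2) xs[OF 2(2)] by simp
        next
          case 3
          then show ?thesis by (auto simp: x_def)
        qed
      qed
      moreover have "lprod M r x = l ^ 2 * (\<Prod>i<k. [:\<alpha> i, \<beta> i:])"
      proof -
        have "(\<Prod>i<k. [:x (2 * Suc i), x (2 * Suc i + 1):]) = (\<Prod>i<k. [:\<alpha> i, \<beta> i:])"
          by (intro prod.cong refl) (simp only: xs lessThan_iff)
        moreover have "[:x 0, x 1:] = l" using l x0 by simp
        ultimately show ?thesis by (simp only: shape(1))
      qed
      then have "l ^ 2 * m = smult b (lprod M r x)" by (simp add: m(3))
      then have "apolar (dual_seq d f) d (\<Sum>i<M. r i) (lprod M r x)"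
        using lm(5) apolar_smultD[OF _ m(1)] unfolding shape(2) by metis
      ultimately show "c \<in> apolar_locus d M r" unfolding f(1) apolar_locus_iff[OF f(2)] by blast
    qed
    then show "zariski d closure_of (waring_stratum d (d - k) :: 'a poly poly set set) \<subseteq> apolar_locus d M r"
      by (rule closure_of_minimal) (rule closedin_apolar_locus)
  next
    show "apolar_locus d M r \<subseteq> zariski d closure_of (waring_stratum d (d - k) :: 'a poly poly set set)"
    proof
      fix c assume "c \<in> (apolar_locus d M r :: 'a poly poly set set)"
      then obtain g x where g: "c = proj_class g" "g \<in> binary_forms d - {0}" "nonzero_pairs M x"
        "apolar (dual_seq d g) d (\<Sum>i<M. r i) (lprod M r x)" unfolding apolar_locus_def by blast
      \<comment> \<open>All linear forms of the target equal \<open>v\<close>, so its product has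
        full degree \<open>k + 2\<close>, and so has the product at general parameters.\<close>
      define y where "y j = (if even j then 0 else 1 :: 'a)" for j :: nat
      have "lprod M r y = [:0, 1:] ^ 2 * [:0, 1:] ^ k" unfolding shape(1) by (simp add: y_def)
      also have "\<dots> = [:0, 1:] ^ (k + 2)" by (simp only: power_add mult.commute)
      finally have "lprod M r y = [:0, 1:] ^ (k + 2)" .
      then have cy: "coeff (lprod M r y) (k + 2) = 1" by (simp add: coeff_linear_power del: power_Suc)
      obtain A e where A: "e \<noteq> 0" "\<forall>j. curvefun (\<lambda>t. A t j)" "form_of_seq d (A 0) = form_scale e g"
        "\<forall>t. apolar (A t) d (\<Sum>i<M. r i) (lprod M r (lineseg x y t))" 
        using apolar_locus_deform[OF g(2,3,4), of y] by blast
      let ?\<delta> = "\<lambda>t. form_of_seq d (A t)" and ?R = "\<lambda>t. lprod M r (lineseg x y t)"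
      have d0: "?\<delta> 0 \<noteq> 0" using A(1,3) g(2) by simp
      have dc: "curvefun (\<lambda>t. form_coord d (?\<delta> t) j)" if "j \<le> d" for j
        by (rule curvefun_form_of_seq) (use A(2) that in auto)
      have ev1: "\<forall>\<^sub>F t in cofinite. coeff (?R t) (k + 2) \<noteq> 0"
        by (rule curvefun_generic[where ?t0.0=1, OF curvefun_lprod_lineseg]) (use cy in simp)
      have ev2: "\<forall>\<^sub>F t in cofinite. ?\<delta> t \<noteq> 0"
        by (rule form_curve_nonzero[where d=d and ?t0.0=0]) (use dc d0 in auto)
      from ev1 ev2 have "\<forall>\<^sub>F t in cofinite. proj_class (?\<delta> t) \<in> zariski d closure_of (waring_stratum d (d - k))"
      proof eventually_elim
        case (elim t)
        let ?x = "lineseg x y t"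
        have dR: "degree (?R t) = k + 2" using degree_lprod[of M r ?x] le_degree[OF elim(1)] unfolding shape(2) by simp
        have "?x 1 \<noteq> 0"
        proof
          assume "?x 1 = 0"
          then have "?R t = smult (?x 0 ^ 2) (\<Prod>i<k. [:?x (2 * Suc i), ?x (2 * Suc i + 1):])" 
            unfolding shape(1) by (simp add: power2_eq_square)
          then have "degree (?R t) \<le> degree (\<Prod>i<k. [:?x (2 * Suc i), ?x (2 * Suc i + 1):])" by (simp only: degree_smult_le)
          also have "\<dots> \<le> (\<Sum>i<k. degree [:?x (2 * Suc i), ?x (2 * Suc i + 1):])"
            using degree_prod_sum_le[of "{..<k}" "\<lambda>i. [:?x (2 * Suc i), ?x (2 * Suc i + 1):]"] by (simp add: comp_def)
          also have "\<dots> \<le> (\<Sum>i<k. 1)" by (intro sum_mono degree_linear_le)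
          finally show False using dR by simp
        qed
        then have "[:?x 0, ?x 1:] = smult (?x 1) [:- (- ?x 0 / ?x 1), 1:]" by simp
        then have "[:?x 0, ?x 1:] ^ 2 = smult (?x 1 ^ 2) ([:- (- ?x 0 / ?x 1), 1:] ^ 2)" by (simp only: smult_power)
        then have "[:- (- ?x 0 / ?x 1), 1:] ^ 2 dvd [:?x 0, ?x 1:] ^ 2" by (metis dvd_smult dvd_refl)
        then have dv: "[:- (- ?x 0 / ?x 1), 1:] ^ 2 dvd ?R t" unfolding shape(1) by (rule dvd_mult2)
        have "apolar (dual_seq d (?\<delta> t)) d (k + 2) (?R t)"
          using A(4) apolar_cong[of d "dual_seq d (?\<delta> t)" "A t"] dual_seq_form_of_seq unfolding shape(2) by blast
        then show ?case by (rule double_root_in_waring_closure[rotated, OF _ dR dv k(1)]) (use elim(2) in simp)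
      qed
      from zariski_curve_closure[where ?t0.0=0 and \<gamma>="?\<delta>", OF _ dc d0 this]
      have "proj_class (?\<delta> 0) \<in> zariski d closure_of (zariski d closure_of (waring_stratum d (d - k)))" by simp
      then show "c \<in> zariski d closure_of (waring_stratum d (d - k))" 
        unfolding A(3) proj_class_scale[OF A(1)] g(1) by simp
    qed
  qed
qed

theorem proposition2:
  fixes d :: nat and k :: int
  assumes "d > 0"
    and "int d \<ge> int d - k"
    and "int d - k > \<lceil>(real d + 1) / 2\<rceil>"
  shows "zariski d closure_of
           (waring_stratum d (nat (int d - k)) :: 'a::{alg_closed_field, field_char_0} poly poly set set)
         = dual_variety d
             (multiple_root_locus
               ([3] @ replicate (nat k) 2 @ replicate (nat (int d - 2 * k - 3)) 1))"
proof -
  define K where "K = nat k"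
  have k: "k = int K" using assms(2) by (simp add: K_def)
  \<comment> \<open>The rank of a general form; the formula covers both parities of
    \<open>d\<close>.\<close>
  have "\<lceil>(real d + 1) / 2\<rceil> = int (d div 2) + 1"
  proof (rule ceiling_unique)
    have "real (d div 2) \<le> real d / 2" by simp
    then show "real_of_int (int (d div 2) + 1) - 1 < (real d + 1) / 2" by simp
    have "d + 1 \<le> 2 * (d div 2 + 1)" by presburger
    then have "real (d + 1) \<le> real (2 * (d div 2 + 1))" by (rule of_nat_mono)
    then show "(real d + 1) / 2 \<le> real_of_int (int (d div 2) + 1)" by simp
  qed
  \<comment> \<open>The strict inequality supplies the second unit. It also makes
    \<open>d - 2 * K - 3\<close> a true difference, so the parts of the partition really sum to
    \<open>d\<close>.\<close>
  then have bound: "d div 2 + 2 \<le> d - K" using assms(3) k by linarith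
  then have K3: "2 * K + 3 \<le> d" by presburger
  define p where "p = [3] @ replicate K 2 @ replicate (d - 2 * K - 3) (1::nat)"
  \<comment> \<open>The exponents \<open>2, 1, ..., 1, 0, ..., 0\<close> of the annihilator, common
    to both descriptions.\<close>
  define r where "r i = p ! i - 1" for i
  have len: "length p = d - K - 2" using K3 by (simp add: p_def)
  have sum: "(\<Sum>i<length p. p ! i) = d"
  proof -
    have "sum_list p = d" using K3 by (simp add: p_def sum_list_replicate)
    then show ?thesis by (simp only: sum_list_sum_nth atLeast0LessThan)
  qed
  have p0: "p ! 0 = 3" by (simp add: p_def)
  have p1: "p ! i = 2" if "1 \<le> i" "i \<le> K" for i using that by (cases i) (auto simp: p_def nth_append)
  have p2: "p ! i = 1" if "K < i" "i < length p" for i using that by (simp add: p_def nth_append nth_Cons')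
  have pos: "p ! i \<ge> 1" if "i < length p" for i
    using p0 p1[of i] p2[of i] that by (cases "i = 0"; cases "i \<le> K") auto
  have M: "length p \<ge> 1" by (simp add: p_def)
  have "nat (int d - 2 * k - 3) = d - 2 * K - 3" using k K3 by linarith
  then have "dual_variety d (multiple_root_locus ([3] @ replicate (nat k) 2 @ replicate (nat (int d - 2 * k - 3)) 1)) = 
    dual_variety d (locus (length p) ((!) p) :: 'a poly poly set set)"
    unfolding multiple_root_locus_eq by (simp only: p_def K_def)
  also have "\<dots> = apolar_locus d (length p) r"
    using dual_variety_locus[where M="length p" and e="(!) p" and 'a='a] pos M unfolding sum r_def by blast
  also have "\<dots> = zariski d closure_of (waring_stratum d (d - K))"
    by (rule closure_waring_stratum[symmetric]) (use p0 p1 p2 bound K3 len in \<open>auto simp: r_def\<close>)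
  also have "d - K = nat (int d - k)" using k by simp
  finally show ?thesis by simp
qed

end
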